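(* Let $(\rho_k,u_k)\colon(0,\infty)_t\times(0,\infty)_x\to D$, $k=1,\dots,d$, be the solution to the generalized Riemann problem or to the generalized Cauchy problem with initial condition $(\hat\rho_k,\hat u_k)$. Assume that $$-\omega_M\le\omega_1(\hat\rho_k,\hat u_k)(x)<\omega_2(\hat\rho_k,\hat u_k)(x)\le\omega_M\quad\text{for a.e. }x>0,\ k=1,\dots,d.$$ Then $$-\omega_M\le\omega_1(\rho_k,u_k)(t,x)<\omega_2(\rho_k,u_k)(t,x)\le\omega_M\quad\text{for a.e. }t,x>0,\ k=1,\dots,d.$$
   Context: Let $\kappa>0$, $1<\gamma<3$, $\theta=\frac{\gamma-1}2$, $a_\gamma=\frac{2\sqrt{\gamma\kappa}}{\gamma-1}$, $d\in\mathbb N$, $A_1,\dots,A_d>0$ (cross-sectional areas of $d$ pipelines, each modelled by $x>0$, meeting at a junction at $x=0$), and $D=\{(x_0,x_1)\in\mathbb R^2:x_0>0\text{ or }x_0=x_1=0\}$. Here $\omega_M$ is a real constant. The isentropic gas equations are $\partial_t\rho+\partial_x(\rho u)=0$, $\partial_t(\rho u)+\partial_x(\rho u^2+\kappa\rho^\gamma)=0$, with Riemann invariants $\omega_1(\rho,u)=u-a_\gamma\rho^\theta$, $\omega_2(\rho,u)=u+a_\gamma\rho^\theta$. Entropies: with $\lambda=\frac1{\gamma-1}-\frac12$, $J_\lambda=\int_{-1}^1(1-z^2)^\lambda\,\mathrm{d}z$, $c_{\gamma,\kappa}=a_\gamma^{-2/(\gamma-1)}/J_\lambda$ and $\chi(\rho,\xi)=c_{\gamma,\kappa}(a_\gamma^2\rho^{\gamma-1}-\xi^2)_+^\lambda$,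 each convex $S\colon\mathbb R\to\mathbb R$ defines $\eta_S(\rho,u)=\int_{\mathbb R}\chi(\rho,v-u)S(v)\,\mathrm{d}v$ and $G_S(\rho,u)=\int_{\mathbb R}[(1-\theta)u+\theta v]\chi(\rho,v-u)S(v)\,\mathrm{d}v$. A weak entropy solution is a weak solution satisfying $\partial_t\eta_S(\rho,u)+\partial_xG_S(\rho,u)\le0$ for all these entropy pairs. Standard Riemann problem: $\mathcal{RP}(\rho_l,u_l,\rho_r,u_r)(x/t)$ denotes the self-similar weak entropy solution in the sense of Lax with initial data $(\rho_l,u_l)\in D$ for $x<0$ and $(\rho_r,u_r)\in D$ for $x>0$. For $(\rho_b,u_b)\in D$, $\mathcal V(\rho_b,u_b)$ is the set of states $(\rho,u)\in D$ with $(\rho,u)=\mathcal{RP}(\rho_b,u_b,\rho_r,u_r)(0+)$ for some $(\rho_r,u_r)\in D$. Generalized Riemann problem: for constant initial data $(\hat\rho_k,\hat u_k)\in D$, a solution is a family $(\rho_k,u_k)\colon(0,\infty)_t\times(0,\infty)_x\to D$, $k=1,\dots,d$, such that $(\rho_k,u_k)(0+,x)=(\hat\rho_k,\hat u_k)$ for all $x>0$; there is $\rho_*\ge0$, independent of $k$, such that each $(\rho_k,u_k)$ equals the restriction to $x>0$ of the weak entropy solution in the sense of Lax with initial data $(\rho_*,0)$ for $x<0$ and $(\hat\rho_k,\hat u_k)$ for $x>0$; and $\sum_{k=1}^dA_k\bar\rho_k\bar u_k=0$, where $(\bar\rho_k,\bar u_k)=(\rho_k,u_k)(t,0+)$ for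 a.e. $t>0$. Generalized Cauchy problem: let $U^0\in D^d$ be a constant vector of states in the conserved variables $(\rho,\rho u)$, let $(\hat\rho_1,\hat\rho_1\hat u_1,\dots,\hat\rho_d,\hat\rho_d\hat u_d)\in U^0+L^1(0,\infty)_x$ with $(\hat\rho_k,\hat\rho_k\hat u_k)\in D$ a.e., and $T\in(0,\infty]$. A solution is $(\rho_1,\rho_1u_1,\dots,\rho_d,\rho_du_d)\in C([0,T]_t,U^0+L^1(0,\infty)_x)$ such that each $(\rho_k,\rho_ku_k)$ is a weak entropy solution to the isentropic gas equations and: $(\rho_k,u_k)(0+,x)=(\hat\rho_k,\hat u_k)(x)$ for a.e. $x>0$ and all $k$; for a.e. $t>0$ there is $\rho_*(t)\ge0$ such that the traces $(\bar\rho_k,\bar u_k)(t)=(\rho_k,u_k)(t,0+)$ lie in $\mathcal V(\rho_*(t),0)$ for all $k$; and $\sum_{k=1}^dA_k\bar\rho_k\bar u_k=0$ for a.e. $t>0$.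
   Formalization: The strict inequality ω1<ω2 in the conclusion is claimed only where (ρ_k,u_k) is not the vacuum (0,0), since vacuum can form from admissible data; weak solutions are understood as essentially bounded on (0,τ) for every τ<T. *)

theory Defs
  imports "HOL-Analysis.Analysis"
begin

text \<open>States are pairs \<open>(\<rho>, u)\<close> of density and velocity. In vacuum the velocity is normalised
  to \<open>0\<close>, so \<open>D\<close> contains a single vacuum state \<open>(0, 0)\<close>.\<close>

type_synonym state = "real \<times> real"

definition D :: "state set" where
  "D = {(x0, x1). 0 < x0 \<or> (x0 = 0 \<and> x1 = 0)}"

definition theta :: "real \<Rightarrow> real" where
  "theta \<gamma> = (\<gamma> - 1) / 2"

definition a_const :: "real \<Rightarrow> real \<Rightarrow> real" where
  "a_const \<kappa> \<gamma> = 2 * sqrt (\<gamma> * \<kappa>) / (\<gamma> - 1)"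

fun omega1 :: "real \<Rightarrow> real \<Rightarrow> state \<Rightarrow> real" where
  "omega1 \<kappa> \<gamma> (\<rho>, u) = u - a_const \<kappa> \<gamma> * \<rho> powr theta \<gamma>"

fun omega2 :: "real \<Rightarrow> real \<Rightarrow> state \<Rightarrow> real" where
  "omega2 \<kappa> \<gamma> (\<rho>, u) = u + a_const \<kappa> \<gamma> * \<rho> powr theta \<gamma>"

text \<open>Conserved variables and flux; \<open>char1\<close> and \<open>char2\<close> are the characteristic speeds
  \<open>u \<mp> c\<close> with sound speed \<open>c = sqrt (\<kappa> \<gamma> \<rho>\<^sup>\<gamma>\<^sup>-\<^sup>1)\<close>.\<close>

fun conserved :: "state \<Rightarrow> real \<times> real" where
  "conserved (\<rho>, u) = (\<rho>, \<rho> * u)"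

fun flux :: "real \<Rightarrow> real \<Rightarrow> state \<Rightarrow> real \<times> real" where
  "flux \<kappa> \<gamma> (\<rho>, u) = (\<rho> * u, \<rho> * u\<^sup>2 + \<kappa> * \<rho> powr \<gamma>)"

fun char1 :: "real \<Rightarrow> real \<Rightarrow> state \<Rightarrow> real" where
  "char1 \<kappa> \<gamma> (\<rho>, u) = u - sqrt (\<gamma> * \<kappa>) * \<rho> powr theta \<gamma>"

fun char2 :: "real \<Rightarrow> real \<Rightarrow> state \<Rightarrow> real" where
  "char2 \<kappa> \<gamma> (\<rho>, u) = u + sqrt (\<gamma> * \<kappa>) * \<rho> powr theta \<gamma>"

section \<open>Entropy pairs\<close>

definition lam :: "real \<Rightarrow> real" where
  "lam \<gamma> = 1 / (\<gamma> - 1) - 1 / 2"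

definition J_const :: "real \<Rightarrow> real" where
  "J_const \<gamma> = (LINT z:{-1..1}|lborel. (1 - z\<^sup>2) powr lam \<gamma>)"

definition c_const :: "real \<Rightarrow> real \<Rightarrow> real" where
  "c_const \<kappa> \<gamma> = a_const \<kappa> \<gamma> powr (- 2 / (\<gamma> - 1)) / J_const \<gamma>"

definition chi :: "real \<Rightarrow> real \<Rightarrow> real \<Rightarrow> real \<Rightarrow> real" where
  "chi \<kappa> \<gamma> \<rho> \<xi> =
     c_const \<kappa> \<gamma> * (max 0 ((a_const \<kappa> \<gamma>)\<^sup>2 * \<rho> powr (\<gamma> - 1) - \<xi>\<^sup>2)) powr lam \<gamma>"

fun eta :: "real \<Rightarrow> real \<Rightarrow> (real \<Rightarrow> real) \<Rightarrow> state \<Rightarrow> real" where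
  "eta \<kappa> \<gamma> S (\<rho>, u) = (LINT v|lborel. chi \<kappa> \<gamma> \<rho> (v - u) * S v)"

fun entropy_flux :: "real \<Rightarrow> real \<Rightarrow> (real \<Rightarrow> real) \<Rightarrow> state \<Rightarrow> real" where
  "entropy_flux \<kappa> \<gamma> S (\<rho>, u) =
     (LINT v|lborel. ((1 - theta \<gamma>) * u + theta \<gamma> * v) * chi \<kappa> \<gamma> \<rho> (v - u) * S v)"

section \<open>Weak entropy solutions\<close>

text \<open>Space-time points are pairs \<open>(t, x)\<close>; \<open>T\<close> may be infinite.\<close>

definition cylinder :: "ereal \<Rightarrow> real set \<Rightarrow> (real \<times> real) set" where
  "cylinder T X = {(t, x). 0 < t \<and> ereal t < T \<and> x \<in> X}"

text \<open>Compactly supported \<open>C\<^sup>1\<close> test functions \<open>\<phi>\<close>, presented together with their partial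
  derivatives \<open>\<phi>t\<close> and \<open>\<phi>x\<close>.\<close>

definition test_function ::
  "(real \<times> real) set \<Rightarrow> (real \<times> real \<Rightarrow> real) \<Rightarrow> (real \<times> real \<Rightarrow> real) \<Rightarrow> (real \<times> real \<Rightarrow> real) \<Rightarrow> bool"
  where
  "test_function Q \<phi> \<phi>t \<phi>x \<longleftrightarrow>
     (\<exists>K. compact K \<and> K \<subseteq> Q \<and> (\<forall>p. p \<notin> K \<longrightarrow> \<phi> p = 0)) \<and>
     (\<forall>p. (\<phi> has_derivative (\<lambda>(h, k). \<phi>t p * h + \<phi>x p * k)) (at p)) \<and>
     continuous_on UNIV \<phi>t \<and> continuous_on UNIV \<phi>x"

text \<open>Weak solutions are taken in the usual class of measurable, \<open>D\<close>-valued functions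
  that are essentially bounded (locally in time). This makes \<open>eta\<close> and \<open>entropy_flux\<close> of the
  solution locally integrable for every convex \<open>S\<close>; conversely, local integrability
  for all convex \<open>S\<close>, whatever their growth, forces local boundedness.\<close>

definition weak_solution ::
  "real \<Rightarrow> real \<Rightarrow> ereal \<Rightarrow> real set \<Rightarrow> (real \<Rightarrow> real \<Rightarrow> state) \<Rightarrow> bool" where
  "weak_solution \<kappa> \<gamma> T X U \<longleftrightarrow>
     set_borel_measurable lborel (cylinder T X) (\<lambda>(t, x). U t x) \<and>
     (AE (t, x) in lborel. (t, x) \<in> cylinder T X \<longrightarrow> U t x \<in> D) \<and>
     (\<forall>\<tau>. ereal \<tau> < T \<longrightarrow>
        (\<exists>M. AE (t, x) in lborel. (t, x) \<in> cylinder (ereal \<tau>) X \<longrightarrow> norm (U t x) \<le> M)) \<and>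
     (\<forall>\<phi> \<phi>t \<phi>x. test_function (cylinder T X) \<phi> \<phi>t \<phi>x \<longrightarrow>
        (LINT (t, x):cylinder T X|lborel.
           \<phi>t (t, x) *\<^sub>R conserved (U t x) + \<phi>x (t, x) *\<^sub>R flux \<kappa> \<gamma> (U t x)) = 0)"

definition weak_entropy_solution ::
  "real \<Rightarrow> real \<Rightarrow> ereal \<Rightarrow> real set \<Rightarrow> (real \<Rightarrow> real \<Rightarrow> state) \<Rightarrow> bool" where
  "weak_entropy_solution \<kappa> \<gamma> T X U \<longleftrightarrow>
     weak_solution \<kappa> \<gamma> T X U \<and>
     (\<forall>S. convex_on UNIV S \<longrightarrow>
        (\<forall>\<phi> \<phi>t \<phi>x. test_function (cylinder T X) \<phi> \<phi>t \<phi>x \<and> (\<forall>p. 0 \<le> \<phi> p) \<longrightarrow>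
           0 \<le> (LINT (t, x):cylinder T X|lborel.
                  eta \<kappa> \<gamma> S (U t x) * \<phi>t (t, x) + entropy_flux \<kappa> \<gamma> S (U t x) * \<phi>x (t, x))))"

section \<open>The standard Riemann problem\<close>

text \<open>Rankine-Hugoniot conditions and Lax inequalities for a shock of speed \<open>\<sigma>\<close>.\<close>

definition lax_shock1 :: "real \<Rightarrow> real \<Rightarrow> state \<Rightarrow> state \<Rightarrow> real \<Rightarrow> bool" where
  "lax_shock1 \<kappa> \<gamma> Ul Ur \<sigma> \<longleftrightarrow>
     0 < fst Ul \<and> 0 < fst Ur \<and>
     \<sigma> *\<^sub>R (conserved Ur - conserved Ul) = flux \<kappa> \<gamma> Ur - flux \<kappa> \<gamma> Ul \<and>
     char1 \<kappa> \<gamma> Ur < \<sigma> \<and> \<sigma> < char1 \<kappa> \<gamma> Ul \<and> \<sigma> < char2 \<kappa> \<gamma> Ur"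

definition lax_shock2 :: "real \<Rightarrow> real \<Rightarrow> state \<Rightarrow> state \<Rightarrow> real \<Rightarrow> bool" where
  "lax_shock2 \<kappa> \<gamma> Ul Ur \<sigma> \<longleftrightarrow>
     0 < fst Ul \<and> 0 < fst Ur \<and>
     \<sigma> *\<^sub>R (conserved Ur - conserved Ul) = flux \<kappa> \<gamma> Ur - flux \<kappa> \<gamma> Ul \<and>
     char2 \<kappa> \<gamma> Ur < \<sigma> \<and> \<sigma> < char2 \<kappa> \<gamma> Ul \<and> char1 \<kappa> \<gamma> Ul < \<sigma>"

text \<open>Centred rarefaction waves of the profile \<open>W\<close> on the interval \<open>(a, b)\<close> of speeds
  \<open>\<xi> = x / t\<close>. The state at the low-density end may be the vacuum; as \<open>\<rho>\<close> tends to \<open>0\<close>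
  along the wave, the characteristic speed then tends to the value of the Riemann
  invariant that is constant along the wave.\<close>

definition rarefaction1 ::
  "real \<Rightarrow> real \<Rightarrow> state \<Rightarrow> state \<Rightarrow> real \<Rightarrow> real \<Rightarrow> (real \<Rightarrow> state) \<Rightarrow> bool" where
  "rarefaction1 \<kappa> \<gamma> Ul Ur a b W \<longleftrightarrow>
     fst Ur < fst Ul \<and>
     a = char1 \<kappa> \<gamma> Ul \<and>
     (if Ur = (0, 0) then b = omega2 \<kappa> \<gamma> Ul
      else b = char1 \<kappa> \<gamma> Ur \<and> omega2 \<kappa> \<gamma> Ur = omega2 \<kappa> \<gamma> Ul) \<and>
     (\<forall>\<xi>\<in>{a<..<b}. 0 < fst (W \<xi>) \<and> omega2 \<kappa> \<gamma> (W \<xi>) = omega2 \<kappa> \<gamma> Ul \<and> char1 \<kappa> \<gamma> (W \<xi>) = \<xi>)"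

definition rarefaction2 ::
  "real \<Rightarrow> real \<Rightarrow> state \<Rightarrow> state \<Rightarrow> real \<Rightarrow> real \<Rightarrow> (real \<Rightarrow> state) \<Rightarrow> bool" where
  "rarefaction2 \<kappa> \<gamma> Ul Ur a b W \<longleftrightarrow>
     fst Ul < fst Ur \<and>
     b = char2 \<kappa> \<gamma> Ur \<and>
     (if Ul = (0, 0) then a = omega1 \<kappa> \<gamma> Ur
      else a = char2 \<kappa> \<gamma> Ul \<and> omega1 \<kappa> \<gamma> Ul = omega1 \<kappa> \<gamma> Ur) \<and>
     (\<forall>\<xi>\<in>{a<..<b}. 0 < fst (W \<xi>) \<and> omega1 \<kappa> \<gamma> (W \<xi>) = omega1 \<kappa> \<gamma> Ur \<and> char2 \<kappa> \<gamma> (W \<xi>) = \<xi>)"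

text \<open>A Lax fan: \<open>Ul\<close>, a 1-wave, a middle state, a 2-wave, \<open>Ur\<close>. Each wave may be absent.
  The middle state may be the vacuum. Values at the
  (at most four) edges of the waves are left open.\<close>

definition lax_fan :: "real \<Rightarrow> real \<Rightarrow> state \<Rightarrow> state \<Rightarrow> (real \<Rightarrow> state) \<Rightarrow> bool" where
  "lax_fan \<kappa> \<gamma> Ul Ur W \<longleftrightarrow>
     (\<forall>\<xi>. W \<xi> \<in> D) \<and>
     (\<exists>Um\<in>D. \<exists>a1 b1 a2 b2. a1 \<le> b1 \<and> b1 \<le> a2 \<and> a2 \<le> b2 \<and>
        (\<forall>\<xi><a1. W \<xi> = Ul) \<and>
        (Ul = Um \<and> a1 = b1 \<or> lax_shock1 \<kappa> \<gamma> Ul Um a1 \<and> a1 = b1 \<or> rarefaction1 \<kappa> \<gamma> Ul Um a1 b1 W) \<and>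
        (\<forall>\<xi>\<in>{b1<..<a2}. W \<xi> = Um) \<and>
        (Um = Ur \<and> a2 = b2 \<or> lax_shock2 \<kappa> \<gamma> Um Ur a2 \<and> a2 = b2 \<or> rarefaction2 \<kappa> \<gamma> Um Ur a2 b2 W) \<and>
        (\<forall>\<xi>>b2. W \<xi> = Ur))"

text \<open>\<open>W\<close> is the profile \<open>RP(Ul, Ur)\<close> of the self-similar weak entropy solution
  in the sense of Lax, unique up to its values at the edges of the waves.\<close>

definition riemann_solution :: "real \<Rightarrow> real \<Rightarrow> state \<Rightarrow> state \<Rightarrow> (real \<Rightarrow> state) \<Rightarrow> bool" where
  "riemann_solution \<kappa> \<gamma> Ul Ur W \<longleftrightarrow>
     lax_fan \<kappa> \<gamma> Ul Ur W \<and> weak_entropy_solution \<kappa> \<gamma> \<infinity> UNIV (\<lambda>t x. W (x / t))"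

definition V_set :: "real \<Rightarrow> real \<Rightarrow> state \<Rightarrow> state set" where
  "V_set \<kappa> \<gamma> Ub =
     {U \<in> D. \<exists>Ur\<in>D. \<exists>W. riemann_solution \<kappa> \<gamma> Ub Ur W \<and> (W \<longlongrightarrow> U) (at_right 0)}"

section \<open>The generalized problems at the junction\<close>

text \<open>The pipelines are numbered \<open>1, \<dots>, d\<close>; \<open>U k t x\<close> is the state in pipeline \<open>k\<close>.\<close>

definition generalized_riemann_solution ::
  "real \<Rightarrow> real \<Rightarrow> nat \<Rightarrow> (nat \<Rightarrow> real) \<Rightarrow> (nat \<Rightarrow> state) \<Rightarrow> (nat \<Rightarrow> real \<Rightarrow> real \<Rightarrow> state) \<Rightarrow> bool"
  where
  "generalized_riemann_solution \<kappa> \<gamma> d A Uhat U \<longleftrightarrow>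
     (\<forall>k\<in>{1..d}. Uhat k \<in> D) \<and>
     (\<forall>k\<in>{1..d}. \<forall>t>0. \<forall>x>0. U k t x \<in> D) \<and>
     (\<forall>k\<in>{1..d}. \<forall>x>0. ((\<lambda>t. U k t x) \<longlongrightarrow> Uhat k) (at_right 0)) \<and>
     (\<exists>\<rho>s\<ge>0. \<forall>k\<in>{1..d}. \<exists>W. riemann_solution \<kappa> \<gamma> (\<rho>s, 0) (Uhat k) W \<and>
        (\<forall>t>0. \<forall>x>0. U k t x = W (x / t))) \<and>
     (AE t in lborel. 0 < t \<longrightarrow>
        (\<exists>Ubar. (\<forall>k\<in>{1..d}. (U k t \<longlongrightarrow> Ubar k) (at_right 0)) \<and>
                (\<Sum>k=1..d. A k * fst (Ubar k) * snd (Ubar k)) = 0))"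

text \<open>The trace \<open>f(0+)\<close> of a function defined up to null sets: an essential limit.\<close>

definition has_right_trace :: "(real \<Rightarrow> state) \<Rightarrow> state \<Rightarrow> bool" where
  "has_right_trace f l \<longleftrightarrow>
     (\<forall>e>0. \<exists>\<delta>>0. AE x in lborel. 0 < x \<and> x < \<delta> \<longrightarrow> dist (f x) l < e)"

text \<open>\<open>U0\<close> is in conserved variables, \<open>Uhat\<close> and \<open>U\<close> are in the variables \<open>(\<rho>, u)\<close>. For \<open>T = \<infinity>\<close>
  the time interval \<open>[0, T]\<close> is read as \<open>[0, \<infinity>)\<close>. The initial condition at \<open>t = 0+\<close> is
  attained in the topology of the solution space.\<close>

definition generalized_cauchy_solution ::
  "real \<Rightarrow> real \<Rightarrow> nat \<Rightarrow> (nat \<Rightarrow> real) \<Rightarrow> ereal \<Rightarrow> (nat \<Rightarrow> real \<times> real) \<Rightarrow> (nat \<Rightarrow> real \<Rightarrow> state) \<Rightarrow>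
   (nat \<Rightarrow> real \<Rightarrow> real \<Rightarrow> state) \<Rightarrow> bool" where
  "generalized_cauchy_solution \<kappa> \<gamma> d A T U0 Uhat U \<longleftrightarrow>
     0 < T \<and>
     (\<forall>k\<in>{1..d}.
        U0 k \<in> D \<and>
        (AE x in lborel. 0 < x \<longrightarrow> Uhat k x \<in> D) \<and>
        set_integrable lborel {0<..} (\<lambda>x. conserved (Uhat k x) - U0 k) \<and>
        (\<forall>t. 0 \<le> t \<and> ereal t \<le> T \<longrightarrow>
           (AE x in lborel. 0 < x \<longrightarrow> U k t x \<in> D) \<and>
           set_integrable lborel {0<..} (\<lambda>x. conserved (U k t x) - U0 k) \<and>
           ((\<lambda>s. LINT x:{0<..}|lborel. norm (conserved (U k s x) - conserved (U k t x))) \<longlongrightarrow> 0)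
             (at t within {s. 0 \<le> s \<and> ereal s \<le> T})) \<and>
        weak_entropy_solution \<kappa> \<gamma> T {0<..} (U k) \<and>
        ((\<lambda>t. LINT x:{0<..}|lborel. norm (conserved (U k t x) - conserved (Uhat k x))) \<longlongrightarrow> 0)
          (at_right 0)) \<and>
     (AE t in lborel. 0 < t \<and> ereal t < T \<longrightarrow>
        (\<exists>\<rho>s\<ge>0. \<exists>Ubar.
           (\<forall>k\<in>{1..d}. has_right_trace (U k t) (Ubar k) \<and> Ubar k \<in> V_set \<kappa> \<gamma> (\<rho>s, 0)) \<and>
           (\<Sum>k=1..d. A k * fst (Ubar k) * snd (Ubar k)) = 0))"

end

(*
  Proof idea.  For the even convex function S(v) = (|v| - \<omega>M)_+ the entropy \<eta>_S vanishes exactly on the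
  states with -\<omega>M \<le> \<omega>_1 and \<omega>_2 \<le> \<omega>M.  Writing \<eta>_S(\<rho>, u) = \<rho> E S(u + a \<rho>^\<theta> Z), with Z distributed
  with density (1 - z^2)^\<lambda> / J, symmetry of Z and convexity of \<rho> S(a \<rho>^\<theta> z) in \<rho> show that \<eta>_S has a
  supporting affine function \<eta>_S(\<rho>s, 0) + c (\<rho> - \<rho>s) at (\<rho>s, 0), while G_S(\<rho>s, 0) = 0.  The entropy
  inequality for S - c on the Riemann solution starting from (\<rho>s, 0) then gives G_S \<le> c \<rho> u for every
  state in V(\<rho>s, 0).  Since c is the same in all pipelines, conservation of mass yields
  \<Sum>_k A_k G_S \<le> 0 at the junction.  As |G_S| \<le> M \<eta>_S, testing on a backward cone shows that the total
  entropy, which is zero initially, stays zero.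
*)

theory Submission
  imports Defs
begin

section \<open>Smooth cutoffs\<close>

text \<open>A junction balances mass only. Hence the one linear functional that may be subtracted
  from the entropy is c \<rho>, whose flux c \<rho> u cancels in the sum over the pipelines; a term
  in \<rho> u would bring in momentum fluxes, on whose sum there is no control. This is what makes
  an even S, treating both invariants at once, the right choice: at a state of velocity 0 the
  support then has no \<rho> u part. Either sign of c is harmless, because S - c stays convex and a
  constant S yields a multiple of the pair (\<rho>, \<rho> u). For a self-similar solution put \<xi>
  = x / t, q = \<eta> - c \<rho>, g = G - c \<rho> u, and let e be the value of q at (\<rho>s, 0).
  The entropy inequality says that the distributional derivative of g - \<xi> (q - e) is at most -(q
  - e), and the support property makes this nonpositive. The quantity is 0 far to the left and tends
  to the trace of g at \<xi> = 0+, which gives the sign of the boundary flux. The trace controls the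
  total flux from above only, and the bound M on the propagation speed exists only up to times
  \<tau> < T; this dictates one-sided limits at the junction and an exhaustion in \<tau>.\<close>

definition posq :: "real \<Rightarrow> real" where
  "posq x = (max 0 x)\<^sup>2"

text \<open>Test functions need only be C^1, so quadratic pieces suffice: 2 x^2 up to 1/2, then 1 -
  2 (1 - x)^2 up to 1, then the constant 1. The derivative \<open>step'\<close> is the tent of
  height 2 over [0, 1], the source of the factors 2 in the estimates below.\<close>

definition step :: "real \<Rightarrow> real" where
  "step x = 2 * posq x - 4 * posq (x - 1/2) + 2 * posq (x - 1)"

definition step' :: "real \<Rightarrow> real" where
  "step' x = 4 * max 0 x - 8 * max 0 (x - 1/2) + 4 * max 0 (x - 1)"

lemma posq_real_derivative: "(posq has_real_derivative 2 * max 0 x) (at x)"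
proof (cases x "0::real" rule: linorder_cases)
  case less
  have "((\<lambda>x. 0) has_real_derivative 0) (at x)"
    by simp
  then have "(posq has_real_derivative 0) (at x)"
    by (rule has_field_derivative_transform_within_open[of _ _ _ "{..<0}"])
       (use less in \<open>auto simp: posq_def max_def\<close>)
  then show ?thesis
    using less by (simp add: max_def)
next
  case equal
  have "((\<lambda>h. max 0 h) \<longlongrightarrow> (0::real)) (at 0)"
    by (rule tendsto_eq_intros | simp)+
  then have "((\<lambda>h. posq h / h) \<longlongrightarrow> 0) (at 0)"
    by (rule Lim_transform_eventually)
       (auto simp: posq_def max_def power2_eq_square eventually_at_filter)
  then show ?thesis
    using equal by (simp add: DERIV_def posq_def)
next
  case greater
  have "((\<lambda>x. x\<^sup>2) has_real_derivative 2 * x) (at x)"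
    by (auto intro!: derivative_eq_intros)
  then have "(posq has_real_derivative 2 * x) (at x)"
    by (rule has_field_derivative_transform_within_open[of _ _ _ "{0<..}"])
       (use greater in \<open>auto simp: posq_def max_def\<close>)
  then show ?thesis
    using greater by (simp add: max_def)
qed

lemma posq_has_derivative [derivative_intros]:
  assumes "(f has_derivative f') (at x within A)"
  shows "((\<lambda>x. posq (f x)) has_derivative (\<lambda>h. 2 * max 0 (f x) * f' h)) (at x within A)"
  using DERIV_compose_FDERIV[OF posq_real_derivative assms] by (simp add: mult.commute)

lemma step_has_derivative [derivative_intros]:
  assumes "(f has_derivative f') (at x within A)"
  shows "((\<lambda>x. step (f x)) has_derivative (\<lambda>h. step' (f x) * f' h)) (at x within A)"
  unfolding step_def step'_def
  by (rule derivative_eq_intros assms refl)+ (auto simp: algebra_simps)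

lemma posq_has_field_derivative [derivative_intros]:
  "(f has_real_derivative f') (at x within A) \<Longrightarrow>
   ((\<lambda>x. posq (f x)) has_real_derivative 2 * max 0 (f x) * f') (at x within A)"
  using posq_has_derivative[of f "(*) f'" x A]
  unfolding has_field_derivative_def by (simp add: mult.assoc[abs_def])

lemma step_has_field_derivative [derivative_intros]:
  "(f has_real_derivative f') (at x within A) \<Longrightarrow>
   ((\<lambda>x. step (f x)) has_real_derivative step' (f x) * f') (at x within A)"
  using step_has_derivative[of f "(*) f'" x A]
  unfolding has_field_derivative_def by (simp add: mult.assoc[abs_def])

lemma continuous_on_posq [continuous_intros]:
  "continuous_on A f \<Longrightarrow> continuous_on A (\<lambda>x. posq (f x))"
  unfolding posq_def by (intro continuous_intros)

lemma continuous_on_step [continuous_intros]: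
  "continuous_on A f \<Longrightarrow> continuous_on A (\<lambda>x. step (f x))"
  unfolding step_def by (intro continuous_intros)

lemma continuous_on_step' [continuous_intros]:
  "continuous_on A f \<Longrightarrow> continuous_on A (\<lambda>x. step' (f x))"
  unfolding step'_def by (intro continuous_intros)

lemma posq_measurable [measurable]: "posq \<in> borel_measurable borel"
  unfolding posq_def[abs_def] by measurable

lemma step_measurable [measurable]: "step \<in> borel_measurable borel"
  unfolding step_def[abs_def] by measurable

lemma step'_measurable [measurable]: "step' \<in> borel_measurable borel"
  unfolding step'_def[abs_def] by measurable

lemma posq_nonneg [simp]: "0 \<le> posq x"
  by (simp add: posq_def)

lemma posq_eq_0 [simp]: "x \<le> 0 \<Longrightarrow> posq x = 0"
  by (simp add: posq_def)

lemma posq_pos: "0 < x \<Longrightarrow> 0 < posq x"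
  by (simp add: posq_def)

lemma posq_mono: "x \<le> y \<Longrightarrow> posq x \<le> posq y"
  unfolding posq_def by (intro power_mono) auto

lemma step'_nonneg [simp]: "0 \<le> step' x"
  by (simp add: step'_def max_def)

lemma step'_le: "step' x \<le> 2"
  by (simp add: step'_def max_def)

lemma step'_eq_0: "x \<le> 0 \<or> 1 \<le> x \<Longrightarrow> step' x = 0"
  by (auto simp: step'_def max_def)

lemma step_eq_0 [simp]: "x \<le> 0 \<Longrightarrow> step x = 0"
  by (simp add: step_def)

lemma step_eq_1 [simp]: "1 \<le> x \<Longrightarrow> step x = 1"
  by (simp add: step_def posq_def max_def power2_eq_square algebra_simps)

lemma step_mono: "x \<le> y \<Longrightarrow> step x \<le> step y"
  by (rule DERIV_nonneg_imp_nondecreasing[of x y step])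
     (auto intro!: exI[of _ "step' _"] derivative_eq_intros)

lemma step_nonneg [simp]: "0 \<le> step x"
  using step_mono[of 0 x] by (cases "x \<le> 0") auto

lemma step_le_1 [simp]: "step x \<le> 1"
  using step_mono[of x 1] by (cases "x \<ge> 1") auto

lemma step_pos: "0 < x \<Longrightarrow> 0 < step x"
proof -
  assume x: "0 < x"
  \<comment> \<open>Up to 1/4 only the first quadratic piece is active, so positivity can be read
    off; monotonicity carries it to larger arguments.\<close>
  have "0 < step (min x (1/4))"
    using x by (auto simp: step_def posq_def max_def min_def)
  also have "\<dots> \<le> step x"
    by (intro step_mono) auto
  finally show ?thesis .
qed

section \<open>Vanishing of an entropy with dissipative boundary flux\<close>

text \<open>Entropies and fluxes are only essentially bounded; they are always paired with a
  continuous derivative of a test function, whose compact support supplies the finite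
  measure.\<close>

lemma integrable_mult_compact_support:
  fixes h q :: "'a::euclidean_space \<Rightarrow> real"
  assumes "continuous_on UNIV h" "compact K" "\<And>p. p \<notin> K \<Longrightarrow> h p = 0"
    and q: "q \<in> borel_measurable borel" and C: "AE p in lborel. p \<in> K \<longrightarrow> \<bar>q p\<bar> \<le> C"
  shows "integrable lborel (\<lambda>p. q p * h p)"
proof -
  have "bounded (h ` K)"
    using assms by (intro compact_imp_bounded compact_continuous_image continuous_on_subset[OF assms(1)]) auto
  then obtain B where B: "\<And>p. p \<in> K \<Longrightarrow> \<bar>h p\<bar> \<le> B"
    by (auto simp: bounded_iff)
  have h: "h \<in> borel_measurable borel"
    using assms(1) by (rule borel_measurable_continuous_onI)
  show ?thesis
  proof (rule integrableI_bounded_set[where A = K and B = "C * B"])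
    show "K \<in> sets lborel"
      using assms by (simp add: compact_imp_closed borel_closed)
    show "(\<lambda>p. q p * h p) \<in> borel_measurable lborel"
      using q h by simp
    show "emeasure lborel K < \<infinity>"
      using assms by (intro emeasure_bounded_finite compact_imp_bounded)
    show "AE p in lborel. p \<in> K \<longrightarrow> norm (q p * h p) \<le> C * B"
      using C by eventually_elim (auto simp: abs_mult intro!: mult_mono B)
    show "AE p in lborel. p \<notin> K \<longrightarrow> q p * h p = 0"
      using assms by simp
  qed
qed

text \<open>The kernel lives on [\<epsilon>, 2 \<epsilon>] and has height at most 2 / \<epsilon>.
  Only an upper bound on \<open>h\<close> enters, because the boundary flux is controlled from one
  side only.\<close>

lemma integral_step'_le:
  assumes "0 < \<epsilon>" "0 \<le> c" and h: "AE x in lborel. \<epsilon> < x \<and> x < 2 * \<epsilon> \<longrightarrow> h x \<le> c"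
  shows "(LINT x|lborel. h x * (step' (x / \<epsilon> - 1) / \<epsilon>)) \<le> 2 * c"
proof (cases "integrable lborel (\<lambda>x. h x * (step' (x / \<epsilon> - 1) / \<epsilon>))")
  case True
  have "(LINT x|lborel. h x * (step' (x / \<epsilon> - 1) / \<epsilon>)) \<le>
        (LINT x|lborel. indicator {\<epsilon>..2 * \<epsilon>} x * (2 * c / \<epsilon>))"
  proof (rule integral_mono_AE[OF True])
    show "integrable lborel (\<lambda>x. indicator {\<epsilon>..2 * \<epsilon>} x * (2 * c / \<epsilon>) :: real)"
      using assms by (intro integrable_mult_left integrable_real_indicator) (auto simp: emeasure_lborel_Icc_eq)
    show "AE x in lborel. h x * (step' (x / \<epsilon> - 1) / \<epsilon>) \<le> indicator {\<epsilon>..2 * \<epsilon>} x * (2 * c / \<epsilon>)"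
      using h
    proof eventually_elim
      case (elim x)
      show ?case
      proof (cases "\<epsilon> < x \<and> x < 2 * \<epsilon>")
        case True
        then have "h x * step' (x / \<epsilon> - 1) \<le> c * 2"
          using elim assms step'_le by (intro mult_mono) auto
        then show ?thesis
          using True assms by (simp add: divide_right_mono mult.commute)
      next
        case False
        then have "step' (x / \<epsilon> - 1) = 0"
          using assms by (intro step'_eq_0) (auto simp: field_simps)
        then show ?thesis
          using assms by simp
      qed
    qed
  qed
  also have "\<dots> = 2 * c"
    using assms by simp
  finally show ?thesis .
next
  \<comment> \<open>A non-integrable function has integral 0 by convention, and 0 \<le> 2 c.\<close>
  case False
  then have "(LINT x|lborel. h x * (step' (x / \<epsilon> - 1) / \<epsilon>)) = 0"
    by (rule not_integrable_integral_eq)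
  then show ?thesis
    using assms by simp
qed

text \<open>\<open>A\<close> switches on after time \<delta> and decays to 0 at \<sigma>,
  \<open>Z\<close> switches on away from the junction, and \<open>B\<close> is supported in the
  backward cone x + M t \<le> R. Since \<open>B\<close> depends on x + M t only, its time derivative
  is M times its space derivative, which is what makes the lateral terms have a sign. The cone opens
  towards t = 0, so at positive times the support stays left of R.\<close>

lemma entropy_test_function:
  fixes M R \<delta> \<epsilon> \<sigma> \<tau> :: real
  assumes "0 < \<delta>" "0 < \<epsilon>" "\<sigma> < \<tau>" "0 \<le> M"
  defines "A \<equiv> \<lambda>t. step (t / \<delta> - 1) * posq (\<sigma> - t)"
    and "A' \<equiv> \<lambda>t. step' (t / \<delta> - 1) / \<delta> * posq (\<sigma> - t) - step (t / \<delta> - 1) * (2 * max 0 (\<sigma> - t))"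
    and "Z \<equiv> \<lambda>x. step (x / \<epsilon> - 1)"
    and "Z' \<equiv> \<lambda>x. step' (x / \<epsilon> - 1) / \<epsilon>"
    and "B \<equiv> \<lambda>t x. posq (R - x - M * t)"
    and "B' \<equiv> \<lambda>t x. 2 * max 0 (R - x - M * t)"
  shows "test_function (cylinder (ereal \<tau>) {0<..}) (\<lambda>(t, x). A t * Z x * B t x)
    (\<lambda>(t, x). A' t * Z x * B t x - A t * Z x * B' t x * M)
    (\<lambda>(t, x). A t * Z' x * B t x - A t * Z x * B' t x)"
    "\<And>t x. (t, x) \<notin> {\<delta>..\<sigma>} \<times> {\<epsilon>..R} \<Longrightarrow> A t * Z x * B t x = 0"
proof -
  show *: "A t * Z x * B t x = 0" if out: "(t, x) \<notin> {\<delta>..\<sigma>} \<times> {\<epsilon>..R}" for t x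
  proof -
    consider "t < \<delta>" | "\<sigma> < t" | "x < \<epsilon>" | "\<delta> \<le> t" "R < x"
      by (metis out mem_Sigma_iff atLeastAtMost_iff not_le)
    then show ?thesis
    proof cases
      case 4
      then have "0 \<le> M * t"
        using assms by (intro mult_nonneg_nonneg) auto
      then have "R - x - M * t \<le> 0"
        using 4 by simp
      then show ?thesis
        by (simp add: B_def)
    qed (use assms in \<open>simp_all add: A_def Z_def field_simps\<close>)
  qed
  show "test_function (cylinder (ereal \<tau>) {0<..}) (\<lambda>(t, x). A t * Z x * B t x)
    (\<lambda>(t, x). A' t * Z x * B t x - A t * Z x * B' t x * M)
    (\<lambda>(t, x). A t * Z' x * B t x - A t * Z x * B' t x)"
    unfolding test_function_def
  proof (intro conjI allI)
    show "\<exists>K. compact K \<and> K \<subseteq> cylinder (ereal \<tau>) {0<..} \<and>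
        (\<forall>p. p \<notin> K \<longrightarrow> (case p of (t, x) \<Rightarrow> A t * Z x * B t x) = 0)"
      using * assms(1-4)
      by (intro exI[of _ "{\<delta>..\<sigma>} \<times> {\<epsilon>..R}"])
         (force simp: cylinder_def intro!: compact_Times)
    show "((\<lambda>(t, x). A t * Z x * B t x) has_derivative
        (\<lambda>(h, k). (case p of (t, x) \<Rightarrow> A' t * Z x * B t x - A t * Z x * B' t x * M) * h +
          (case p of (t, x) \<Rightarrow> A t * Z' x * B t x - A t * Z x * B' t x) * k)) (at p)" for p
      unfolding A_def A'_def B_def B'_def Z_def Z'_def case_prod_beta
      using assms(1,2)
      by (auto intro!: derivative_eq_intros simp: algebra_simps fun_eq_iff)
    show "continuous_on UNIV (\<lambda>(t, x). A' t * Z x * B t x - A t * Z x * B' t x * M)"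
      "continuous_on UNIV (\<lambda>(t, x). A t * Z' x * B t x - A t * Z x * B' t x)"
      unfolding A_def A'_def B_def B'_def Z_def Z'_def case_prod_beta
      using assms(1,2) by (auto intro!: continuous_intros)
  qed
qed

text \<open>Testing with the cone function leaves three contributions besides the lateral one: a
  good term from the decay towards \<sigma>, an initial layer, and a boundary layer. Both layers
  become negligible as \<delta> and \<epsilon> shrink, and since \<open>Q\<close> is nonnegative the
  good term can vanish only if \<open>Q\<close> does.\<close>

lemma entropy_vanishes:
  fixes Q G :: "real \<times> real \<Rightarrow> real" and \<tau> M C :: real
  assumes M: "0 \<le> M"
    and Q [measurable]: "Q \<in> borel_measurable borel" and G [measurable]: "G \<in> borel_measurable borel"
    and Q0: "\<And>p. 0 \<le> Q p" and QC: "\<And>p. Q p \<le> C" and GQ: "\<And>p. \<bar>G p\<bar> \<le> M * Q p"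
    and ineq: "\<And>\<phi> \<phi>t \<phi>x. test_function (cylinder (ereal \<tau>) {0<..}) \<phi> \<phi>t \<phi>x \<Longrightarrow> (\<And>p. 0 \<le> \<phi> p) \<Longrightarrow>
        0 \<le> (LINT p|lborel. Q p * \<phi>t p + G p * \<phi>x p)"
    and init: "\<And>R e. 0 < e \<Longrightarrow> \<exists>\<delta>>0. AE t in lborel. 0 < t \<and> t < \<delta> \<longrightarrow>
        (LINT x:{0<..<R}|lborel. Q (t, x)) \<le> e"
    and trace: "AE t in lborel. 0 < t \<and> t < \<tau> \<longrightarrow>
        (\<forall>e>0. \<exists>\<delta>>0. AE x in lborel. 0 < x \<and> x < \<delta> \<longrightarrow> G (t, x) \<le> e)"
  shows "AE (t, x) in lborel. 0 < t \<and> t < \<tau> \<and> 0 < x \<longrightarrow> Q (t, x) = 0"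
proof -
  have Q' [measurable]: "Q \<in> borel_measurable (borel \<Otimes>\<^sub>M borel)"
    and G' [measurable]: "G \<in> borel_measurable (borel \<Otimes>\<^sub>M borel)"
    using Q G by (simp_all add: borel_prod)
  have C: "0 \<le> C"
    using Q0 QC order_trans by blast
  have Qabs: "\<bar>Q p\<bar> \<le> C" and Gabs: "\<bar>G p\<bar> \<le> M * C" for p
    using Q0[of p] QC[of p] GQ[of p] M by (auto intro: order_trans mult_left_mono)
  define A where "A \<delta> \<sigma> t = step (t / \<delta> - 1) * posq (\<sigma> - t)" for \<delta> \<sigma> t
  define A1 where "A1 \<delta> \<sigma> t = step' (t / \<delta> - 1) / \<delta> * posq (\<sigma> - t)" for \<delta> \<sigma> t
  define A2 where "A2 \<delta> \<sigma> t = step (t / \<delta> - 1) * (2 * max 0 (\<sigma> - t))" for \<delta> \<sigma> t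
  define Z where "Z \<epsilon> x = step (x / \<epsilon> - 1)" for \<epsilon> x
  define Z' where "Z' \<epsilon> x = step' (x / \<epsilon> - 1) / \<epsilon>" for \<epsilon> x
  define B where "B R t x = posq (R - x - M * t)" for R t x
  define B' where "B' R t x = 2 * max 0 (R - x - M * t)" for R t x
  note defs = A_def A1_def A2_def Z_def Z'_def B_def B'_def
  have meas [measurable]: "A \<delta> \<sigma> \<in> borel_measurable borel" "A1 \<delta> \<sigma> \<in> borel_measurable borel"
    "A2 \<delta> \<sigma> \<in> borel_measurable borel" "Z \<epsilon> \<in> borel_measurable borel" "Z' \<epsilon> \<in> borel_measurable borel"
    "(\<lambda>p. B R (fst p) (snd p)) \<in> borel_measurable (borel \<Otimes>\<^sub>M borel)"
    "(\<lambda>p. B' R (fst p) (snd p)) \<in> borel_measurable (borel \<Otimes>\<^sub>M borel)" for \<delta> \<sigma> \<epsilon> R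
    unfolding defs[abs_def] by measurable
  have nonneg: "0 \<le> A \<delta> \<sigma> t" "0 \<le> Z \<epsilon> x" "0 \<le> B R t x" "0 \<le> B' R t x" for \<delta> \<sigma> t \<epsilon> x R
    by (simp_all add: defs)

  have key: "AE p in lborel. Q p * (A2 \<delta>0 \<sigma> (fst p) * Z \<epsilon>0 (snd p) * B R (fst p) (snd p)) = 0"
    if pos: "0 < \<delta>0" "0 < \<epsilon>0" "0 < \<sigma>" "\<sigma> < \<tau>" "0 < R" for \<delta>0 \<epsilon>0 \<sigma> R
  proof -
    \<comment> \<open>\<open>w\<close> comes from the decay of \<open>posq (\<sigma> - t)\<close>,
      \<open>a\<close> from the switching on at times in [\<delta>, 2 \<delta>], and
      \<open>b\<close> from the switching on at positions in [\<epsilon>, 2 \<epsilon>].\<close>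
    define w where "w \<delta> \<epsilon> = (\<lambda>p. A2 \<delta> \<sigma> (fst p) * Z \<epsilon> (snd p) * B R (fst p) (snd p))" for \<delta> \<epsilon>
    define a where "a \<delta> \<epsilon> = (\<lambda>p. A1 \<delta> \<sigma> (fst p) * Z \<epsilon> (snd p) * B R (fst p) (snd p))" for \<delta> \<epsilon>
    define b where "b \<delta> \<epsilon> = (\<lambda>p. A \<delta> \<sigma> (fst p) * Z' \<epsilon> (snd p) * B R (fst p) (snd p))" for \<delta> \<epsilon>
    have zero: "w \<delta> \<epsilon> p = 0 \<and> a \<delta> \<epsilon> p = 0 \<and> b \<delta> \<epsilon> p = 0" if out: "p \<notin> {\<delta>..\<sigma>} \<times> {\<epsilon>..R}" and "0 < \<delta>" "0 < \<epsilon>" for p \<delta> \<epsilon>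
    proof -
      obtain t x where p: "p = (t, x)"
        by (cases p)
      consider "t < \<delta>" | "\<sigma> < t" | "x < \<epsilon>" | "\<delta> \<le> t" "R < x"
        by (metis out p mem_Sigma_iff atLeastAtMost_iff not_le)
      then show ?thesis
      proof cases
        case 1
        then have "t / \<delta> - 1 \<le> 0"
          using that by (simp add: field_simps)
        then show ?thesis
          by (simp add: p w_def a_def b_def defs step'_eq_0)
      next
        case 2
        then show ?thesis
          by (simp add: p w_def a_def b_def defs)
      next
        case 3
        then have "x / \<epsilon> - 1 \<le> 0"
          using that by (simp add: field_simps)
        then show ?thesis
          by (simp add: p w_def a_def b_def defs step'_eq_0)
      next
        case 4
        then have "0 \<le> M * t"
          using that M by (intro mult_nonneg_nonneg) auto
        then have "R - x - M * t \<le> 0"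
          using 4 by simp
        then show ?thesis
          by (simp add: p w_def a_def b_def defs)
      qed
    qed
    have cont: "continuous_on UNIV (w \<delta> \<epsilon>)" "continuous_on UNIV (a \<delta> \<epsilon>)" "continuous_on UNIV (b \<delta> \<epsilon>)"
      if "0 < \<delta>" "0 < \<epsilon>" for \<delta> \<epsilon>
      unfolding w_def a_def b_def defs using that by (auto intro!: continuous_intros)
    have int: "integrable lborel (\<lambda>p. Q p * w \<delta> \<epsilon> p)" "integrable lborel (\<lambda>p. Q p * a \<delta> \<epsilon> p)"
      "integrable lborel (\<lambda>p. G p * b \<delta> \<epsilon> p)" if "0 < \<delta>" "0 < \<epsilon>" for \<delta> \<epsilon>
    proof -
      have K: "compact ({\<delta>..\<sigma>} \<times> {\<epsilon>..R})"
        by (intro compact_Times compact_Icc)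
      show "integrable lborel (\<lambda>p. Q p * w \<delta> \<epsilon> p)"
        by (rule integrable_mult_compact_support[OF cont(1)[OF that] K, where C = C])
           (use zero that Qabs in auto)
      show "integrable lborel (\<lambda>p. Q p * a \<delta> \<epsilon> p)"
        by (rule integrable_mult_compact_support[OF cont(2)[OF that] K, where C = C])
           (use zero that Qabs in auto)
      show "integrable lborel (\<lambda>p. G p * b \<delta> \<epsilon> p)"
        by (rule integrable_mult_compact_support[OF cont(3)[OF that] K, where C = "M * C"])
           (use zero that Gabs in auto)
    qed

    have main: "(LINT p|lborel. Q p * w \<delta> \<epsilon> p) \<le> (LINT p|lborel. Q p * a \<delta> \<epsilon> p) + (LINT p|lborel. G p * b \<delta> \<epsilon> p)"
      if "0 < \<delta>" "0 < \<epsilon>" for \<delta> \<epsilon>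
    proof -
      define \<phi>t where "\<phi>t = (\<lambda>(t, x). (A1 \<delta> \<sigma> t - A2 \<delta> \<sigma> t) * Z \<epsilon> x * B R t x - A \<delta> \<sigma> t * Z \<epsilon> x * B' R t x * M)"
      define \<phi>x where "\<phi>x = (\<lambda>(t, x). A \<delta> \<sigma> t * Z' \<epsilon> x * B R t x - A \<delta> \<sigma> t * Z \<epsilon> x * B' R t x)"
      have "0 \<le> (LINT p|lborel. Q p * \<phi>t p + G p * \<phi>x p)"
        using entropy_test_function(1)[OF that pos(4) M, of R]
        by (intro ineq[of "\<lambda>(t, x). A \<delta> \<sigma> t * Z \<epsilon> x * B R t x"])
           (auto simp: defs \<phi>t_def \<phi>x_def)
      also have "\<dots> \<le> (LINT p|lborel. (Q p * a \<delta> \<epsilon> p - Q p * w \<delta> \<epsilon> p) + G p * b \<delta> \<epsilon> p)"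
      proof (rule integral_mono)
        have K: "compact ({\<delta>..\<sigma>} \<times> {\<epsilon>..R})"
          by (intro compact_Times compact_Icc)
        have cont\<phi>: "continuous_on UNIV \<phi>t" "continuous_on UNIV \<phi>x"
          unfolding \<phi>t_def \<phi>x_def defs case_prod_beta using that by (auto intro!: continuous_intros)
        have zero\<phi>: "\<phi>t p = 0" "\<phi>x p = 0" if "p \<notin> {\<delta>..\<sigma>} \<times> {\<epsilon>..R}" for p
        proof -
          have "A \<delta> \<sigma> (fst p) * Z \<epsilon> (snd p) * B' R (fst p) (snd p) = 0"
            using entropy_test_function(2)[OF \<open>0 < \<delta>\<close> \<open>0 < \<epsilon>\<close> pos(4) M, of "fst p" "snd p" R] that
            by (auto simp: defs posq_def)
          then show "\<phi>t p = 0" "\<phi>x p = 0"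
            using zero[OF that \<open>0 < \<delta>\<close> \<open>0 < \<epsilon>\<close>]
            by (auto simp: \<phi>t_def \<phi>x_def w_def a_def b_def case_prod_beta left_diff_distrib)
        qed
        have "integrable lborel (\<lambda>p. Q p * \<phi>t p)"
          by (rule integrable_mult_compact_support[OF cont\<phi>(1) K zero\<phi>(1) Q, where C = C]) (simp_all add: Qabs)
        moreover have "integrable lborel (\<lambda>p. G p * \<phi>x p)"
          by (rule integrable_mult_compact_support[OF cont\<phi>(2) K zero\<phi>(2) G, where C = "M * C"]) (simp_all add: Gabs)
        ultimately show "integrable lborel (\<lambda>p. Q p * \<phi>t p + G p * \<phi>x p)"
          by (rule Bochner_Integration.integrable_add)
        show "integrable lborel (\<lambda>p. (Q p * a \<delta> \<epsilon> p - Q p * w \<delta> \<epsilon> p) + G p * b \<delta> \<epsilon> p)"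
          by (intro Bochner_Integration.integrable_add Bochner_Integration.integrable_diff int that)
        fix p :: "real \<times> real"
        obtain t x where p: "p = (t, x)"
          by (cases p)
        \<comment> \<open>The lateral contribution of the cone, dropped with the right sign because
          \<bar>G\<bar> \<le> M Q.\<close>
        have "0 \<le> A \<delta> \<sigma> t * Z \<epsilon> x * B' R t x * (M * Q p + G p)"
          using GQ[of p] by (intro mult_nonneg_nonneg nonneg) auto
        then show "Q p * \<phi>t p + G p * \<phi>x p \<le> (Q p * a \<delta> \<epsilon> p - Q p * w \<delta> \<epsilon> p) + G p * b \<delta> \<epsilon> p"
          by (simp add: p \<phi>t_def \<phi>x_def a_def w_def b_def algebra_simps)
      qed
      also have "\<dots> = (LINT p|lborel. Q p * a \<delta> \<epsilon> p) - (LINT p|lborel. Q p * w \<delta> \<epsilon> p) + (LINT p|lborel. G p * b \<delta> \<epsilon> p)"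
        using int[OF that] by simp
      finally show ?thesis
        by simp
    qed
    have AB: "A \<delta> \<sigma> t * B R t x \<le> \<sigma>\<^sup>2 * R\<^sup>2" if "0 < \<delta>" "0 < x" for \<delta> t x
    proof (cases "t \<le> 0")
      case True
      then have "t / \<delta> - 1 \<le> 0"
        using that by (simp add: field_simps)
      then show ?thesis
        by (simp add: A_def)
    next
      case False
      have "posq (\<sigma> - t) \<le> posq \<sigma>"
        using False by (intro posq_mono) auto
      moreover have "0 \<le> M * t"
        using False M by simp
      then have "posq (R - x - M * t) \<le> posq R"
        using that by (intro posq_mono) auto
      moreover have "step (t / \<delta> - 1) * posq (\<sigma> - t) \<le> 1 * posq \<sigma>"
        using calculation by (intro mult_mono) auto
      ultimately have "step (t / \<delta> - 1) * posq (\<sigma> - t) * posq (R - x - M * t) \<le> posq \<sigma> * posq R"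
        by (intro mult_mono) auto
      then show ?thesis
        using pos by (simp add: A_def B_def posq_def)
    qed
    \<comment> \<open>The weight \<open>a\<close> is at most (2 / \<delta>) \<sigma>^2 R^2, where 2
      bounds \<open>step'\<close>, and it is active for a time of length \<delta>; the powers of
      \<delta> cancel.\<close>
    have early: "(LINT p|lborel. Q p * a \<delta> \<epsilon> p) \<le> 2 * \<sigma>\<^sup>2 * R\<^sup>2 * e"
      if "0 < \<delta>" "0 < \<epsilon>" "0 < e"
        and e: "AE t in lborel. 0 < t \<and> t < 2 * \<delta> \<longrightarrow> (LINT x:{0<..<R}|lborel. Q (t, x)) \<le> e" for \<delta> \<epsilon> e
    proof -
      have int': "integrable (lborel \<Otimes>\<^sub>M lborel) (\<lambda>p. Q p * a \<delta> \<epsilon> p)"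
        using int(2)[OF that(1,2)] by (simp add: lborel_prod)
      have "(LINT p|lborel. Q p * a \<delta> \<epsilon> p) = (LINT t|lborel. LINT x|lborel. Q (t, x) * a \<delta> \<epsilon> (t, x))"
        using lborel_pair.integral_fst'[OF int'] by (simp add: lborel_prod)
      also have "\<dots> \<le> (LINT t|lborel. indicator {\<delta>..2 * \<delta>} t * (2 * \<sigma>\<^sup>2 * R\<^sup>2 * e / \<delta>))"
      proof (rule integral_mono_AE[OF lborel_pair.integrable_fst'[OF int']])
        show "integrable lborel (\<lambda>t. indicator {\<delta>..2 * \<delta>} t * (2 * \<sigma>\<^sup>2 * R\<^sup>2 * e / \<delta>) :: real)"
          using that by (intro integrable_mult_left integrable_real_indicator) (auto simp: emeasure_lborel_Icc_eq)
        show "AE t in lborel. (LINT x|lborel. Q (t, x) * a \<delta> \<epsilon> (t, x)) \<le>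
            indicator {\<delta>..2 * \<delta>} t * (2 * \<sigma>\<^sup>2 * R\<^sup>2 * e / \<delta>)"
          using e lborel_pair.AE_integrable_fst'[OF int']
        proof eventually_elim
          case (elim t)
          show ?case
          proof (cases "\<delta> < t \<and> t < 2 * \<delta>")
            case True
            define k where "k = 2 / \<delta> * (\<sigma>\<^sup>2 * R\<^sup>2)"
            have k: "0 \<le> k"
              using that by (simp add: k_def)
            have intQ: "integrable lborel (\<lambda>x. indicator {0<..<R} x * Q (t, x))"
              by (rule integrableI_bounded_set[where A = "{0<..<R}" and B = C])
                 (use Qabs pos in \<open>auto simp: emeasure_lborel_Ioo indicator_def\<close>)
            have "(LINT x|lborel. Q (t, x) * a \<delta> \<epsilon> (t, x)) \<le> (LINT x|lborel. k * (indicator {0<..<R} x * Q (t, x)))"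
            proof (rule integral_mono)
              show "integrable lborel (\<lambda>x. Q (t, x) * a \<delta> \<epsilon> (t, x))"
                using elim(2) by simp
              show "integrable lborel (\<lambda>x. k * (indicator {0<..<R} x * Q (t, x)))"
                using intQ by simp
              fix x
              show "Q (t, x) * a \<delta> \<epsilon> (t, x) \<le> k * (indicator {0<..<R} x * Q (t, x))"
              proof (cases "0 < x \<and> x < R")
                case True
                have "0 \<le> M * t"
                  using \<open>\<delta> < t \<and> _\<close> that M by simp
                then have "posq (\<sigma> - t) \<le> posq \<sigma>" "posq (R - x - M * t) \<le> posq R"
                  using \<open>\<delta> < t \<and> _\<close> that True by (auto intro!: posq_mono)
                then have "step' (t / \<delta> - 1) / \<delta> * posq (\<sigma> - t) * step (x / \<epsilon> - 1) * posq (R - x - M * t) \<le>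
                    2 / \<delta> * posq \<sigma> * 1 * posq R"
                  using that by (intro mult_mono divide_right_mono step'_le mult_nonneg_nonneg) auto
                then have "a \<delta> \<epsilon> (t, x) \<le> k"
                  using pos by (simp add: a_def k_def defs posq_def)
                then have "a \<delta> \<epsilon> (t, x) * Q (t, x) \<le> k * Q (t, x)"
                  by (intro mult_right_mono Q0)
                then show ?thesis
                  using True by (simp add: mult.commute)
              next
                case False
                then have "(t, x) \<notin> {\<delta>..\<sigma>} \<times> {\<epsilon>..R} \<or> x = R"
                  using that by auto
                moreover have "a \<delta> \<epsilon> (t, R) = 0"
                  using \<open>\<delta> < t \<and> _\<close> that M by (simp add: a_def defs)
                ultimately have "a \<delta> \<epsilon> (t, x) = 0"
                  using zero[of "(t, x)" \<delta> \<epsilon>] that by auto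
                then show ?thesis
                  using k Q0 by simp
              qed
            qed
            also have "\<dots> = k * (LINT x:{0<..<R}|lborel. Q (t, x))"
              by (simp add: set_lebesgue_integral_def)
            also have "\<dots> \<le> k * e"
              using elim(1) True that k by (intro mult_left_mono) auto
            finally show ?thesis
              using True by (simp add: k_def mult_ac)
          next
            case False
            then have "step' (t / \<delta> - 1) = 0"
              using that by (intro step'_eq_0) (auto simp: field_simps)
            then have "a \<delta> \<epsilon> (t, x) = 0" for x
              by (simp add: a_def A1_def)
            then show ?thesis
              using that by simp
          qed
        qed
      qed
      also have "\<dots> = 2 * \<sigma>\<^sup>2 * R\<^sup>2 * e"
        using that by simp
      finally show ?thesis .
    qed

    \<comment> \<open>Here \<delta> is already fixed and only \<epsilon> moves. The boundary
      integrals need not converge, since the trace bounds \<open>G\<close> from above only; their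
      positive parts do tend to 0, and dominated convergence is applied to these.\<close>
    have boundary: "\<exists>\<epsilon>>0. \<epsilon> \<le> \<epsilon>0 \<and> (LINT p|lborel. G p * b \<delta> \<epsilon> p) \<le> e" if "0 < \<delta>" "0 < e" for \<delta> e
    proof -
      define E where "E n = \<epsilon>0 / Suc n" for n
      have E: "0 < E n" "E n \<le> \<epsilon>0" for n
        using pos by (auto simp: E_def field_simps)
      have Elim: "E \<longlonglongrightarrow> 0"
        unfolding E_def[abs_def] by (rule LIMSEQ_Suc[OF lim_const_over_n])
      define I where "I n t = (LINT x|lborel. G (t, x) * b \<delta> (E n) (t, x))" for n t
      have I_eq: "I n t = (LINT x|lborel. (G (t, x) * (A \<delta> \<sigma> t * B R t x)) * (step' (x / E n - 1) / E n))" for n t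
        by (simp add: I_def b_def Z'_def mult_ac)
      have I_meas [measurable]: "I n \<in> borel_measurable borel" for n
        unfolding I_def[abs_def] b_def fst_conv snd_conv by measurable
      have I_le: "I n t \<le> 2 * (M * C * (\<sigma>\<^sup>2 * R\<^sup>2))" for n t
        unfolding I_eq
      proof (rule integral_step'_le[OF E(1)])
        show "AE x in lborel. E n < x \<and> x < 2 * E n \<longrightarrow> G (t, x) * (A \<delta> \<sigma> t * B R t x) \<le> M * C * (\<sigma>\<^sup>2 * R\<^sup>2)"
        proof (intro AE_I2 impI)
          fix x assume "E n < x \<and> x < 2 * E n"
          then have "0 < x"
            using E(1)[of n] by linarith
          then show "G (t, x) * (A \<delta> \<sigma> t * B R t x) \<le> M * C * (\<sigma>\<^sup>2 * R\<^sup>2)"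
            using Gabs[of "(t, x)"] M C nonneg AB \<open>0 < \<delta>\<close> by (intro mult_mono[of "G (t, x)"]) auto
        qed
      qed (use M C in auto)
      have I_zero: "I n t = 0" if "t \<notin> {0..\<sigma>}" for n t
      proof -
        have "A \<delta> \<sigma> t = 0"
          using that \<open>0 < \<delta>\<close> by (auto simp: A_def not_le divide_less_0_iff less_imp_le intro!: step_eq_0)
        then show ?thesis
          by (simp add: I_eq)
      qed
      have "(\<lambda>n. LINT t|lborel. max 0 (I n t)) \<longlonglongrightarrow> (LINT t|(lborel :: real measure). 0)"
      proof (rule integral_dominated_convergence[where w = "\<lambda>t. indicator {0..\<sigma>} t * (2 * (M * C * (\<sigma>\<^sup>2 * R\<^sup>2)))"])
        show "integrable lborel (\<lambda>t. indicator {0..\<sigma>} t * (2 * (M * C * (\<sigma>\<^sup>2 * R\<^sup>2))) :: real)"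
          using pos by (intro integrable_mult_left integrable_real_indicator) (auto simp: emeasure_lborel_Icc_eq)
        show "AE t in lborel. norm (max 0 (I n t)) \<le> indicator {0..\<sigma>} t * (2 * (M * C * (\<sigma>\<^sup>2 * R\<^sup>2)))" for n
          using I_le[of n] I_zero[of _ n] M C by (intro AE_I2) (auto simp: indicator_def)
        show "AE t in lborel. (\<lambda>n. max 0 (I n t)) \<longlonglongrightarrow> 0"
          using trace AE_lborel_singleton[of 0]
        proof eventually_elim
          case (elim t)
          show ?case
          proof (cases "0 < t \<and> t \<le> \<sigma>")
            case True
            show ?thesis
            proof (rule LIMSEQ_I)
              fix r :: real assume r: "0 < r"
              \<comment> \<open>Chosen so that the factor 2 of the kernel and the bound \<sigma>^2
                R^2 of the remaining weight leave r / 2.\<close>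
              define r' where "r' = r / (4 * (\<sigma>\<^sup>2 * R\<^sup>2))"
              have r': "0 < r'"
                using r pos by (simp add: r'_def)
              then obtain \<eta> where \<eta>: "0 < \<eta>" "AE x in lborel. 0 < x \<and> x < \<eta> \<longrightarrow> G (t, x) \<le> r'"
                using elim True pos by force
              have "\<forall>\<^sub>F n in sequentially. E n < \<eta> / 2"
                using \<eta> by (intro order_tendstoD(2)[OF Elim]) simp
              then obtain N where N: "\<And>n. N \<le> n \<Longrightarrow> E n < \<eta> / 2"
                by (auto simp: eventually_sequentially)
              have "I n t \<le> 2 * (r' * (\<sigma>\<^sup>2 * R\<^sup>2))" if "N \<le> n" for n
                unfolding I_eq
              proof (rule integral_step'_le[OF E(1)])
                show "AE x in lborel. E n < x \<and> x < 2 * E n \<longrightarrow>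
                    G (t, x) * (A \<delta> \<sigma> t * B R t x) \<le> r' * (\<sigma>\<^sup>2 * R\<^sup>2)"
                  using \<eta>(2)
                proof eventually_elim
                  case (elim x)
                  show ?case
                  proof
                    assume x: "E n < x \<and> x < 2 * E n"
                    then have "0 < x" "x < \<eta>"
                      using E(1)[of n] N[OF that] by linarith+
                    then show "G (t, x) * (A \<delta> \<sigma> t * B R t x) \<le> r' * (\<sigma>\<^sup>2 * R\<^sup>2)"
                      using elim AB \<open>0 < \<delta>\<close> r' nonneg by (intro mult_mono[of "G (t, x)"]) auto
                  qed
                qed
              qed (use r' in auto)
              moreover have "2 * (r' * (\<sigma>\<^sup>2 * R\<^sup>2)) < r"
                using r pos by (simp add: r'_def)
              ultimately show "\<exists>no. \<forall>n\<ge>no. norm (max 0 (I n t) - 0) < r"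
                using r by (intro exI[of _ N]) fastforce
            qed
          next
            case False
            then have "I n t = 0" for n
              using I_zero[of t n] elim by auto
            then show ?thesis
              by simp
          qed
        qed
      qed auto
      then have "\<forall>\<^sub>F n in sequentially. (LINT t|lborel. max 0 (I n t)) < e"
        using that by (intro order_tendstoD(2)) auto
      then obtain n where n: "(LINT t|lborel. max 0 (I n t)) < e"
        by (auto simp: eventually_sequentially)
      have int': "integrable (lborel \<Otimes>\<^sub>M lborel) (\<lambda>p. G p * b \<delta> (E n) p)"
        using int(3)[OF that(1) E(1)] by (simp add: lborel_prod)
      have intI: "integrable lborel (I n)"
        using lborel_pair.integrable_fst'[OF int'] by (simp add: I_def[abs_def])
      have "(LINT p|lborel. G p * b \<delta> (E n) p) = (LINT t|lborel. I n t)"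
        using lborel_pair.integral_fst'[OF int'] by (simp add: lborel_prod I_def)
      also have "\<dots> \<le> (LINT t|lborel. max 0 (I n t))"
        by (rule integral_mono[OF intI]) (auto intro: intI)
      finally show ?thesis
        using n E by (intro exI[of _ "E n"]) auto
    qed

    have w_le: "(LINT p|lborel. Q p * w \<delta>0 \<epsilon>0 p) \<le> (2 * \<sigma>\<^sup>2 * R\<^sup>2 + 1) * e" if e: "0 < e" for e
    proof -
      obtain \<delta>1 where \<delta>1: "0 < \<delta>1" "AE t in lborel. 0 < t \<and> t < \<delta>1 \<longrightarrow> (LINT x:{0<..<R}|lborel. Q (t, x)) \<le> e"
        using init[OF e] by blast
      define \<delta> where "\<delta> = min \<delta>0 (\<delta>1 / 2)"
      have \<delta>: "0 < \<delta>" "\<delta> \<le> \<delta>0" "2 * \<delta> \<le> \<delta>1"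
        using \<delta>1 pos by (auto simp: \<delta>_def)
      obtain \<epsilon> where \<epsilon>: "0 < \<epsilon>" "\<epsilon> \<le> \<epsilon>0" "(LINT p|lborel. G p * b \<delta> \<epsilon> p) \<le> e"
        using boundary[OF \<delta>(1) e] by blast
      \<comment> \<open>Smaller \<delta> and \<epsilon> switch the cutoffs on earlier, so the weight
        increases. The left side is thereby bounded by quantities whose layers are arbitrarily
        small.\<close>
      have "(LINT p|lborel. Q p * w \<delta>0 \<epsilon>0 p) \<le> (LINT p|lborel. Q p * w \<delta> \<epsilon> p)"
      proof (intro integral_mono int pos \<delta> \<epsilon> mult_left_mono Q0)
        fix p :: "real \<times> real"
        obtain t x where p: "p = (t, x)"
          by (cases p)
        show "w \<delta>0 \<epsilon>0 p \<le> w \<delta> \<epsilon> p"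
        proof (cases "0 < t \<and> 0 < x")
          case True
          then have "step (t / \<delta>0 - 1) \<le> step (t / \<delta> - 1)" "step (x / \<epsilon>0 - 1) \<le> step (x / \<epsilon> - 1)"
            using pos \<delta> \<epsilon> by (auto intro!: step_mono divide_left_mono)
          then show ?thesis
            unfolding w_def A2_def Z_def p fst_conv snd_conv
            by (intro mult_mono mult_nonneg_nonneg nonneg) auto
        next
          case False
          then have "w \<delta>0 \<epsilon>0 p = 0"
            using zero[of p \<delta>0 \<epsilon>0] pos p by auto
          moreover have "0 \<le> w \<delta> \<epsilon> p"
            by (simp add: w_def A2_def nonneg)
          ultimately show ?thesis
            by simp
        qed
      qed
      also have "\<dots> \<le> 2 * \<sigma>\<^sup>2 * R\<^sup>2 * e + e"
      proof -
        have "(LINT p|lborel. Q p * a \<delta> \<epsilon> p) \<le> 2 * \<sigma>\<^sup>2 * R\<^sup>2 * e"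
          using \<delta>1(2) \<delta> by (intro early \<delta> \<epsilon> e) (auto elim!: eventually_mono)
        then show ?thesis
          using main[OF \<delta>(1) \<epsilon>(1)] \<epsilon>(3) by linarith
      qed
      finally show ?thesis
        by (simp add: algebra_simps)
    qed
    have "(LINT p|lborel. Q p * w \<delta>0 \<epsilon>0 p) \<le> 0 + e" if "0 < e" for e
    proof -
      have "0 < 2 * \<sigma>\<^sup>2 * R\<^sup>2 + 1"
        by (intro add_nonneg_pos) auto
      then show ?thesis
        using w_le[of "e / (2 * \<sigma>\<^sup>2 * R\<^sup>2 + 1)"] that by simp
    qed
    then have "(LINT p|lborel. Q p * w \<delta>0 \<epsilon>0 p) \<le> 0"
      by (rule field_le_epsilon)
    moreover have w0: "0 \<le> Q p * w \<delta>0 \<epsilon>0 p" for p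
      by (intro mult_nonneg_nonneg Q0) (simp add: w_def A2_def nonneg)
    ultimately have "(LINT p|lborel. Q p * w \<delta>0 \<epsilon>0 p) = 0"
      by (intro antisym integral_nonneg) auto
    then show ?thesis
      using integral_nonneg_eq_0_iff_AE[OF int(1)[OF pos(1,2)]] w0 by (simp add: w_def)
  qed

  \<comment> \<open>Countably many weights suffice to be positive somewhere at each point of the
    strip; the second alternative discards the final times that are not positive.\<close>
  have "AE p in lborel. \<forall>m n j :: nat. Q p * (A2 (1 / Suc m) (\<tau> - 1 / Suc n) (fst p) * Z (1 / Suc m) (snd p) *
      B (Suc j) (fst p) (snd p)) = 0 \<or> \<tau> - 1 / Suc n \<le> 0"
    unfolding AE_all_countable
  proof (intro allI)
    fix m n j :: nat
    show "AE p in lborel. Q p * (A2 (1 / Suc m) (\<tau> - 1 / Suc n) (fst p) * Z (1 / Suc m) (snd p) *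
      B (Suc j) (fst p) (snd p)) = 0 \<or> \<tau> - 1 / Suc n \<le> 0"
    proof (cases "\<tau> - 1 / Suc n \<le> 0")
      case False
      show ?thesis
        using key[of "1 / Suc m" "1 / Suc m" "\<tau> - 1 / Suc n" "real (Suc j)"] False
        by (auto elim!: eventually_mono)
    qed simp
  qed
  then show ?thesis
  proof eventually_elim
    case (elim p)
    obtain t x where p: "p = (t, x)"
      by (cases p)
    have "Q (t, x) = 0" if tx: "0 < t" "t < \<tau>" "0 < x"
    proof -
      obtain m where m: "1 / Suc m < min t x"
        using reals_Archimedean[of "min t x"] tx by (auto simp: inverse_eq_divide)
      obtain n where n: "1 / Suc n < \<tau> - t"
        using reals_Archimedean[of "\<tau> - t"] tx by (auto simp: inverse_eq_divide)
      obtain j :: nat where j: "x + M * t < j"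
        using reals_Archimedean2 by blast
      have "0 < A2 (1 / Suc m) (\<tau> - 1 / Suc n) t"
        unfolding A2_def using m n by (intro mult_pos_pos step_pos) (auto simp: field_simps)
      moreover have "0 < Z (1 / Suc m) x"
        unfolding Z_def using m by (intro step_pos) (auto simp: field_simps)
      moreover have "0 < B (Suc j) t x"
        unfolding B_def using j by (intro posq_pos) auto
      moreover have "\<not> \<tau> - 1 / Suc n \<le> 0"
        using n tx by linarith
      ultimately show ?thesis
        using elim[rule_format, of m n j] p by simp
    qed
    then show ?case
      by (simp add: p)
  qed
qed

section \<open>The entropy kernel as a probability law\<close>

text \<open>An open interval has positive measure. This serves to evaluate almost-everywhere
  statements at one suitable point.\<close>

lemma AE_lborel_interval_witness:
  fixes a b :: real
  assumes "a < b" and P: "AE x in lborel. a < x \<and> x < b \<longrightarrow> P x"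
  shows "\<exists>x. a < x \<and> x < b \<and> P x"
proof (rule ccontr)
  assume "\<not> ?thesis"
  then have "AE x in lborel. x \<notin> {a<..<b}"
    using P by (auto elim!: eventually_mono)
  then have "{a<..<b} \<in> null_sets lborel"
    by (subst AE_iff_null_sets) auto
  then show False
    using \<open>a < b\<close> by (simp add: null_sets_def)
qed

lemma powr_tangent_le:
  fixes x y p :: real
  assumes "1 \<le> p" "0 \<le> x" "0 < y"
  shows "y powr p + p * y powr (p - 1) * (x - y) \<le> x powr p"
proof (cases "x = 0")
  \<comment> \<open>The point 0 lies outside the open half-line on which convexity is applied; there
    the claim reduces to (1 - p) y^p \<le> 0.\<close>
  case True
  have "y powr (p - 1) * y = y powr p"
    using assms by (simp add: powr_diff)
  then show ?thesis
    using assms True by (simp add: algebra_simps mult_right_mono)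
next
  case False
  have "((\<lambda>x. x powr p) has_real_derivative p * y powr (p - 1)) (at y within {0<..})"
    using assms by (auto intro!: derivative_eq_intros)
  then have "p * y powr (p - 1) * (x - y) \<le> x powr p - y powr p"
    using assms False
    by (intro convex_on_imp_above_tangent[OF powr_convex[OF assms(1)]]) (auto simp: interior_open)
  then show ?thesis
    by simp
qed

locale isentropic_gas =
  fixes \<kappa> \<gamma> :: real
  assumes kappa: "0 < \<kappa>" and gamma: "1 < \<gamma>" "\<gamma> < 3"
begin

abbreviation "\<theta> \<equiv> theta \<gamma>"
abbreviation "a \<equiv> a_const \<kappa> \<gamma>"

lemma theta: "0 < \<theta>" "\<theta> < 1"
  using gamma by (auto simp: theta_def)

lemma a_pos: "0 < a"
  using kappa gamma by (simp add: a_const_def)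

lemma lam_pos: "0 < lam \<gamma>"
  using gamma by (simp add: lam_def field_simps)

text \<open>A symmetric beta law rescaled to [-1, 1]. The measure with density \<open>chi\<close> at
  (\<rho>, u) is \<rho> times its image under z \<mapsto> u + a \<rho>^\<theta> z, which turns every
  entropy into an expectation over a fixed law.\<close>

definition law :: "real measure" where
  "law = density lborel (\<lambda>z. indicator {-1..1} z * (1 - z\<^sup>2) powr lam \<gamma> / J_const \<gamma>)"

lemma weight_integrable: "integrable lborel (\<lambda>z. indicator {-1..1} z * (1 - z\<^sup>2) powr lam \<gamma>)"
proof (rule integrableI_bounded_set[where A = "{-1..1}" and B = 1])
  show "AE z in lborel. z \<in> {-1..1} \<longrightarrow> norm (indicator {-1..1} z * (1 - z\<^sup>2) powr lam \<gamma>) \<le> 1"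
  proof (intro AE_I2 impI)
    fix z :: real assume "z \<in> {-1..1}"
    then have "z\<^sup>2 \<le> 1"
      by (simp add: abs_square_le_1 abs_le_iff)
    then show "norm (indicator {-1..1} z * (1 - z\<^sup>2) powr lam \<gamma>) \<le> 1"
      using lam_pos powr_le1[of "lam \<gamma>" "1 - z\<^sup>2"] by (simp add: indicator_def)
  qed
qed (auto simp: emeasure_lborel_Icc_eq)

lemma J_pos: "0 < J_const \<gamma>"
proof -
  have "0 < (3/4) powr lam \<gamma>"
    by simp
  also have "(3/4) powr lam \<gamma> = (LINT z|lborel. indicator {-1/2..1/2::real} z * (3/4) powr lam \<gamma>)"
    by simp
  also have "\<dots> \<le> (LINT z|lborel. indicator {-1..1} z * (1 - z\<^sup>2) powr lam \<gamma>)"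
  proof (rule integral_mono[OF _ weight_integrable])
    show "integrable lborel (\<lambda>z. indicator {-1/2..1/2::real} z * (3/4) powr lam \<gamma> :: real)"
      by (intro integrable_mult_left integrable_real_indicator) (auto simp: emeasure_lborel_Icc_eq)
    show "indicator {-1/2..1/2::real} z * (3/4) powr lam \<gamma> \<le> indicator {-1..1} z * (1 - z\<^sup>2) powr lam \<gamma>" for z :: real
    proof (cases "z \<in> {-1/2..1/2::real}")
      case True
      then have "\<bar>z\<bar>\<^sup>2 \<le> (1/2)\<^sup>2"
        by (intro power_mono) auto
      then have "3/4 \<le> 1 - z\<^sup>2"
        by (simp add: power2_eq_square)
      then have "(3/4) powr lam \<gamma> \<le> (1 - z\<^sup>2) powr lam \<gamma>"
        using lam_pos by (intro powr_mono2) auto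
      then show ?thesis
        using True by (simp add: indicator_def)
    qed auto
  qed
  also have "\<dots> = J_const \<gamma>"
    by (simp add: J_const_def set_lebesgue_integral_def)
  finally show ?thesis .
qed

lemma sets_law [measurable_cong, simp]: "sets law = sets borel"
  and space_law [simp]: "space law = UNIV"
  by (simp_all add: law_def)

lemma integral_law:
  assumes "f \<in> borel_measurable borel"
  shows "(LINT z|law. f z) = (LINT z|lborel. indicator {-1..1} z * (1 - z\<^sup>2) powr lam \<gamma> / J_const \<gamma> * f z)"
  unfolding law_def using assms J_pos by (subst integral_density) auto

text \<open>The density is positive exactly on the open interval: 1 - z^2 vanishes at the
  endpoints.\<close>

lemma AE_law: "(AE z in law. P z) \<longleftrightarrow> (AE z in lborel. -1 < z \<and> z < 1 \<longrightarrow> P z)"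
proof -
  have "0 < ennreal (indicator {-1..1} z * (1 - z\<^sup>2) powr lam \<gamma> / J_const \<gamma>) \<longleftrightarrow> -1 < z \<and> z < 1" for z :: real
    using J_pos abs_square_less_1[of z] abs_square_eq_1[of z]
    by (auto simp: indicator_def ennreal_zero_less_divide power2_eq_1_iff)
  then have "(AE z in law. P z) \<longleftrightarrow> (AE z in lborel. -1 < z \<and> z < 1 \<longrightarrow> P z)"
    unfolding law_def by (subst AE_density) (simp_all only: measurable_lborel1, measurable)
  then show ?thesis .
qed

lemma emeasure_law: "emeasure law UNIV = 1"
proof -
  have "emeasure law UNIV = (\<integral>\<^sup>+z. ennreal (indicator {-1..1} z * (1 - z\<^sup>2) powr lam \<gamma> / J_const \<gamma>) \<partial>lborel)"
    unfolding law_def by (subst emeasure_density) auto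
  also have "\<dots> = ennreal (LINT z|lborel. indicator {-1..1} z * (1 - z\<^sup>2) powr lam \<gamma> / J_const \<gamma>)"
    using weight_integrable J_pos by (intro nn_integral_eq_integral) auto
  also have "(LINT z|lborel. indicator {-1..1} z * (1 - z\<^sup>2) powr lam \<gamma> / J_const \<gamma>) = 1"
    using J_pos by (simp add: J_const_def set_lebesgue_integral_def)
  finally show ?thesis
    by simp
qed

sublocale law: finite_measure law
  by standard (simp add: emeasure_law)

lemma measure_law [simp]: "measure law UNIV = 1"
  by (simp add: measure_def emeasure_law)

lemma law_abs_le_1: "AE z in law. \<bar>z\<bar> \<le> 1"
  by (simp add: AE_law abs_le_iff)

lemma integrable_law:
  fixes f :: "real \<Rightarrow> real"
  assumes "f \<in> borel_measurable borel" "\<And>z. \<bar>z\<bar> \<le> 1 \<Longrightarrow> \<bar>f z\<bar> \<le> B"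
  shows "integrable law f"
  using assms law_abs_le_1 by (intro law.integrable_const_bound[of _ B]) (auto elim!: eventually_mono)

lemma integral_law_uminus:
  fixes f :: "real \<Rightarrow> real"
  assumes [measurable]: "f \<in> borel_measurable borel"
  shows "(LINT z|law. f (- z)) = (LINT z|law. f z)"
proof -
  have "(LINT z|law. f z) = (LINT z|lborel. indicator {-1..1} z * (1 - z\<^sup>2) powr lam \<gamma> / J_const \<gamma> * f z)"
    by (simp add: integral_law)
  also have "\<dots> = (LINT z|lborel. indicator {-1..1} z * (1 - z\<^sup>2) powr lam \<gamma> / J_const \<gamma> * f (- z))"
    by (subst lborel_integral_real_affine[where c = "-1" and t = 0])
       (auto intro!: Bochner_Integration.integral_cong simp: indicator_def)
  also have "\<dots> = (LINT z|law. f (- z))"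
    by (simp add: integral_law)
  finally show ?thesis
    by simp
qed

lemma integral_law_id: "(LINT z|law. z) = 0"
  using integral_law_uminus[of "\<lambda>z. z"] by simp

text \<open>Substitute v = u + r z with r = a \<rho>^\<theta>. The exponents match because 1 + 2
  \<lambda> = 2 / (\<gamma> - 1) and \<theta> * 2 / (\<gamma> - 1) = 1, so the Jacobian and the
  homogeneity of the kernel together give exactly one power of \<rho>; \<open>c_const\<close> is the
  constant that normalises the rest.\<close>

lemma integral_chi:
  assumes [measurable]: "g \<in> borel_measurable borel" and \<rho>: "0 \<le> \<rho>"
  shows "(LINT v|lborel. chi \<kappa> \<gamma> \<rho> (v - u) * g v) = \<rho> * (LINT z|law. g (u + a * \<rho> powr \<theta> * z))"
proof (cases "\<rho> = 0")
  case True
  then show ?thesis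
    by (simp add: chi_def)
next
  case False
  define r where "r = a * \<rho> powr \<theta>"
  have r: "0 < r"
    using False \<rho> a_pos by (simp add: r_def)
  have r2: "a\<^sup>2 * \<rho> powr (\<gamma> - 1) = r\<^sup>2"
  proof -
    have "(\<rho> powr \<theta>)\<^sup>2 = \<rho> powr (\<gamma> - 1)"
      by (simp add: power2_eq_square theta_def flip: powr_add)
    then show ?thesis
      by (simp add: r_def power_mult_distrib)
  qed
  have scale: "r * (c_const \<kappa> \<gamma> * (r\<^sup>2) powr lam \<gamma>) = \<rho> / J_const \<gamma>"
  proof -
    have "r * (r\<^sup>2) powr lam \<gamma> = r powr (1 + 2 * lam \<gamma>)"
      using r by (simp add: powr_add powr_powr flip: powr_numeral)
    also have "1 + 2 * lam \<gamma> = 2 / (\<gamma> - 1)"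
      by (simp add: lam_def)
    also have "r powr (2 / (\<gamma> - 1)) = a powr (2 / (\<gamma> - 1)) * \<rho> powr (\<theta> * (2 / (\<gamma> - 1)))"
      using a_pos \<rho> by (simp add: r_def powr_mult powr_powr)
    also have "\<theta> * (2 / (\<gamma> - 1)) = 1"
      using gamma by (simp add: theta_def)
    finally have "r * (r\<^sup>2) powr lam \<gamma> = a powr (2 / (\<gamma> - 1)) * \<rho> powr 1" .
    then have "r * (r\<^sup>2) powr lam \<gamma> = a powr (2 / (\<gamma> - 1)) * \<rho>"
      using \<rho> by simp
    moreover have "a powr (- 2 / (\<gamma> - 1)) * a powr (2 / (\<gamma> - 1)) = 1"
      using a_pos by (simp flip: powr_add)
    ultimately have "r * (r\<^sup>2) powr lam \<gamma> * a powr (- 2 / (\<gamma> - 1)) = \<rho>"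
      by (metis mult.assoc mult.commute mult_1_left)
    then show ?thesis
      by (simp add: c_const_def mult_ac)
  qed
  have chi: "chi \<kappa> \<gamma> \<rho> (r * z) = c_const \<kappa> \<gamma> * (r\<^sup>2) powr lam \<gamma> * (indicator {-1..1} z * (1 - z\<^sup>2) powr lam \<gamma>)" for z
  proof (cases "z \<in> {-1..1}")
    case True
    then have "z\<^sup>2 \<le> 1"
      by (simp add: abs_square_le_1 abs_le_iff)
    then have "max 0 (r\<^sup>2 - (r * z)\<^sup>2) = r\<^sup>2 * (1 - z\<^sup>2)"
      by (simp add: power_mult_distrib right_diff_distrib mult_left_le)
    then show ?thesis
      using True \<open>z\<^sup>2 \<le> 1\<close> by (simp add: chi_def r2 powr_mult)
  next
    case False
    then have "1 \<le> z\<^sup>2"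
      using abs_square_less_1[of z] by (auto simp: abs_less_iff not_less)
    then have "r\<^sup>2 - (r * z)\<^sup>2 \<le> 0"
      using mult_left_mono[of 1 "z\<^sup>2" "r\<^sup>2"] by (simp add: power_mult_distrib)
    then show ?thesis
      using False by (simp add: chi_def r2 max_def)
  qed
  have "(LINT v|lborel. chi \<kappa> \<gamma> \<rho> (v - u) * g v) = r * (LINT z|lborel. chi \<kappa> \<gamma> \<rho> (r * z) * g (u + r * z))"
    using r by (subst lborel_integral_real_affine[where c = r and t = u]) auto
  also have "\<dots> = (LINT z|lborel. r * (c_const \<kappa> \<gamma> * (r\<^sup>2) powr lam \<gamma>) *
      (indicator {-1..1} z * (1 - z\<^sup>2) powr lam \<gamma> * g (u + r * z)))"
    unfolding chi integral_mult_right_zero[symmetric] by (simp add: mult_ac)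
  also have "\<dots> = \<rho> * (LINT z|law. g (u + r * z))"
    unfolding scale by (subst integral_law) (simp_all add: mult_ac flip: integral_mult_right_zero)
  finally show ?thesis
    by (simp add: r_def)
qed

text \<open>Along a convergent sequence the parameters stay in a ball, and on the product of that
  ball with [-1, 1] the integrand is bounded by compactness; dominated convergence applies.\<close>

lemma integral_law_continuous:
  fixes f :: "'b::euclidean_space \<Rightarrow> real \<Rightarrow> real"
  assumes f: "continuous_on UNIV (\<lambda>(p, z). f p z)"
  shows "continuous_on UNIV (\<lambda>p. LINT z|law. f p z)"
  unfolding continuous_on_sequentially
proof (intro allI ballI impI, elim conjE)
  fix x :: "nat \<Rightarrow> 'b" and p
  assume x: "x \<longlonglongrightarrow> p"
  obtain R where R: "\<And>n. norm (x n) \<le> R"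
    using convergent_imp_Bseq[OF convergentI[OF x]] by (auto simp: Bseq_def)
  have "bounded ((\<lambda>(p, z). f p z) ` (cball 0 R \<times> {-1..1}))"
    by (intro compact_imp_bounded compact_continuous_image continuous_on_subset[OF f] compact_Times) auto
  then obtain C where C: "\<And>p z. norm p \<le> R \<Longrightarrow> \<bar>z\<bar> \<le> 1 \<Longrightarrow> \<bar>f p z\<bar> \<le> C"
    by (force simp: bounded_iff abs_le_iff)
  have cont: "continuous_on UNIV (f p)" "continuous_on UNIV (\<lambda>p. f p z)" for p z
    using continuous_on_compose2[OF f, of UNIV "\<lambda>z. (p, z)"]
      continuous_on_compose2[OF f, of UNIV "\<lambda>p. (p, z)"]
    by (simp_all add: continuous_on_Pair continuous_on_const continuous_on_id)
  have [measurable]: "f p \<in> borel_measurable borel" for p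
    by (rule borel_measurable_continuous_onI[OF cont(1)])
  show "((\<lambda>p. LINT z|law. f p z) \<circ> x) \<longlonglongrightarrow> (LINT z|law. f p z)"
    unfolding o_def
  proof (rule integral_dominated_convergence[where w = "\<lambda>_. C"])
    show "AE z in law. (\<lambda>n. f (x n) z) \<longlonglongrightarrow> f p z"
      using cont(2) x by (auto simp: continuous_on_sequentially o_def)
    show "AE z in law. norm (f (x n) z) \<le> C" for n
      using law_abs_le_1 C R by (auto elim!: eventually_mono)
  qed auto
qed

end

section \<open>The entropy of the excess over a velocity bound\<close>

context isentropic_gas
begin

text \<open>Half the distance between the two Riemann invariants, so the region to be preserved is
  \<bar>u\<bar> + \<open>rad\<close> \<le> \<omega>.\<close>

definition rad :: "state \<Rightarrow> real" where
  "rad V = a * fst V powr \<theta>"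

definition excess :: "real \<Rightarrow> state \<Rightarrow> real" where
  "excess \<omega> V = fst V * (LINT z|law. max 0 (\<bar>snd V + rad V * z\<bar> - \<omega>))"

text \<open>The factor is (1 - \<theta>) u + \<theta> v at v = u + r z, that is u + \<theta> r
  z.\<close>

definition excess_flux :: "real \<Rightarrow> state \<Rightarrow> real" where
  "excess_flux \<omega> V = fst V * (LINT z|law. (snd V + \<theta> * rad V * z) * max 0 (\<bar>snd V + rad V * z\<bar> - \<omega>))"

lemma rad_nonneg [simp]: "0 \<le> rad V"
  using a_pos by (simp add: rad_def)

lemma rad_pos: "0 < fst V \<Longrightarrow> 0 < rad V"
  using a_pos by (simp add: rad_def)

lemma omega_eq: "omega1 \<kappa> \<gamma> V = snd V - rad V" "omega2 \<kappa> \<gamma> V = snd V + rad V"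
  by (cases V; simp add: rad_def)+

lemma D_nonneg: "V \<in> D \<Longrightarrow> 0 \<le> fst V"
  by (auto simp: D_def)

lemma D_cases: "V \<in> D \<Longrightarrow> 0 < fst V \<or> V = (0, 0)"
  by (auto simp: D_def)

lemma zero_in_D [simp]: "(0, 0) \<in> D"
  by (simp add: D_def)

lemma rad_measurable [measurable]: "rad \<in> borel_measurable borel"
  unfolding rad_def[abs_def] by (simp add: borel_prod[symmetric])

lemma excess_measurable [measurable]: "excess \<omega> \<in> borel_measurable borel"
proof -
  have [measurable]: "rad \<in> borel_measurable (borel \<Otimes>\<^sub>M borel)"
    using rad_measurable by (simp add: borel_prod)
  have "excess \<omega> \<in> borel_measurable (borel \<Otimes>\<^sub>M borel)"
    unfolding excess_def[abs_def] by measurable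
  then show ?thesis
    by (simp add: borel_prod)
qed

lemma excess_flux_measurable [measurable]: "excess_flux \<omega> \<in> borel_measurable borel"
proof -
  have [measurable]: "rad \<in> borel_measurable (borel \<Otimes>\<^sub>M borel)"
    using rad_measurable by (simp add: borel_prod)
  have "excess_flux \<omega> \<in> borel_measurable (borel \<Otimes>\<^sub>M borel)"
    unfolding excess_flux_def[abs_def] by measurable
  then show ?thesis
    by (simp add: borel_prod)
qed

lemma eta_measurable:
  assumes [measurable]: "S \<in> borel_measurable borel"
  shows "eta \<kappa> \<gamma> S \<in> borel_measurable borel"
proof -
  have "eta \<kappa> \<gamma> S = (\<lambda>V. LINT v|lborel. chi \<kappa> \<gamma> (fst V) (v - snd V) * S v)"
    by (auto simp: fun_eq_iff)
  moreover have "\<dots> \<in> borel_measurable (borel \<Otimes>\<^sub>M borel)"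
    unfolding chi_def by measurable
  ultimately show ?thesis
    by (simp add: borel_prod)
qed

lemma entropy_flux_measurable:
  assumes [measurable]: "S \<in> borel_measurable borel"
  shows "entropy_flux \<kappa> \<gamma> S \<in> borel_measurable borel"
proof -
  have "entropy_flux \<kappa> \<gamma> S =
      (\<lambda>V. LINT v|lborel. ((1 - theta \<gamma>) * snd V + theta \<gamma> * v) * chi \<kappa> \<gamma> (fst V) (v - snd V) * S v)"
    by (auto simp: fun_eq_iff)
  moreover have "\<dots> \<in> borel_measurable (borel \<Otimes>\<^sub>M borel)"
    unfolding chi_def by measurable
  ultimately show ?thesis
    by (simp add: borel_prod)
qed

text \<open>Shifting S by the constant c subtracts c \<rho> from the entropy and c \<rho> u from its
  flux. Keeping the shift inside S lets the entropy inequality be invoked once for the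
  combination.\<close>

definition cutoff :: "real \<Rightarrow> real \<Rightarrow> real \<Rightarrow> real" where
  "cutoff \<omega> c v = max 0 (\<bar>v\<bar> - \<omega>) - c"

lemma cutoff_measurable [measurable]: "cutoff \<omega> c \<in> borel_measurable borel"
  unfolding cutoff_def[abs_def] by measurable

lemma cutoff_convex: "convex_on UNIV (cutoff \<omega> c)"
proof (rule convex_onI)
  fix t x y :: real
  assume t: "0 < t" "t < 1"
  have abs: "\<bar>(1 - t) * x + t * y\<bar> \<le> (1 - t) * \<bar>x\<bar> + t * \<bar>y\<bar>"
    using t abs_triangle_ineq[of "(1 - t) * x" "t * y"] by (simp add: abs_mult)
  have "(1 - t) * (\<bar>x\<bar> - \<omega>) \<le> (1 - t) * max 0 (\<bar>x\<bar> - \<omega>)" "t * (\<bar>y\<bar> - \<omega>) \<le> t * max 0 (\<bar>y\<bar> - \<omega>)"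
    "0 \<le> (1 - t) * max 0 (\<bar>x\<bar> - \<omega>)" "0 \<le> t * max 0 (\<bar>y\<bar> - \<omega>)"
    using t by (auto intro: mult_left_mono)
  moreover have "\<bar>(1 - t) * x + t * y\<bar> - \<omega> \<le> (1 - t) * (\<bar>x\<bar> - \<omega>) + t * (\<bar>y\<bar> - \<omega>)"
    using abs by (simp add: algebra_simps)
  ultimately have "max 0 (\<bar>(1 - t) * x + t * y\<bar> - \<omega>) \<le> (1 - t) * max 0 (\<bar>x\<bar> - \<omega>) + t * max 0 (\<bar>y\<bar> - \<omega>)"
    by (intro max.boundedI) linarith+
  then show "cutoff \<omega> c ((1 - t) *\<^sub>R x + t *\<^sub>R y) \<le> (1 - t) * cutoff \<omega> c x + t * cutoff \<omega> c y"
    by (simp add: cutoff_def algebra_simps)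
qed simp

lemma abs_add_rad_le:
  assumes "\<bar>z\<bar> \<le> 1"
  shows "\<bar>snd V + rad V * z\<bar> \<le> \<bar>snd V\<bar> + rad V" "\<bar>snd V + \<theta> * rad V * z\<bar> \<le> \<bar>snd V\<bar> + rad V"
proof -
  have z: "\<bar>rad V * z\<bar> \<le> rad V"
    using assms mult_left_mono[of "\<bar>z\<bar>" 1 "rad V"] by (simp add: abs_mult)
  moreover have "\<theta> * \<bar>rad V * z\<bar> \<le> 1 * rad V"
    using z theta by (intro mult_mono) auto
  then have "\<bar>\<theta> * rad V * z\<bar> \<le> rad V"
    using theta by (simp add: abs_mult mult.assoc)
  ultimately show "\<bar>snd V + rad V * z\<bar> \<le> \<bar>snd V\<bar> + rad V" "\<bar>snd V + \<theta> * rad V * z\<bar> \<le> \<bar>snd V\<bar> + rad V"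
    by linarith+
qed

lemma excess_integrand_bound:
  assumes "\<bar>z\<bar> \<le> 1"
  shows "\<bar>max 0 (\<bar>snd V + rad V * z\<bar> - \<omega>)\<bar> \<le> max 0 (\<bar>snd V\<bar> + rad V - \<omega>)"
  using abs_add_rad_le(1)[OF assms, of V] by auto

lemma excess_flux_integrand_bound:
  assumes "\<bar>z\<bar> \<le> 1"
  shows "\<bar>(snd V + \<theta> * rad V * z) * max 0 (\<bar>snd V + rad V * z\<bar> - \<omega>)\<bar> \<le>
    (\<bar>snd V\<bar> + rad V) * max 0 (\<bar>snd V\<bar> + rad V - \<omega>)"
  unfolding abs_mult
  using abs_add_rad_le(2)[OF assms, of V] excess_integrand_bound[OF assms, of V \<omega>]
  by (intro mult_mono) auto

lemma excess_integrable: "integrable law (\<lambda>z. max 0 (\<bar>snd V + rad V * z\<bar> - \<omega>))"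
  by (rule integrable_law[OF _ excess_integrand_bound]) auto

lemma excess_flux_integrable: "integrable law (\<lambda>z. (snd V + \<theta> * rad V * z) * max 0 (\<bar>snd V + rad V * z\<bar> - \<omega>))"
  by (rule integrable_law[OF _ excess_flux_integrand_bound]) auto

lemma id_integrable_law: "integrable law (\<lambda>z. z)"
  by (rule integrable_law[where B = 1]) auto

lemma eta_cutoff:
  assumes "0 \<le> fst V"
  shows "eta \<kappa> \<gamma> (cutoff \<omega> c) V = excess \<omega> V - c * fst V"
proof -
  obtain \<rho> u where V: "V = (\<rho>, u)"
    by (cases V)
  have "eta \<kappa> \<gamma> (cutoff \<omega> c) V = fst V * (LINT z|law. cutoff \<omega> c (snd V + rad V * z))"
    using integral_chi[of "cutoff \<omega> c" \<rho> u] assms by (simp add: V rad_def)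
  also have "(LINT z|law. cutoff \<omega> c (snd V + rad V * z)) =
      (LINT z|law. max 0 (\<bar>snd V + rad V * z\<bar> - \<omega>)) - c"
    unfolding cutoff_def using excess_integrable by simp
  finally show ?thesis
    by (simp add: excess_def algebra_simps)
qed

lemma entropy_flux_cutoff:
  assumes "0 \<le> fst V"
  shows "entropy_flux \<kappa> \<gamma> (cutoff \<omega> c) V = excess_flux \<omega> V - c * (fst V * snd V)"
proof -
  obtain \<rho> u where V: "V = (\<rho>, u)"
    by (cases V)
  have "entropy_flux \<kappa> \<gamma> (cutoff \<omega> c) V =
      fst V * (LINT z|law. ((1 - \<theta>) * snd V + \<theta> * (snd V + rad V * z)) * cutoff \<omega> c (snd V + rad V * z))"
    using integral_chi[of "\<lambda>v. ((1 - \<theta>) * u + \<theta> * v) * cutoff \<omega> c v" \<rho> u] assms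
    by (simp add: V rad_def mult_ac)
  also have "(\<lambda>z. ((1 - \<theta>) * snd V + \<theta> * (snd V + rad V * z)) * cutoff \<omega> c (snd V + rad V * z)) =
      (\<lambda>z. (snd V + \<theta> * rad V * z) * max 0 (\<bar>snd V + rad V * z\<bar> - \<omega>) - (c * snd V + c * \<theta> * rad V * z))"
    by (simp add: cutoff_def algebra_simps fun_eq_iff)
  also have "(LINT z|law. (snd V + \<theta> * rad V * z) * max 0 (\<bar>snd V + rad V * z\<bar> - \<omega>) - (c * snd V + c * \<theta> * rad V * z)) =
      (LINT z|law. (snd V + \<theta> * rad V * z) * max 0 (\<bar>snd V + rad V * z\<bar> - \<omega>)) - c * snd V"
    using excess_flux_integrable[of V \<omega>] id_integrable_law integral_law_id by simp
  finally show ?thesis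
    by (simp add: excess_flux_def algebra_simps)
qed

section \<open>Bounds and supporting affine functions of the excess entropy\<close>

lemma excess_nonneg: "0 \<le> fst V \<Longrightarrow> 0 \<le> excess \<omega> V"
  unfolding excess_def by (intro mult_nonneg_nonneg integral_nonneg) auto

lemma excess_le: "0 \<le> fst V \<Longrightarrow> excess \<omega> V \<le> fst V * max 0 (\<bar>snd V\<bar> + rad V - \<omega>)"
proof -
  assume V: "0 \<le> fst V"
  have "(LINT z|law. max 0 (\<bar>snd V + rad V * z\<bar> - \<omega>)) \<le> (LINT z|law. max 0 (\<bar>snd V\<bar> + rad V - \<omega>))"
  proof (rule integral_mono_AE[OF excess_integrable])
    show "AE z in law. max 0 (\<bar>snd V + rad V * z\<bar> - \<omega>) \<le> max 0 (\<bar>snd V\<bar> + rad V - \<omega>)"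
      using law_abs_le_1
    proof eventually_elim
      case (elim z)
      then show ?case
        using excess_integrand_bound[of z V \<omega>] by linarith
    qed
  qed simp
  then show ?thesis
    using V unfolding excess_def by (intro mult_left_mono) auto
qed

text \<open>Since \<theta> < 1, the factor u + \<theta> r z is at most \<bar>u\<bar> + r in absolute
  value on the support of the law. This bounds the speed at which excess entropy propagates and
  later fixes the slope of the cone.\<close>

lemma excess_flux_abs_le: "0 \<le> fst V \<Longrightarrow> \<bar>excess_flux \<omega> V\<bar> \<le> (\<bar>snd V\<bar> + rad V) * excess \<omega> V"
proof -
  assume V: "0 \<le> fst V"
  let ?g = "\<lambda>z. max 0 (\<bar>snd V + rad V * z\<bar> - \<omega>)"
  have "\<bar>LINT z|law. (snd V + \<theta> * rad V * z) * ?g z\<bar> \<le> (LINT z|law. \<bar>(snd V + \<theta> * rad V * z) * ?g z\<bar>)"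
    by (rule integral_abs_bound)
  also have "\<dots> \<le> (LINT z|law. (\<bar>snd V\<bar> + rad V) * ?g z)"
  proof (rule integral_mono_AE)
    show "integrable law (\<lambda>z. \<bar>(snd V + \<theta> * rad V * z) * ?g z\<bar>)"
      using excess_flux_integrable by (rule integrable_abs)
    show "integrable law (\<lambda>z. (\<bar>snd V\<bar> + rad V) * ?g z)"
      using excess_integrable by simp
    show "AE z in law. \<bar>(snd V + \<theta> * rad V * z) * ?g z\<bar> \<le> (\<bar>snd V\<bar> + rad V) * ?g z"
      using law_abs_le_1
      by eventually_elim (auto simp: abs_mult intro!: mult_right_mono abs_add_rad_le(2))
  qed
  also have "\<dots> = (\<bar>snd V\<bar> + rad V) * (LINT z|law. ?g z)"
    by simp
  finally show ?thesis
    using V mult_left_mono[of _ _ "fst V"] unfolding excess_flux_def excess_def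
    by (simp add: abs_mult mult.left_commute)
qed

text \<open>At velocity 0 the integrand is odd in z and the law is symmetric.\<close>

lemma excess_flux_velocity_zero: "excess_flux \<omega> (\<rho>, 0) = 0"
proof -
  let ?f = "\<lambda>z. \<theta> * rad (\<rho>, 0) * z * max 0 (\<bar>rad (\<rho>, 0) * z\<bar> - \<omega>)"
  have "(LINT z|law. ?f z) = 0"
    using integral_law_uminus[of ?f] by simp
  then show ?thesis
    by (simp add: excess_flux_def)
qed

text \<open>Pair z with -z: r z is the midpoint of u + r z and -(u - r z), so convexity and evenness
  of the positive part give the inequality pointwise after symmetrisation. It reduces the support
  property to states at rest.\<close>

lemma excess_velocity_zero_le: "0 \<le> \<rho> \<Longrightarrow> excess \<omega> (\<rho>, 0) \<le> excess \<omega> (\<rho>, u)"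
proof -
  assume \<rho>: "0 \<le> \<rho>"
  define r where "r = rad (\<rho>, 0)"
  have r: "rad (\<rho>, u) = r" for u
    by (simp add: r_def rad_def)
  let ?s = "\<lambda>v::real. max 0 (\<bar>v\<bar> - \<omega>)"
  have int: "integrable law (\<lambda>z. ?s (v + s * z))" for v s
  proof (rule integrable_law)
    show "\<bar>?s (v + s * z)\<bar> \<le> \<bar>v\<bar> + \<bar>s\<bar> + \<bar>\<omega>\<bar>" if "\<bar>z\<bar> \<le> 1" for z
    proof -
      have "\<bar>s * z\<bar> \<le> \<bar>s\<bar>"
        using that mult_left_mono[of "\<bar>z\<bar>" 1 "\<bar>s\<bar>"] by (simp add: abs_mult)
      then show ?thesis
        by linarith
    qed
  qed auto
  have "2 * (LINT z|law. ?s (r * z)) = (LINT z|law. 2 * ?s (r * z))"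
    by simp
  also have "\<dots> \<le> (LINT z|law. ?s (u + r * z) + ?s (u + - r * z))"
  proof (rule integral_mono)
    show "integrable law (\<lambda>z. 2 * ?s (r * z))"
      using int[of 0 r] by simp
    show "integrable law (\<lambda>z. ?s (u + r * z) + ?s (u + - r * z))"
      by (intro Bochner_Integration.integrable_add int)
    show "2 * ?s (r * z) \<le> ?s (u + r * z) + ?s (u + - r * z)" for z
      by (simp add: max_def abs_if)
  qed
  also have "\<dots> = (LINT z|law. ?s (u + r * z)) + (LINT z|law. ?s (u + - r * z))"
    by (intro Bochner_Integration.integral_add int)
  also have "(LINT z|law. ?s (u + - r * z)) = (LINT z|law. ?s (u + r * z))"
    using integral_law_uminus[of "\<lambda>z. ?s (u + r * z)"] by simp
  finally show ?thesis
    using \<rho> by (simp add: excess_def r mult_left_mono)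
qed

text \<open>With \<open>r = a \<rho>\<^sup>\<theta>\<close> the integrand of \<open>excess\<close> at velocity \<open>0\<close> is \<open>max 0 (a \<bar>z\<bar> \<rho>\<^sup>1\<^sup>+\<^sup>\<theta> - \<omega> \<rho>)\<close>, which is
  convex in \<open>\<rho>\<close>; integrating its subgradients gives \<open>c\<close>.\<close>

lemma excess_subgradient:
  assumes \<rho>s: "0 \<le> \<rho>s"
  shows "\<exists>c. \<forall>V. 0 \<le> fst V \<longrightarrow> excess \<omega> (\<rho>s, 0) + c * (fst V - \<rho>s) \<le> excess \<omega> V"
proof (cases "\<rho>s = 0")
  case True
  then show ?thesis
    \<comment> \<open>At the vacuum c = 0 works, because the excess is nonnegative and vanishes
      there.\<close>
    by (intro exI[of _ 0]) (simp add: excess_nonneg, simp add: excess_def)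
next
  case False
  with \<rho>s have \<rho>s: "0 < \<rho>s"
    by simp
  define p where "p = 1 + \<theta>"
  define g where "g \<rho> z = max 0 (a * \<rho> powr p * \<bar>z\<bar> - \<omega> * \<rho>)" for \<rho> z
  \<comment> \<open>The \<rho>-derivative at \<rho>s of the active branch a \<bar>z\<bar> \<rho>^p -
    \<omega> \<rho>, and 0 where the positive part is inactive: a subgradient for each z.\<close>
  define s where "s z = (if 0 < a * \<rho>s powr p * \<bar>z\<bar> - \<omega> * \<rho>s then p * a * \<rho>s powr \<theta> * \<bar>z\<bar> - \<omega> else 0)" for z
  have g_int: "integrable law (g \<rho>)" for \<rho>
  proof (rule integrable_law)
    show "\<bar>g \<rho> z\<bar> \<le> a * \<rho> powr p + \<bar>\<omega> * \<rho>\<bar>" if "\<bar>z\<bar> \<le> 1" for z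
    proof -
      have "0 \<le> a * \<rho> powr p" "a * \<rho> powr p * \<bar>z\<bar> \<le> a * \<rho> powr p"
        using that a_pos by (auto intro: mult_left_le)
      then show ?thesis
        unfolding g_def by linarith
    qed
  qed (simp add: g_def[abs_def])
  have s_int: "integrable law s"
  proof (rule integrable_law)
    show "\<bar>s z\<bar> \<le> p * a * \<rho>s powr \<theta> + \<bar>\<omega>\<bar>" if "\<bar>z\<bar> \<le> 1" for z
    proof -
      have "0 \<le> p * a * \<rho>s powr \<theta> * \<bar>z\<bar>" "p * a * \<rho>s powr \<theta> * \<bar>z\<bar> \<le> p * a * \<rho>s powr \<theta>"
        using that a_pos theta by (auto simp: p_def intro!: mult_left_le mult_nonneg_nonneg)
      then show ?thesis
        by (auto simp: s_def)
    qed
  qed (simp add: s_def[abs_def])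
  have excess_eq: "excess \<omega> (\<rho>, 0) = (LINT z|law. g \<rho> z)" if "0 \<le> \<rho>" for \<rho>
  proof -
    have "\<rho> * max 0 (\<bar>rad (\<rho>, 0) * z\<bar> - \<omega>) = g \<rho> z" for z
    proof -
      have "\<rho> * rad (\<rho>, 0) = a * \<rho> powr p"
        using that by (cases "\<rho> = 0") (auto simp: rad_def p_def powr_add)
      moreover have "\<rho> * max 0 (\<bar>rad (\<rho>, 0) * z\<bar> - \<omega>) = max 0 (\<rho> * rad (\<rho>, 0) * \<bar>z\<bar> - \<omega> * \<rho>)"
        using that by (simp add: max_mult_distrib_left abs_mult algebra_simps)
      ultimately show ?thesis
        by (simp add: g_def)
    qed
    then show ?thesis
      by (simp add: excess_def flip: integral_mult_right_zero)
  qed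
  have g_ge: "g \<rho>s z + s z * (\<rho> - \<rho>s) \<le> g \<rho> z" if "0 \<le> \<rho>" for \<rho> z
  proof (cases "0 < a * \<rho>s powr p * \<bar>z\<bar> - \<omega> * \<rho>s")
    case True
    have "\<rho>s powr p + p * \<rho>s powr (p - 1) * (\<rho> - \<rho>s) \<le> \<rho> powr p"
      using theta that \<rho>s by (intro powr_tangent_le) (auto simp: p_def)
    then have "a * \<bar>z\<bar> * (\<rho>s powr p + p * \<rho>s powr \<theta> * (\<rho> - \<rho>s)) \<le> a * \<bar>z\<bar> * \<rho> powr p"
      using a_pos by (intro mult_left_mono) (auto simp: p_def)
    moreover have s_eq: "s z = p * a * \<rho>s powr \<theta> * \<bar>z\<bar> - \<omega>"
      using True by (simp add: s_def)
    moreover have "g \<rho>s z = a * \<rho>s powr p * \<bar>z\<bar> - \<omega> * \<rho>s" "a * \<rho> powr p * \<bar>z\<bar> - \<omega> * \<rho> \<le> g \<rho> z"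
      using True by (simp_all add: g_def)
    ultimately show ?thesis
      unfolding s_eq by (simp add: algebra_simps)
  qed (auto simp: g_def s_def)
  show ?thesis
  proof (intro exI[of _ "LINT z|law. s z"] allI impI)
    fix V :: state assume V: "0 \<le> fst V"
    have "excess \<omega> (\<rho>s, 0) + (LINT z|law. s z) * (fst V - \<rho>s) = (LINT z|law. g \<rho>s z + s z * (fst V - \<rho>s))"
      using g_int s_int \<rho>s by (simp add: excess_eq)
    also have "\<dots> \<le> (LINT z|law. g (fst V) z)"
      using g_int s_int g_ge V by (intro integral_mono) auto
    also have "\<dots> = excess \<omega> (fst V, 0)"
      using V by (simp add: excess_eq)
    also have "\<dots> \<le> excess \<omega> V"
      using excess_velocity_zero_le[of "fst V" \<omega> "snd V"] V by simp
    finally show "excess \<omega> (\<rho>s, 0) + (LINT z|law. s z) * (fst V - \<rho>s) \<le> excess \<omega> V" .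
  qed
qed

section \<open>Continuity on states and the zero set of the excess\<close>

lemma rad_continuous: "continuous_on D rad"
  unfolding rad_def using theta D_nonneg by (intro continuous_intros continuous_on_powr') auto

lemma excess_continuous: "continuous_on D (excess \<omega>)"
proof -
  have "continuous_on UNIV (\<lambda>p :: real \<times> real. LINT z|law. max 0 (\<bar>fst p + snd p * z\<bar> - \<omega>))"
    by (rule integral_law_continuous) (auto simp: case_prod_beta intro!: continuous_intros)
  then have "continuous_on D (\<lambda>V. LINT z|law. max 0 (\<bar>fst (snd V, rad V) + snd (snd V, rad V) * z\<bar> - \<omega>))"
    by (rule continuous_on_compose2) (auto intro!: continuous_intros rad_continuous)
  then show ?thesis
    unfolding excess_def by (intro continuous_intros) auto
qed

lemma excess_flux_continuous: "continuous_on D (excess_flux \<omega>)"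
proof -
  have "continuous_on UNIV (\<lambda>p :: real \<times> real. LINT z|law. (fst p + \<theta> * snd p * z) * max 0 (\<bar>fst p + snd p * z\<bar> - \<omega>))"
    by (rule integral_law_continuous) (auto simp: case_prod_beta intro!: continuous_intros)
  then have "continuous_on D (\<lambda>V. LINT z|law. (fst (snd V, rad V) + \<theta> * snd (snd V, rad V) * z) *
      max 0 (\<bar>fst (snd V, rad V) + snd (snd V, rad V) * z\<bar> - \<omega>))"
    by (rule continuous_on_compose2) (auto intro!: continuous_intros rad_continuous)
  then show ?thesis
    unfolding excess_flux_def by (intro continuous_intros) auto
qed

text \<open>The law charges every neighbourhood of z = 1 and z = -1 inside (-1, 1). If an invariant
  left the bound, \<bar>u + r z\<bar> would exceed \<omega> on a whole interval of z next to that
  end.\<close>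

lemma excess_eq_0_imp:
  assumes V: "0 < fst V" and "excess \<omega> V = 0"
  shows "- \<omega> \<le> omega1 \<kappa> \<gamma> V" "omega2 \<kappa> \<gamma> V \<le> \<omega>"
proof -
  have "(LINT z|law. max 0 (\<bar>snd V + rad V * z\<bar> - \<omega>)) = 0"
    using assms by (simp add: excess_def)
  then have "AE z in law. max 0 (\<bar>snd V + rad V * z\<bar> - \<omega>) = 0"
    by (subst (asm) integral_nonneg_eq_0_iff_AE) (auto intro: excess_integrable)
  then have "AE z in lborel. - 1 < z \<and> z < 1 \<longrightarrow> \<bar>snd V + rad V * z\<bar> \<le> \<omega>"
    by (auto simp: AE_law elim!: eventually_mono)
  then have ae: "AE z in lborel. b < z \<and> z < c \<longrightarrow> \<bar>snd V + rad V * z\<bar> \<le> \<omega>" if "- 1 \<le> b" "c \<le> 1" for b c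
    by eventually_elim (use that in auto)
  have r: "0 < rad V"
    using V by (rule rad_pos)
  show "omega2 \<kappa> \<gamma> V \<le> \<omega>"
  proof (rule ccontr)
    assume "\<not> ?thesis"
    then have "max (- 1) ((\<omega> - snd V) / rad V) < 1"
      using r by (simp add: omega_eq field_simps)
    from AE_lborel_interval_witness[OF this ae]
    obtain z where "(\<omega> - snd V) / rad V < z" "\<bar>snd V + rad V * z\<bar> \<le> \<omega>"
      by auto
    then show False
      using r by (simp add: field_simps)
  qed
  show "- \<omega> \<le> omega1 \<kappa> \<gamma> V"
  proof (rule ccontr)
    assume "\<not> ?thesis"
    then have "- 1 < min 1 ((- \<omega> - snd V) / rad V)"
      using r by (simp add: omega_eq field_simps)
    from AE_lborel_interval_witness[OF this ae]
    obtain z where "z < (- \<omega> - snd V) / rad V" "\<bar>snd V + rad V * z\<bar> \<le> \<omega>"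
      by auto
    then show False
      using r by (simp add: field_simps)
  qed
qed

end

section \<open>Self-similar test functions\<close>

text \<open>A time profile supported in [1, 2], hence away from t = 0 where x / t is
  singular.\<close>

definition bump :: "real \<Rightarrow> real" where
  "bump t = posq (t - 1) * posq (2 - t)"

definition bump' :: "real \<Rightarrow> real" where
  "bump' t = 2 * max 0 (t - 1) * posq (2 - t) - posq (t - 1) * (2 * max 0 (2 - t))"

lemma bump_derivative: "(bump has_real_derivative bump' t) (at t)"
  unfolding bump_def[abs_def] bump'_def by (auto intro!: derivative_eq_intros)

lemma bump_eq_0: "t \<notin> {1<..<2} \<Longrightarrow> bump t = 0 \<and> bump' t = 0"
  by (auto simp: bump_def bump'_def not_less)

lemma bump_nonneg: "0 \<le> bump t"
  by (simp add: bump_def)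

lemma bump_continuous [continuous_intros]:
  "continuous_on A f \<Longrightarrow> continuous_on A (\<lambda>x. bump (f x))"
  "continuous_on A f \<Longrightarrow> continuous_on A (\<lambda>x. bump' (f x))"
  unfolding bump_def bump'_def by (auto intro!: continuous_intros)

lemma bump_integrable:
  "integrable lborel bump" "integrable lborel (\<lambda>t. t * bump' t)"
proof -
  have "integrable lborel (\<lambda>t. 1 * bump t)" "integrable lborel (\<lambda>t. t * bump' t)"
    using bump_eq_0
    by (intro integrable_mult_compact_support[where K = "{1..2}" and C = 2] continuous_intros; force)+
  then show "integrable lborel bump" "integrable lborel (\<lambda>t. t * bump' t)"
    by simp_all
qed

lemma bump_integral_pos: "0 < (LINT t|lborel. bump t)"
proof -
  have "(LINT t|lborel. bump t) \<noteq> 0"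
  proof
    assume "(LINT t|lborel. bump t) = 0"
    then have "AE t in lborel. bump t = 0"
      by (subst (asm) integral_nonneg_eq_0_iff_AE[OF bump_integrable(1)]) (simp_all add: bump_nonneg)
    then have "AE t in lborel. 1 < t \<and> t < 2 \<longrightarrow> bump t = 0"
      by eventually_elim simp
    from AE_lborel_interval_witness[OF _ this] obtain t :: real where "1 < t" "t < 2" "bump t = 0"
      by auto
    then show False
      using posq_pos[of "t - 1"] posq_pos[of "2 - t"] by (simp add: bump_def)
  qed
  moreover have "0 \<le> (LINT t|lborel. bump t)"
    by (intro Bochner_Integration.integral_nonneg) (simp add: bump_nonneg)
  ultimately show ?thesis
    by simp
qed

lemma integral_derivative_compact_support:
  fixes f f' :: "real \<Rightarrow> real"
  assumes "\<And>x. (f has_real_derivative f' x) (at x)" "continuous_on UNIV f'"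
    and "l \<le> r" "f l = 0" "f r = 0" "\<And>x. x \<notin> {l..r} \<Longrightarrow> f' x = 0"
  shows "(LINT x|lborel. f' x) = 0"
proof -
  have "(LINT x|lborel. f' x) = (LINT x|lborel. f' x * indicator {l..r} x)"
    using assms(6) by (intro Bochner_Integration.integral_cong) (auto simp: indicator_def)
  also have "\<dots> = f r - f l"
    using assms by (intro integral_FTC_Icc_real) (auto simp: continuous_on_eq_continuous_at)
  finally show ?thesis
    using assms by simp
qed

text \<open>The integrand of the sum is the derivative of t \<open>bump\<close> t, which has compact
  support.\<close>

lemma bump_integral_by_parts: "(LINT t|lborel. t * bump' t) = - (LINT t|lborel. bump t)"
proof -
  have "(LINT t|lborel. bump t + t * bump' t) = 0"
    by (rule integral_derivative_compact_support[where f = "\<lambda>t. t * bump t" and l = 1 and r = 2])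
       (use bump_eq_0 in \<open>auto intro!: derivative_eq_intros bump_derivative continuous_intros\<close>)
  then show ?thesis
    using bump_integrable by simp
qed

text \<open>Data for the test functions \<open>bump t * \<beta> (x / t)\<close>. Against functions
  of x / t they reduce an entropy inequality in the plane to one on the line of speeds.\<close>

locale self_similar_cutoff =
  fixes \<beta> \<beta>' :: "real \<Rightarrow> real" and B :: real
  assumes deriv: "\<And>x. (\<beta> has_real_derivative \<beta>' x) (at x)"
    and cont': "continuous_on UNIV \<beta>'"
    and supp: "\<And>x. x \<notin> {-B..B} \<Longrightarrow> \<beta> x = 0 \<and> \<beta>' x = 0"
    and B: "0 \<le> B"
begin

lemma cont: "continuous_on UNIV \<beta>"
  using deriv by (meson DERIV_isCont continuous_at_imp_continuous_on)

definition "\<phi> = (\<lambda>(t, x). bump t * \<beta> (x / t))"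
definition "\<phi>t = (\<lambda>(t, x). bump' t * \<beta> (x / t) - bump t * \<beta>' (x / t) * (x / t\<^sup>2))"
definition "\<phi>x = (\<lambda>(t, x). bump t * \<beta>' (x / t) / t)"

lemma support:
  assumes "p \<notin> {1..2} \<times> {-2*B..2*B}"
  shows "\<phi> p = 0" "\<phi>t p = 0" "\<phi>x p = 0"
proof -
  obtain t x where p: "p = (t, x)"
    by (cases p)
  have "bump t = 0 \<and> bump' t = 0 \<or> \<beta> (x / t) = 0 \<and> \<beta>' (x / t) = 0"
  proof (cases "t \<in> {1..2}")
    case True
    then have "2 * B < x \<or> x < - 2 * B"
      using assms p by auto
    moreover have "B * t \<le> 2 * B"
      using True B mult_left_mono[of t 2 B] by (simp add: mult.commute)
    ultimately have "x / t \<notin> {-B..B}"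
      using True by (auto simp: field_simps)
    then show ?thesis
      using supp by blast
  qed (use bump_eq_0 in auto)
  then show "\<phi> p = 0" "\<phi>t p = 0" "\<phi>x p = 0"
    by (auto simp: \<phi>_def \<phi>t_def \<phi>x_def p)
qed

text \<open>The quotient x / t is continuous for t \<ge> 1, and for t \<le> 1 both
  \<open>bump\<close> and \<open>bump'\<close> vanish; the two closed half-planes are glued along t
  = 1.\<close>

lemma continuous: "continuous_on UNIV \<phi>t" "continuous_on UNIV \<phi>x"
proof -
  have early: "\<phi>t p = 0" "\<phi>x p = 0" if "fst p \<le> 1" for p
    using that bump_eq_0[of "fst p"] by (auto simp: \<phi>t_def \<phi>x_def case_prod_beta)
  have late: "continuous_on {p. 1 \<le> fst p} \<phi>t" "continuous_on {p. 1 \<le> fst p} \<phi>x"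
    unfolding \<phi>t_def \<phi>x_def case_prod_beta
    by (auto intro!: continuous_intros continuous_on_compose2[OF cont] continuous_on_compose2[OF cont'])
  have "continuous_on {p. fst p \<le> 1} \<phi>t" "continuous_on {p. fst p \<le> 1} \<phi>x"
    using early by (auto cong: continuous_on_cong_simp)
  then have "continuous_on ({p. fst p \<le> 1} \<union> {p. 1 \<le> fst p}) \<phi>t"
    "continuous_on ({p. fst p \<le> 1} \<union> {p. 1 \<le> fst p}) \<phi>x"
    using late by (auto intro!: continuous_on_closed_Un closed_Collect_le continuous_intros)
  moreover have "{p :: real \<times> real. fst p \<le> 1} \<union> {p. 1 \<le> fst p} = UNIV"
    by auto
  ultimately show "continuous_on UNIV \<phi>t" "continuous_on UNIV \<phi>x"
    by simp_all
qed

lemma derivative: "(\<phi> has_derivative (\<lambda>(h, k). \<phi>t p * h + \<phi>x p * k)) (at p)"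
proof (cases "fst p < 1")
  case True
  have "\<phi>t p = 0" "\<phi>x p = 0"
    using True bump_eq_0[of "fst p"] by (auto simp: \<phi>t_def \<phi>x_def case_prod_beta)
  then have "(\<lambda>(h, k). \<phi>t p * h + \<phi>x p * k) = (\<lambda>_. 0)"
    by (simp add: fun_eq_iff)
  then have "((\<lambda>p. 0) has_derivative (\<lambda>(h, k). \<phi>t p * h + \<phi>x p * k)) (at p)"
    by simp
  then show ?thesis
  proof (rule has_derivative_transform_within_open)
    show "open {p :: real \<times> real. fst p < 1}"
      by (intro open_Collect_less continuous_intros)
    show "0 = \<phi> q" if "q \<in> {p. fst p < 1}" for q
      using that bump_eq_0[of "fst q"] by (auto simp: \<phi>_def case_prod_beta)
  qed (use True in simp)
next
  case False
  then have t: "fst p \<noteq> 0"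
    by auto
  have 1: "((\<lambda>q. bump (fst q)) has_derivative (\<lambda>h. fst h * bump' (fst p))) (at p)"
    by (rule DERIV_compose_FDERIV[OF bump_derivative]) (auto intro!: derivative_eq_intros)
  have "((\<lambda>q. snd q / fst q) has_derivative
      (\<lambda>h. snd h / fst p - snd p / (fst p)\<^sup>2 * fst h)) (at p)"
    using t by (auto intro!: derivative_eq_intros simp: field_simps power2_eq_square)
  from DERIV_compose_FDERIV[OF deriv this]
  have 2: "((\<lambda>q. \<beta> (snd q / fst q)) has_derivative
      (\<lambda>h. (snd h / fst p - snd p / (fst p)\<^sup>2 * fst h) * \<beta>' (snd p / fst p))) (at p)" .
  show ?thesis
    unfolding \<phi>_def \<phi>t_def \<phi>x_def case_prod_beta
    by (rule has_derivative_eq_rhs[OF has_derivative_mult[OF 1 2]])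
       (simp add: fun_eq_iff algebra_simps)
qed

lemma test_function: "test_function (cylinder \<infinity> UNIV) \<phi> \<phi>t \<phi>x"
  unfolding test_function_def
proof (intro conjI allI derivative continuous)
  show "\<exists>K. compact K \<and> K \<subseteq> cylinder \<infinity> UNIV \<and> (\<forall>p. p \<notin> K \<longrightarrow> \<phi> p = 0)"
    using support(1)
    by (intro exI[of _ "{1..2} \<times> {-2*B..2*B}"]) (auto simp: cylinder_def intro!: compact_Times)
qed

text \<open>For a self-similar integrand the change of variables \<open>x = t \<xi>\<close> splits off the factor
  \<open>\<integral> bump\<close>, because \<open>\<integral> t bump' = - \<integral> bump\<close>.\<close>

lemma integral_self_similar:
  fixes q g :: "real \<Rightarrow> real"
  assumes q [measurable]: "q \<in> borel_measurable borel" and g [measurable]: "g \<in> borel_measurable borel"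
    and bound: "AE x in lborel. \<bar>q x\<bar> \<le> C \<and> \<bar>g x\<bar> \<le> C"
    and plane: "AE p in lborel. p \<in> {1..2} \<times> {-2*B..2*B} \<longrightarrow>
      \<bar>q (snd p / fst p)\<bar> \<le> C \<and> \<bar>g (snd p / fst p)\<bar> \<le> C"
  shows "integrable lborel (\<lambda>\<xi>. q \<xi> * \<beta> \<xi>)" "integrable lborel (\<lambda>\<xi>. (g \<xi> - \<xi> * q \<xi>) * \<beta>' \<xi>)"
    and "(LINT p|lborel. q (snd p / fst p) * \<phi>t p + g (snd p / fst p) * \<phi>x p) =
      ((LINT \<xi>|lborel. (g \<xi> - \<xi> * q \<xi>) * \<beta>' \<xi>) - (LINT \<xi>|lborel. q \<xi> * \<beta> \<xi>)) * (LINT t|lborel. bump t)"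
proof -
  have K: "compact {-B..B}"
    by simp
  show int1: "integrable lborel (\<lambda>\<xi>. q \<xi> * \<beta> \<xi>)"
    using bound supp
    by (intro integrable_mult_compact_support[OF cont K, where C = C]) (auto elim!: eventually_mono)
  show int2: "integrable lborel (\<lambda>\<xi>. (g \<xi> - \<xi> * q \<xi>) * \<beta>' \<xi>)"
  proof (rule integrable_mult_compact_support[OF cont' K, where C = "C + B * C"])
    show "AE x in lborel. x \<in> {-B..B} \<longrightarrow> \<bar>g x - x * q x\<bar> \<le> C + B * C"
      using bound
    proof eventually_elim
      case (elim x)
      show ?case
      proof
        assume "x \<in> {-B..B}"
        then have "\<bar>x * q x\<bar> \<le> B * C"
          using elim B unfolding abs_mult by (intro mult_mono) auto
        then show "\<bar>g x - x * q x\<bar> \<le> C + B * C"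
          using elim by linarith
      qed
    qed
  qed (use supp in auto)
  define I1 where "I1 = (LINT \<xi>|lborel. q \<xi> * \<beta> \<xi>)"
  define I2 where "I2 = (LINT \<xi>|lborel. (g \<xi> - \<xi> * q \<xi>) * \<beta>' \<xi>)"
  let ?f = "\<lambda>p. q (snd p / fst p) * \<phi>t p + g (snd p / fst p) * \<phi>x p"
  have K2: "compact ({1..2::real} \<times> {-2*B..2*B})"
    by (intro compact_Times compact_Icc)
  have meas: "(\<lambda>p. q (snd p / fst p)) \<in> borel_measurable borel"
    "(\<lambda>p. g (snd p / fst p)) \<in> borel_measurable borel"
    by (simp_all add: borel_prod[symmetric])
  have "integrable lborel (\<lambda>p. q (snd p / fst p) * \<phi>t p)"
    by (rule integrable_mult_compact_support[OF continuous(1) K2 support(2) meas(1), where C = C])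
       (use plane in \<open>auto elim!: eventually_mono\<close>)
  moreover have "integrable lborel (\<lambda>p. g (snd p / fst p) * \<phi>x p)"
    by (rule integrable_mult_compact_support[OF continuous(2) K2 support(3) meas(2), where C = C])
       (use plane in \<open>auto elim!: eventually_mono\<close>)
  ultimately have int: "integrable (lborel \<Otimes>\<^sub>M lborel) ?f"
    by (simp add: lborel_prod)
  \<comment> \<open>With x = t \<xi>, the Jacobian t turns \<open>\<phi>t\<close> into t
    \<open>bump'\<close> \<beta> - \<open>bump\<close> \<xi> \<beta>' and \<open>\<phi>x\<close>
    into \<open>bump\<close> \<beta>'.\<close>
  have inner: "(LINT x|lborel. ?f (t, x)) = t * bump' t * I1 + bump t * I2" for t
  proof (cases "1 < t")
    case True
    have "(LINT x|lborel. ?f (t, x)) = t * (LINT \<xi>|lborel. ?f (t, t * \<xi>))"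
      using True by (subst lborel_integral_real_affine[where c = t and t = 0]) auto
    also have "\<dots> = (LINT \<xi>|lborel. t * bump' t * (q \<xi> * \<beta> \<xi>) + bump t * ((g \<xi> - \<xi> * q \<xi>) * \<beta>' \<xi>))"
      unfolding integral_mult_right_zero[symmetric]
      using True by (intro Bochner_Integration.integral_cong refl)
        (simp add: \<phi>t_def \<phi>x_def field_simps power2_eq_square)
    also have "\<dots> = t * bump' t * I1 + bump t * I2"
      using int1 int2 by (simp add: I1_def I2_def)
    finally show ?thesis .
  next
    case False
    then show ?thesis
      using bump_eq_0[of t] by (simp add: \<phi>t_def \<phi>x_def)
  qed
  have "(LINT p|lborel. ?f p) = (LINT t|lborel. LINT x|lborel. ?f (t, x))"
    using lborel_pair.integral_fst'[OF int] by (simp add: lborel_prod)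
  also have "\<dots> = (LINT t|lborel. t * bump' t * I1 + bump t * I2)"
    unfolding inner ..
  also have "\<dots> = (I2 - I1) * (LINT t|lborel. bump t)"
    using bump_integrable by (simp add: bump_integral_by_parts left_diff_distrib)
  finally show "(LINT p|lborel. ?f p) = ((LINT \<xi>|lborel. (g \<xi> - \<xi> * q \<xi>) * \<beta>' \<xi>) -
      (LINT \<xi>|lborel. q \<xi> * \<beta> \<xi>)) * (LINT t|lborel. bump t)"
    by (simp add: I1_def I2_def)
qed

end

section \<open>Entropy flux of traces of Riemann solutions\<close>

text \<open>Off the compact support the function vanishes on an open set, so uniqueness of the
  derivative applies. Integrals over cylinders can therefore be extended to larger domains or to the
  whole plane without changing them.\<close>

lemma test_function_derivative_eq_0:
  assumes "test_function Q \<phi> \<phi>t \<phi>x" "p \<notin> Q"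
  shows "\<phi>t p = 0" "\<phi>x p = 0"
proof -
  obtain K where K: "compact K" "K \<subseteq> Q" "\<And>p. p \<notin> K \<Longrightarrow> \<phi> p = 0"
    and deriv: "(\<phi> has_derivative (\<lambda>(h, k). \<phi>t p * h + \<phi>x p * k)) (at p)"
    using assms(1) unfolding test_function_def by blast
  have "((\<lambda>p. 0) has_derivative (\<lambda>(h, k). \<phi>t p * h + \<phi>x p * k)) (at p)"
  proof (rule has_derivative_transform_within_open[OF deriv])
    show "open (- K)" "p \<in> - K"
      using K assms(2) compact_imp_closed[OF K(1)] by (auto intro: open_Compl)
  qed (use K in auto)
  moreover have "((\<lambda>p. 0) has_derivative (\<lambda>p. 0 :: real)) (at p)"
    by simp
  ultimately have "(\<lambda>(h, k). \<phi>t p * h + \<phi>x p * k) = (\<lambda>p. 0)"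
    by (rule has_derivative_unique)
  from fun_cong[OF this, of "(1, 0)"] fun_cong[OF this, of "(0, 1)"] show "\<phi>t p = 0" "\<phi>x p = 0"
    by simp_all
qed

lemma test_function_mono: "test_function Q \<phi> \<phi>t \<phi>x \<Longrightarrow> Q \<subseteq> Q' \<Longrightarrow> test_function Q' \<phi> \<phi>t \<phi>x"
  unfolding test_function_def by blast

lemma cylinder_measurable [measurable]:
  "X \<in> sets borel \<Longrightarrow> cylinder T X \<in> sets (borel \<Otimes>\<^sub>M borel)"
proof -
  assume [measurable]: "X \<in> sets borel"
  have "cylinder T X = {p \<in> space (borel \<Otimes>\<^sub>M borel). 0 < fst p \<and> ereal (fst p) < T \<and> snd p \<in> X}"
    by (auto simp: cylinder_def space_pair_measure)
  also have "\<dots> \<in> sets (borel \<Otimes>\<^sub>M borel)"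
    by measurable
  finally show ?thesis .
qed

context isentropic_gas
begin

text \<open>Supplies the essential bounds on entropy and flux from the essential bound on the state;
  the shift c is included so that the same bound serves at the trace and in the pipelines.\<close>

lemma bounded_on_states:
  "\<exists>C. \<forall>V. V \<in> D \<longrightarrow> norm V \<le> M \<longrightarrow>
      \<bar>excess \<omega> V - c * fst V\<bar> \<le> C \<and> \<bar>excess_flux \<omega> V - c * (fst V * snd V)\<bar> \<le> C"
proof -
  define r where "r = a * M powr \<theta>"
  define h where "h = M * (M + r + \<bar>\<omega>\<bar>)"
  have "\<bar>excess \<omega> V - c * fst V\<bar> \<le> max (h + \<bar>c\<bar> * M) ((M + r) * h + \<bar>c\<bar> * (M * M)) \<and>
      \<bar>excess_flux \<omega> V - c * (fst V * snd V)\<bar> \<le> max (h + \<bar>c\<bar> * M) ((M + r) * h + \<bar>c\<bar> * (M * M))"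
    if V: "V \<in> D" and "norm V \<le> M" for V
  proof -
    have V0: "0 \<le> fst V" and M: "fst V \<le> M" "\<bar>snd V\<bar> \<le> M"
      using D_nonneg[OF V] that norm_fst_le[of "fst V" "snd V"] norm_snd_le[of "snd V" "fst V"] by auto
    then have "0 \<le> M"
      by linarith
    have "rad V \<le> r"
      unfolding rad_def r_def using V0 M a_pos theta by (intro mult_left_mono powr_mono2) auto
    then have "0 \<le> r"
      using rad_nonneg[of V] by linarith
    have "excess \<omega> V \<le> fst V * max 0 (\<bar>snd V\<bar> + rad V - \<omega>)"
      by (rule excess_le[OF V0])
    also have "\<dots> \<le> M * (M + r + \<bar>\<omega>\<bar>)"
      using M V0 \<open>rad V \<le> r\<close> \<open>0 \<le> r\<close> by (intro mult_mono) auto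
    finally have H: "0 \<le> excess \<omega> V" "excess \<omega> V \<le> h"
      using excess_nonneg[OF V0] by (auto simp: h_def)
    have "\<bar>excess_flux \<omega> V\<bar> \<le> (\<bar>snd V\<bar> + rad V) * excess \<omega> V"
      by (rule excess_flux_abs_le[OF V0])
    also have "\<dots> \<le> (M + r) * h"
      using M V0 \<open>rad V \<le> r\<close> \<open>0 \<le> r\<close> H by (intro mult_mono) auto
    finally have F: "\<bar>excess_flux \<omega> V\<bar> \<le> (M + r) * h" .
    have "\<bar>c * fst V\<bar> \<le> \<bar>c\<bar> * M" "\<bar>c * (fst V * snd V)\<bar> \<le> \<bar>c\<bar> * (M * M)"
      unfolding abs_mult using M V0 \<open>0 \<le> M\<close> by (intro mult_mono mult_nonneg_nonneg order_refl; simp)+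
    then show ?thesis
      using H F by linarith
  qed
  then show ?thesis
    by blast
qed

text \<open>By contradiction: if g were positive at 0+, then k = g - \<xi> (q - e) would exceed some
  h > 0 on a short interval to the right of 0, although it vanishes far to the left. A cutoff that
  rises on the left and falls inside that interval turns the self-similar entropy inequality into 0
  \<le> -h.\<close>

theorem trace_entropy_flux_le:
  assumes V: "V \<in> V_set \<kappa> \<gamma> (\<rho>s, 0)" and \<rho>s: "0 \<le> \<rho>s"
    and c: "\<And>V. 0 \<le> fst V \<Longrightarrow> excess \<omega> (\<rho>s, 0) + c * (fst V - \<rho>s) \<le> excess \<omega> V"
  shows "excess_flux \<omega> V \<le> c * (fst V * snd V)"
proof (rule ccontr)
  assume contr: "\<not> ?thesis"
  obtain W where VD: "V \<in> D" and fan: "\<exists>Ur. lax_fan \<kappa> \<gamma> (\<rho>s, 0) Ur W"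
    and weak: "weak_entropy_solution \<kappa> \<gamma> \<infinity> UNIV (\<lambda>t x. W (x / t))"
    and lim: "(W \<longlongrightarrow> V) (at_right 0)"
    using V by (auto simp: V_set_def riemann_solution_def)
  have WD: "W \<xi> \<in> D" for \<xi>
    using fan by (auto simp: lax_fan_def)
  obtain a1 where a1: "\<And>\<xi>. \<xi> < a1 \<Longrightarrow> W \<xi> = (\<rho>s, 0)"
    using fan by (auto simp: lax_fan_def)
  have sol: "weak_solution \<kappa> \<gamma> \<infinity> UNIV (\<lambda>t x. W (x / t))"
    using weak by (simp add: weak_entropy_solution_def)

  have W_meas [measurable]: "W \<in> borel_measurable borel"
  proof -
    have "set_borel_measurable lborel (cylinder \<infinity> UNIV) (\<lambda>(t, x). W (x / t))"
      using sol by (simp add: weak_solution_def)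
    then have "(\<lambda>p. indicator (cylinder \<infinity> UNIV) p *\<^sub>R W (snd p / fst p)) \<in> borel_measurable (borel \<Otimes>\<^sub>M borel)"
      by (simp add: set_borel_measurable_def case_prod_beta borel_prod)
    moreover have "(\<lambda>\<xi>. (1 :: real, \<xi>)) \<in> borel \<rightarrow>\<^sub>M borel \<Otimes>\<^sub>M (borel :: real measure)"
      by measurable
    ultimately have "(\<lambda>\<xi>. indicator (cylinder \<infinity> UNIV) (1, \<xi>) *\<^sub>R W (snd (1 :: real, \<xi>) / fst (1 :: real, \<xi>))) \<in> borel_measurable borel"
      by (rule measurable_compose[rotated])
    then show ?thesis
      by (simp add: cylinder_def)
  qed
  \<comment> \<open>Any time beyond 2 would do: the support of \<open>bump\<close> must lie below
    it.\<close>
  obtain M0 where M0: "AE p in lborel. p \<in> cylinder 3 UNIV \<longrightarrow> norm (W (snd p / fst p)) \<le> M0"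
    using sol unfolding weak_solution_def by (auto simp: case_prod_beta dest!: spec[of _ 3])
  \<comment> \<open>By Fubini the bound holds for almost every x at one time t between 1 and 2;
    scaling by t makes it a bound on the profile itself.\<close>
  have M1: "AE \<xi> in lborel. norm (W \<xi>) \<le> M0"
  proof -
    have "AE t in lborel. AE x in lborel. (t, x) \<in> cylinder 3 UNIV \<longrightarrow> norm (W (x / t)) \<le> M0"
      using lborel_pair.AE_pair[unfolded lborel_prod, OF M0] by simp
    then have "AE t in lborel. 1 < t \<and> t < 2 \<longrightarrow> (AE x in lborel. norm (W (x / t)) \<le> M0)"
      by eventually_elim (auto simp: cylinder_def)
    from AE_lborel_interval_witness[OF _ this] obtain t :: real
      where t: "1 < t" "AE x in lborel. norm (W (x / t)) \<le> M0"
      by auto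
    have "AE x in lborel. norm (W ((0 + t * x) / t)) \<le> M0"
      by (rule AE_borel_affine[where P = "\<lambda>x. norm (W (x / t)) \<le> M0"]) (use t in auto)
    then show ?thesis
      using t by simp
  qed

  define q where "q \<xi> = excess \<omega> (W \<xi>) - c * fst (W \<xi>)" for \<xi>
  define g where "g \<xi> = excess_flux \<omega> (W \<xi>) - c * (fst (W \<xi>) * snd (W \<xi>))" for \<xi>
  define e where "e = excess \<omega> (\<rho>s, 0) - c * \<rho>s"
  \<comment> \<open>Measuring q from its value e at the left state makes k vanish to the left of the
    fan, whatever the speed \<xi>.\<close>
  define k where "k \<xi> = g \<xi> - \<xi> * (q \<xi> - e)" for \<xi>
  have fstW: "0 \<le> fst (W \<xi>)" for \<xi>
    using WD D_nonneg by blast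
  have q_ge: "e \<le> q \<xi>" for \<xi>
    using c[OF fstW] by (simp add: q_def e_def algebra_simps)
  have left: "q \<xi> = e" "g \<xi> = 0" if "\<xi> < a1" for \<xi>
    using a1[OF that] excess_flux_velocity_zero by (simp_all add: q_def e_def g_def)
  have "W \<in> borel \<rightarrow>\<^sub>M borel \<Otimes>\<^sub>M borel"
    using W_meas by (simp add: borel_prod)
  then have [measurable]: "(\<lambda>\<xi>. fst (W \<xi>)) \<in> borel_measurable borel" "(\<lambda>\<xi>. snd (W \<xi>)) \<in> borel_measurable borel"
    by (auto intro: measurable_compose[OF _ measurable_fst] measurable_compose[OF _ measurable_snd])
  have [measurable]: "(\<lambda>\<xi>. excess \<omega> (W \<xi>)) \<in> borel_measurable borel" "(\<lambda>\<xi>. excess_flux \<omega> (W \<xi>)) \<in> borel_measurable borel"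
    by (rule measurable_compose[OF W_meas excess_measurable] measurable_compose[OF W_meas excess_flux_measurable])+
  have q_meas [measurable]: "q \<in> borel_measurable borel" and g_meas [measurable]: "g \<in> borel_measurable borel"
    unfolding q_def[abs_def] g_def[abs_def] by measurable

  obtain C where C: "\<And>V. V \<in> D \<Longrightarrow> norm V \<le> M0 \<Longrightarrow>
      \<bar>excess \<omega> V - c * fst V\<bar> \<le> C \<and> \<bar>excess_flux \<omega> V - c * (fst V * snd V)\<bar> \<le> C"
    using bounded_on_states by blast
  have qg: "\<bar>q \<xi>\<bar> \<le> C \<and> \<bar>g \<xi>\<bar> \<le> C" if "norm (W \<xi>) \<le> M0" for \<xi>
    using C[OF WD that] by (simp add: q_def g_def)
  have bound: "AE \<xi> in lborel. \<bar>q \<xi>\<bar> \<le> C \<and> \<bar>g \<xi>\<bar> \<le> C"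
    using M1 by eventually_elim (rule qg)
  have plane: "AE p in lborel. p \<in> {1..2} \<times> {-2*B..2*B} \<longrightarrow>
      \<bar>q (snd p / fst p)\<bar> \<le> C \<and> \<bar>g (snd p / fst p)\<bar> \<le> C" for B
    using M0 by eventually_elim (use qg in \<open>auto simp: cylinder_def\<close>)

  have g_lim: "(g \<longlongrightarrow> excess_flux \<omega> V - c * (fst V * snd V)) (at_right 0)"
  proof -
    have "((\<lambda>\<xi>. excess_flux \<omega> (W \<xi>)) \<longlongrightarrow> excess_flux \<omega> V) (at_right 0)"
      by (rule continuous_on_tendsto_compose[OF excess_flux_continuous lim VD]) (simp add: WD)
    then show ?thesis
      unfolding g_def by (intro tendsto_intros lim)
  qed
  have q_lim: "(q \<longlongrightarrow> excess \<omega> V - c * fst V) (at_right 0)"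
  proof -
    have "((\<lambda>\<xi>. excess \<omega> (W \<xi>)) \<longlongrightarrow> excess \<omega> V) (at_right 0)"
      by (rule continuous_on_tendsto_compose[OF excess_continuous lim VD]) (simp add: WD)
    then show ?thesis
      unfolding q_def by (intro tendsto_intros lim)
  qed
  define h where "h = (excess_flux \<omega> V - c * (fst V * snd V)) / 2"
  have h: "0 < h"
    using contr by (simp add: h_def)
  have "(k \<longlongrightarrow> (excess_flux \<omega> V - c * (fst V * snd V)) - 0 * ((excess \<omega> V - c * fst V) - e)) (at_right 0)"
    unfolding k_def[abs_def] by (intro tendsto_intros g_lim q_lim)
  then have "\<forall>\<^sub>F \<xi> in at_right 0. h < k \<xi>"
    using h by (intro order_tendstoD(1)) (auto simp: h_def)
  then obtain \<delta> where \<delta>: "0 < \<delta>" "\<And>\<xi>. 0 < \<xi> \<Longrightarrow> \<xi> < \<delta> \<Longrightarrow> h < k \<xi>"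
    by (auto simp: eventually_at_right_field)

  define \<epsilon> where "\<epsilon> = \<delta> / 3"
  define L where "L = \<bar>a1\<bar> + 1"
  have \<epsilon>: "0 < \<epsilon>" "2 * \<epsilon> < \<delta>"
    using \<delta> by (auto simp: \<epsilon>_def)
  \<comment> \<open>It rises on [-L-1, -L], to the left of \<open>a1\<close>, and falls on
    [\<epsilon>, 2 \<epsilon>], which lies inside (0, \<delta>), where k > h.\<close>
  define \<beta> where "\<beta> \<xi> = step (\<xi> + L + 1) * step (2 - \<xi> / \<epsilon>)" for \<xi>
  define \<beta>' where "\<beta>' \<xi> = step' (\<xi> + L + 1) * step (2 - \<xi> / \<epsilon>) - step (\<xi> + L + 1) * (step' (2 - \<xi> / \<epsilon>) / \<epsilon>)" for \<xi>
  define B where "B = L + 1 + 2 * \<epsilon>"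
  interpret self_similar_cutoff \<beta> \<beta>' B
  proof
    show "(\<beta> has_real_derivative \<beta>' x) (at x)" for x
      unfolding \<beta>_def[abs_def] \<beta>'_def using \<epsilon> by (auto intro!: derivative_eq_intros)
    show "continuous_on UNIV \<beta>'"
      unfolding \<beta>'_def[abs_def] using \<epsilon> by (auto intro!: continuous_intros)
    show "\<beta> x = 0 \<and> \<beta>' x = 0" if "x \<notin> {-B..B}" for x
    proof -
      have "x + L + 1 \<le> 0 \<or> 2 - x / \<epsilon> \<le> 0"
        using that \<epsilon> by (auto simp: B_def L_def field_simps)
      then show ?thesis
        by (auto simp: \<beta>_def \<beta>'_def step'_eq_0)
    qed
    show "0 \<le> B"
      using \<epsilon> by (simp add: B_def L_def)
  qed

  have "0 \<le> (LINT p|lborel. q (snd p / fst p) * \<phi>t p + g (snd p / fst p) * \<phi>x p)"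
  proof -
    have "0 \<le> (LINT (t, x):cylinder \<infinity> UNIV|lborel.
        eta \<kappa> \<gamma> (cutoff \<omega> c) (W (x / t)) * \<phi>t (t, x) + entropy_flux \<kappa> \<gamma> (cutoff \<omega> c) (W (x / t)) * \<phi>x (t, x))"
    proof -
      have "0 \<le> \<phi> p" for p
        by (simp add: \<phi>_def \<beta>_def bump_nonneg case_prod_beta)
      then show ?thesis
        using weak test_function cutoff_convex unfolding weak_entropy_solution_def by blast
    qed
    also have "\<dots> = (LINT p|lborel. q (snd p / fst p) * \<phi>t p + g (snd p / fst p) * \<phi>x p)"
      unfolding set_lebesgue_integral_def
      using test_function_derivative_eq_0[OF test_function]
      by (intro Bochner_Integration.integral_cong refl)
         (auto simp: indicator_def eta_cutoff entropy_flux_cutoff fstW q_def g_def)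
    finally show ?thesis .
  qed
  then have "(LINT \<xi>|lborel. q \<xi> * \<beta> \<xi>) \<le> (LINT \<xi>|lborel. (g \<xi> - \<xi> * q \<xi>) * \<beta>' \<xi>)"
    using bump_integral_pos integral_self_similar(3)[OF q_meas g_meas bound plane] by (simp add: zero_le_mult_iff)
  \<comment> \<open>The added integrand is e times the derivative of \<xi> \<beta>, so it
    contributes 0; it replaces q by q - e in both terms.\<close>
  then have "0 \<le> (LINT \<xi>|lborel. (g \<xi> - \<xi> * q \<xi>) * \<beta>' \<xi>) - (LINT \<xi>|lborel. q \<xi> * \<beta> \<xi>) +
      e * (LINT \<xi>|lborel. \<beta> \<xi> + \<xi> * \<beta>' \<xi>)"
  proof -
    have "(LINT \<xi>|lborel. \<beta> \<xi> + \<xi> * \<beta>' \<xi>) = 0"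
    proof (rule integral_derivative_compact_support[where f = "\<lambda>x. x * \<beta> x" and l = "-B-1" and r = "B+1"])
      show "((\<lambda>x. x * \<beta> x) has_real_derivative \<beta> x + x * \<beta>' x) (at x)" for x
        by (auto intro!: derivative_eq_intros deriv)
      show "continuous_on UNIV (\<lambda>x. \<beta> x + x * \<beta>' x)"
        by (intro continuous_intros cont cont')
    qed (use supp B in auto)
    then show ?thesis
      using \<open>(LINT \<xi>|lborel. q \<xi> * \<beta> \<xi>) \<le> _\<close> by simp
  qed
  also have "\<dots> = (LINT \<xi>|lborel. ((g \<xi> - \<xi> * q \<xi>) * \<beta>' \<xi> - q \<xi> * \<beta> \<xi>) + e * (\<beta> \<xi> + \<xi> * \<beta>' \<xi>))"
  proof -
    have "integrable lborel (\<lambda>\<xi>. 1 * (\<beta> \<xi> + \<xi> * \<beta>' \<xi>))"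
      by (rule integrable_mult_compact_support[where K = "{-B..B}" and C = 1])
         (use supp in \<open>auto intro!: continuous_intros cont cont'\<close>)
    then show ?thesis
      using integral_self_similar(1,2)[OF q_meas g_meas bound plane] by simp
  qed
  also have "\<dots> \<le> (LINT \<xi>|lborel. - h * (indicator {\<epsilon>..2 * \<epsilon>} \<xi> * (step' (2 - \<xi> / \<epsilon>) / \<epsilon>)))"
  proof (rule integral_mono)
    have "integrable lborel (\<lambda>\<xi>. 1 * (\<beta> \<xi> + \<xi> * \<beta>' \<xi>))"
      by (rule integrable_mult_compact_support[where K = "{-B..B}" and C = 1])
         (use supp in \<open>auto intro!: continuous_intros cont cont'\<close>)
    then show "integrable lborel (\<lambda>\<xi>. ((g \<xi> - \<xi> * q \<xi>) * \<beta>' \<xi> - q \<xi> * \<beta> \<xi>) + e * (\<beta> \<xi> + \<xi> * \<beta>' \<xi>))"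
      using integral_self_similar(1,2)[OF q_meas g_meas bound plane] by simp
    have "integrable lborel (\<lambda>\<xi>. indicator {\<epsilon>..2 * \<epsilon>} \<xi> *\<^sub>R (step' (2 - \<xi> / \<epsilon>) / \<epsilon>))"
      by (rule borel_integrable_compact) (use \<epsilon> in \<open>auto intro!: continuous_intros\<close>)
    then show "integrable lborel (\<lambda>\<xi>. - h * (indicator {\<epsilon>..2 * \<epsilon>} \<xi> * (step' (2 - \<xi> / \<epsilon>) / \<epsilon>)))"
      unfolding real_scaleR_def by (rule integrable_mult_right)
    fix \<xi> :: real
    have "((g \<xi> - \<xi> * q \<xi>) * \<beta>' \<xi> - q \<xi> * \<beta> \<xi>) + e * (\<beta> \<xi> + \<xi> * \<beta>' \<xi>) = k \<xi> * \<beta>' \<xi> - (q \<xi> - e) * \<beta> \<xi>"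
      by (simp add: k_def algebra_simps)
    \<comment> \<open>This is where the support property enters: q \<ge> e everywhere in the
      fan.\<close>
    also have "\<dots> \<le> k \<xi> * \<beta>' \<xi>"
      using q_ge[of \<xi>] by (simp add: \<beta>_def)
    also have "\<dots> \<le> - h * (indicator {\<epsilon>..2 * \<epsilon>} \<xi> * (step' (2 - \<xi> / \<epsilon>) / \<epsilon>))"
    proof (cases "\<xi> < - L")
      case True
      then have "\<xi> < a1"
        by (simp add: L_def)
      then have "k \<xi> = 0"
        using left by (simp add: k_def)
      moreover have "\<xi> < \<epsilon>"
        using True \<epsilon> by (simp add: L_def)
      ultimately show ?thesis
        by simp
    next
      case False
      then have \<beta>': "\<beta>' \<xi> = - (step' (2 - \<xi> / \<epsilon>) / \<epsilon>)"
        by (simp add: \<beta>'_def step'_eq_0)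
      show ?thesis
      proof (cases "\<epsilon> < \<xi> \<and> \<xi> < 2 * \<epsilon>")
        case True
        then have "h * (step' (2 - \<xi> / \<epsilon>) / \<epsilon>) \<le> k \<xi> * (step' (2 - \<xi> / \<epsilon>) / \<epsilon>)"
          using \<delta>(2)[of \<xi>] \<epsilon> by (intro mult_right_mono) auto
        then show ?thesis
          using True by (simp add: \<beta>')
      next
        case False
        then have "step' (2 - \<xi> / \<epsilon>) = 0"
          using \<epsilon> by (intro step'_eq_0) (auto simp: field_simps)
        then show ?thesis
          by (simp add: \<beta>')
      qed
    qed
    finally show "((g \<xi> - \<xi> * q \<xi>) * \<beta>' \<xi> - q \<xi> * \<beta> \<xi>) + e * (\<beta> \<xi> + \<xi> * \<beta>' \<xi>) \<le>
      - h * (indicator {\<epsilon>..2 * \<epsilon>} \<xi> * (step' (2 - \<xi> / \<epsilon>) / \<epsilon>))" .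
  qed
  also have "\<dots> = - h * (LINT \<xi>|lborel. (step' (2 - \<xi> / \<epsilon>) / \<epsilon>) * indicator {\<epsilon>..2 * \<epsilon>} \<xi>)"
    by (simp add: mult.commute)
  also have "(LINT \<xi>|lborel. (step' (2 - \<xi> / \<epsilon>) / \<epsilon>) * indicator {\<epsilon>..2 * \<epsilon>} \<xi>) =
      - step (2 - (2 * \<epsilon>) / \<epsilon>) - (- step (2 - \<epsilon> / \<epsilon>))"
  proof (rule integral_FTC_Icc_real)
    show "((\<lambda>\<xi>. - step (2 - \<xi> / \<epsilon>)) has_real_derivative step' (2 - x / \<epsilon>) / \<epsilon>) (at x)" for x
      using \<epsilon> by (auto intro!: derivative_eq_intros)
    show "isCont (\<lambda>\<xi>. step' (2 - \<xi> / \<epsilon>) / \<epsilon>) x" for x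
    proof -
      have "continuous_on UNIV (\<lambda>\<xi>. step' (2 - \<xi> / \<epsilon>) / \<epsilon>)"
        using \<epsilon> by (auto intro!: continuous_intros)
      then show ?thesis
        by (simp add: continuous_on_eq_continuous_at)
    qed
  qed (use \<epsilon> in auto)
  also have "\<dots> = 1"
    using \<epsilon> by simp
  finally show False
    using h by simp
qed

end

section \<open>The invariant region\<close>

lemma AE_right_interval_finite_allI:
  fixes P :: "'k \<Rightarrow> real \<Rightarrow> bool"
  assumes K: "finite K"
    and P: "\<And>k. k \<in> K \<Longrightarrow> \<exists>\<delta>>0. AE x in lborel. 0 < x \<and> x < \<delta> \<longrightarrow> P k x"
  shows "\<exists>\<delta>>0. AE x in lborel. 0 < x \<and> x < \<delta> \<longrightarrow> (\<forall>k\<in>K. P k x)"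
proof -
  have "\<forall>k\<in>K. \<exists>\<delta>>0. AE x in lborel. 0 < x \<and> x < \<delta> \<longrightarrow> P k x"
    using P by blast
  from bchoice[OF this]
  obtain \<delta> where \<delta>: "\<And>k. k \<in> K \<Longrightarrow> 0 < \<delta> k \<and> (AE x in lborel. 0 < x \<and> x < \<delta> k \<longrightarrow> P k x)"
    by blast
  define m where "m = Min (insert 1 (\<delta> ` K))"
  have "0 < m" and m: "\<And>k. k \<in> K \<Longrightarrow> m \<le> \<delta> k"
    using K \<delta> by (auto simp: m_def)
  have "AE x in lborel. \<forall>k\<in>K. 0 < x \<and> x < \<delta> k \<longrightarrow> P k x"
    using K \<delta> by (intro AE_finite_allI) auto
  then have "AE x in lborel. 0 < x \<and> x < m \<longrightarrow> (\<forall>k\<in>K. P k x)"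
    by eventually_elim (use m in fastforce)
  then show ?thesis
    using \<open>0 < m\<close> by blast
qed

lemma D_measurable [measurable]: "D \<in> sets borel"
proof -
  have "D = {V. 0 < fst V} \<union> {(0, 0)}"
    by (auto simp: D_def)
  moreover have "open {V :: state. 0 < fst V}"
    by (intro open_Collect_less continuous_intros)
  moreover have "closed {(0, 0) :: state}"
    by simp
  ultimately show ?thesis
    by (metis borel_open borel_closed sets.Un)
qed

lemma cylinder_borel: "X \<in> sets borel \<Longrightarrow> cylinder T X \<in> sets borel"
  unfolding borel_prod[symmetric] by (rule cylinder_measurable)

context isentropic_gas
begin

text \<open>The weighted sums over the pipelines of excess and excess flux play the roles of
  \<open>Q\<close> and \<open>G\<close> in \<open>entropy_vanishes\<close>. Stopping at \<tau> < T
  gives essential bounds on the states, and hence a finite propagation speed.\<close>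

lemma invariant_region_until:
  fixes A :: "nat \<Rightarrow> real" and U :: "nat \<Rightarrow> real \<Rightarrow> real \<Rightarrow> state"
  assumes A: "\<And>k. k \<in> {1..d} \<Longrightarrow> 0 < A k"
    and sol: "\<And>k. k \<in> {1..d} \<Longrightarrow> weak_entropy_solution \<kappa> \<gamma> T {0<..} (U k)"
    and init: "\<And>k R e. k \<in> {1..d} \<Longrightarrow> 0 < e \<Longrightarrow> \<exists>\<delta>>0. AE t in lborel. 0 < t \<and> t < \<delta> \<longrightarrow>
        (LINT x:{0<..<R}|lborel. excess \<omega> (U k t x)) \<le> e"
    and trace: "AE t in lborel. 0 < t \<and> ereal t < T \<longrightarrow>
        (\<exists>\<rho>s\<ge>0. \<exists>Ubar.
           (\<forall>k\<in>{1..d}. has_right_trace (U k t) (Ubar k) \<and> Ubar k \<in> V_set \<kappa> \<gamma> (\<rho>s, 0)) \<and>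
           (\<Sum>k=1..d. A k * fst (Ubar k) * snd (Ubar k)) = 0)"
    and \<tau>: "0 < \<tau>" "ereal \<tau> < T"
  shows "AE p in lborel. p \<in> cylinder (ereal \<tau>) {0<..} \<longrightarrow>
    (\<forall>k\<in>{1..d}. excess \<omega> (U k (fst p) (snd p)) = 0 \<and> U k (fst p) (snd p) \<in> D)"
proof -
  let ?cyl = "cylinder (ereal \<tau>) {0<..}"
  have weak: "weak_solution \<kappa> \<gamma> T {0<..} (U k)" if "k \<in> {1..d}" for k
    using sol[OF that] by (simp add: weak_entropy_solution_def)
  have sub: "?cyl \<subseteq> cylinder T {0<..}"
    by (auto simp: cylinder_def intro: less_trans[OF _ \<tau>(2)])

  have "\<exists>m. AE p in lborel. p \<in> ?cyl \<longrightarrow> norm (U k (fst p) (snd p)) \<le> m" if "k \<in> {1..d}" for k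
  proof -
    have "\<forall>\<tau>. ereal \<tau> < T \<longrightarrow> (\<exists>m. AE (t, x) in lborel. (t, x) \<in> cylinder (ereal \<tau>) {0<..} \<longrightarrow> norm (U k t x) \<le> m)"
      using weak[OF that] unfolding weak_solution_def by blast
    then show ?thesis
      using \<tau> by (simp add: case_prod_beta)
  qed
  then have "\<forall>k\<in>{1..d}. \<exists>m. AE p in lborel. p \<in> ?cyl \<longrightarrow> norm (U k (fst p) (snd p)) \<le> m"
    by blast
  from bchoice[OF this]
  obtain m where m: "\<And>k. k \<in> {1..d} \<Longrightarrow> AE p in lborel. p \<in> ?cyl \<longrightarrow> norm (U k (fst p) (snd p)) \<le> m k"
    by blast
  \<comment> \<open>One bound for all pipelines, so that a single cone can be used for their
    sum.\<close>
  define M0 where "M0 = (\<Sum>k=1..d. \<bar>m k\<bar>)"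
  have "0 \<le> M0"
    by (simp add: M0_def sum_nonneg)
  have M0: "AE p in lborel. p \<in> ?cyl \<longrightarrow> norm (U k (fst p) (snd p)) \<le> M0" if k: "k \<in> {1..d}" for k
  proof -
    have "\<bar>m k\<bar> \<le> M0"
      unfolding M0_def using k by (intro member_le_sum) auto
    then show ?thesis
      using m[OF k] by (auto elim!: eventually_mono)
  qed
  have inD: "AE p in lborel. p \<in> ?cyl \<longrightarrow> U k (fst p) (snd p) \<in> D" if k: "k \<in> {1..d}" for k
    using weak[OF k] sub unfolding weak_solution_def by (auto simp: case_prod_beta elim!: eventually_mono)

  \<comment> \<open>Measurability is known only after multiplication by the indicator of the
    cylinder. \<open>Y\<close> keeps a measurable copy of the solution there, and \<open>V\<close>
    below also repairs the exceptional points, so that state and bound hold everywhere.\<close>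
  define Y where "Y k p = indicator (cylinder T {0<..}) p *\<^sub>R U k (fst p) (snd p)" for k p
  have Y_meas: "Y k \<in> borel_measurable borel" if "k \<in> {1..d}" for k
    using weak[OF that] unfolding weak_solution_def set_borel_measurable_def
    by (simp add: Y_def[abs_def] case_prod_beta)
  define V where "V k p = (if p \<in> ?cyl \<and> Y k p \<in> D \<and> norm (Y k p) \<le> M0 then Y k p else (0, 0))" for k p
  have V_meas: "V k \<in> borel_measurable borel" if "k \<in> {1..d}" for k
  proof -
    have [measurable]: "Y k \<in> borel_measurable borel"
      by (rule Y_meas[OF that])
    have [measurable]: "?cyl \<in> sets borel"
      by (intro cylinder_borel) simp
    show ?thesis
      unfolding V_def[abs_def] by measurable
  qed
  have VD: "V k p \<in> D" and V_norm: "norm (V k p) \<le> M0" for k p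
    using \<open>0 \<le> M0\<close> by (auto simp: V_def)
  have V0: "0 \<le> fst (V k p)" for k p
    using VD D_nonneg by blast
  have V_eq: "AE p in lborel. p \<in> ?cyl \<longrightarrow> V k p = U k (fst p) (snd p) \<and> V k p \<in> D" if k: "k \<in> {1..d}" for k
    using M0[OF k] inD[OF k]
  proof eventually_elim
    case (elim p)
    then show ?case
      using sub by (auto simp: V_def Y_def indicator_def)
  qed
  have V_eq': "AE t in lborel. AE x in lborel. (t, x) \<in> ?cyl \<longrightarrow> V k (t, x) = U k t x" if k: "k \<in> {1..d}" for k
    using lborel_pair.AE_pair[unfolded lborel_prod, OF V_eq[OF k]]
    by (auto elim!: eventually_mono)
  have V_eq_all: "AE t in lborel. \<forall>k\<in>{1..d}. AE x in lborel. (t, x) \<in> ?cyl \<longrightarrow> V k (t, x) = U k t x"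
    using V_eq' by (intro AE_finite_allI) auto

  obtain C where C: "\<And>V. V \<in> D \<Longrightarrow> norm V \<le> M0 \<Longrightarrow> \<bar>excess \<omega> V - 0 * fst V\<bar> \<le> C \<and> \<bar>excess_flux \<omega> V - 0 * (fst V * snd V)\<bar> \<le> C"
    using bounded_on_states by blast
  have HC: "0 \<le> excess \<omega> (V k p)" "\<bar>excess \<omega> (V k p)\<bar> \<le> C" "\<bar>excess_flux \<omega> (V k p)\<bar> \<le> C" for k p
    using C[OF VD V_norm, of k p] excess_nonneg[OF V0] by auto
  \<comment> \<open>A bound for \<bar>u\<bar> + a \<rho>^\<theta> over all states of norm at most
    \<open>M0\<close>.\<close>
  define M where "M = M0 + a * M0 powr \<theta>"
  have M: "0 \<le> M"
    using \<open>0 \<le> M0\<close> a_pos by (simp add: M_def)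
  have FM: "\<bar>excess_flux \<omega> (V k p)\<bar> \<le> M * excess \<omega> (V k p)" for k p
  proof -
    have le: "fst (V k p) \<le> M0" "\<bar>snd (V k p)\<bar> \<le> M0"
      using V_norm[of k p] norm_fst_le[of "fst (V k p)" "snd (V k p)"] norm_snd_le[of "snd (V k p)" "fst (V k p)"]
      by auto
    then have "rad (V k p) \<le> a * M0 powr \<theta>"
      unfolding rad_def using V0 a_pos theta by (intro mult_left_mono powr_mono2) auto
    then have "(\<bar>snd (V k p)\<bar> + rad (V k p)) * excess \<omega> (V k p) \<le> M * excess \<omega> (V k p)"
      using le HC(1) by (intro mult_right_mono) (auto simp: M_def)
    then show ?thesis
      using excess_flux_abs_le[OF V0] order_trans by blast
  qed
  have HV_meas: "(\<lambda>p. excess \<omega> (V k p)) \<in> borel_measurable borel" "(\<lambda>p. excess_flux \<omega> (V k p)) \<in> borel_measurable borel"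
    if "k \<in> {1..d}" for k
    by (rule measurable_compose[OF V_meas[OF that] excess_measurable] measurable_compose[OF V_meas[OF that] excess_flux_measurable])+

  define Q where "Q p = (\<Sum>k=1..d. A k * excess \<omega> (V k p))" for p
  define G where "G p = (\<Sum>k=1..d. A k * excess_flux \<omega> (V k p))" for p
  define SA where "SA = (\<Sum>k=1..d. A k)"
  have SA: "0 \<le> SA"
    unfolding SA_def using A by (intro sum_nonneg) (simp add: less_imp_le)

  have "AE (t, x) in lborel. 0 < t \<and> t < \<tau> \<and> 0 < x \<longrightarrow> Q (t, x) = 0"
  proof (rule entropy_vanishes[OF M])
    show "Q \<in> borel_measurable borel" "G \<in> borel_measurable borel"
      unfolding Q_def[abs_def] G_def[abs_def] using HV_meas by simp_all
    show "0 \<le> Q p" for p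
      unfolding Q_def using A HC by (intro sum_nonneg) (simp add: less_imp_le)
    show "Q p \<le> SA * C" for p
      unfolding Q_def SA_def sum_distrib_right using A HC(2) by (intro sum_mono mult_left_mono) (auto simp: abs_le_iff less_imp_le)
    show "\<bar>G p\<bar> \<le> M * Q p" for p
    proof -
      have "\<bar>G p\<bar> \<le> (\<Sum>k=1..d. \<bar>A k * excess_flux \<omega> (V k p)\<bar>)"
        unfolding G_def by (rule sum_abs)
      also have "\<dots> \<le> (\<Sum>k=1..d. A k * (M * excess \<omega> (V k p)))"
        using A FM by (intro sum_mono) (auto simp: abs_mult less_imp_le intro!: mult_mono)
      finally show ?thesis
        by (simp add: Q_def sum_distrib_left mult_ac)
    qed
  next
    fix \<phi> \<phi>t \<phi>x :: "real \<times> real \<Rightarrow> real"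
    assume test: "test_function ?cyl \<phi> \<phi>t \<phi>x" and \<phi>: "\<And>p. 0 \<le> \<phi> p"
    \<comment> \<open>The support itself is used as domain, so the derivatives vanish off a compact
      set.\<close>
    obtain K where K: "compact K" "test_function K \<phi> \<phi>t \<phi>x"
      using test unfolding test_function_def by blast
    have cont: "continuous_on UNIV \<phi>t" "continuous_on UNIV \<phi>x"
      using test by (simp_all add: test_function_def)
    note \<phi>0 = test_function_derivative_eq_0[OF K(2)]
    have [measurable]: "\<phi>t \<in> borel_measurable borel" "\<phi>x \<in> borel_measurable borel"
      using cont by (auto intro: borel_measurable_continuous_onI)
    have int: "integrable lborel (\<lambda>p. excess \<omega> (V k p) * \<phi>t p)" "integrable lborel (\<lambda>p. excess_flux \<omega> (V k p) * \<phi>x p)"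
      if "k \<in> {1..d}" for k
      using integrable_mult_compact_support[OF cont(1) K(1) \<phi>0(1) HV_meas(1)[OF that], of C]
        integrable_mult_compact_support[OF cont(2) K(1) \<phi>0(2) HV_meas(2)[OF that], of C] HC
      by simp_all
    have "0 \<le> (LINT p|lborel. excess \<omega> (V k p) * \<phi>t p + excess_flux \<omega> (V k p) * \<phi>x p)" if k: "k \<in> {1..d}" for k
    proof -
      have [measurable]: "Y k \<in> borel_measurable borel"
        by (rule Y_meas[OF k])
      have [measurable]: "cylinder T {0<..} \<in> sets borel"
        by (intro cylinder_borel) simp
      have "0 \<le> (LINT (t, x):cylinder T {0<..}|lborel.
          eta \<kappa> \<gamma> (cutoff \<omega> 0) (U k t x) * \<phi>t (t, x) + entropy_flux \<kappa> \<gamma> (cutoff \<omega> 0) (U k t x) * \<phi>x (t, x))"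
        using sol[OF k] test_function_mono[OF test sub] \<phi> cutoff_convex unfolding weak_entropy_solution_def by blast
      also have "\<dots> = (LINT p|lborel. indicator (cylinder T {0<..}) p *
          (eta \<kappa> \<gamma> (cutoff \<omega> 0) (Y k p) * \<phi>t p + entropy_flux \<kappa> \<gamma> (cutoff \<omega> 0) (Y k p) * \<phi>x p))"
        unfolding set_lebesgue_integral_def
        by (intro Bochner_Integration.integral_cong refl) (auto simp: Y_def indicator_def)
      also have "\<dots> = (LINT p|lborel. excess \<omega> (V k p) * \<phi>t p + excess_flux \<omega> (V k p) * \<phi>x p)"
      proof (rule integral_cong_AE)
        have [measurable]: "(\<lambda>p. eta \<kappa> \<gamma> (cutoff \<omega> 0) (Y k p)) \<in> borel_measurable borel"
          "(\<lambda>p. entropy_flux \<kappa> \<gamma> (cutoff \<omega> 0) (Y k p)) \<in> borel_measurable borel"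
          by (rule measurable_compose[OF Y_meas[OF k] eta_measurable] measurable_compose[OF Y_meas[OF k] entropy_flux_measurable];
              measurable)+
        show "(\<lambda>p. indicator (cylinder T {0<..}) p *
            (eta \<kappa> \<gamma> (cutoff \<omega> 0) (Y k p) * \<phi>t p + entropy_flux \<kappa> \<gamma> (cutoff \<omega> 0) (Y k p) * \<phi>x p)) \<in> borel_measurable lborel"
          by measurable
        show "(\<lambda>p. excess \<omega> (V k p) * \<phi>t p + excess_flux \<omega> (V k p) * \<phi>x p) \<in> borel_measurable lborel"
          using HV_meas[OF k] by simp
        show "AE p in lborel. indicator (cylinder T {0<..}) p *
            (eta \<kappa> \<gamma> (cutoff \<omega> 0) (Y k p) * \<phi>t p + entropy_flux \<kappa> \<gamma> (cutoff \<omega> 0) (Y k p) * \<phi>x p) =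
            excess \<omega> (V k p) * \<phi>t p + excess_flux \<omega> (V k p) * \<phi>x p"
          using V_eq[OF k]
        proof eventually_elim
          case (elim p)
          show ?case
          proof (cases "p \<in> ?cyl")
            case True
            then have "Y k p = V k p"
              using elim sub by (auto simp: Y_def)
            then show ?thesis
              using True sub V0[of k p] by (auto simp: eta_cutoff entropy_flux_cutoff)
          next
            case False
            then show ?thesis
              using test_function_derivative_eq_0[OF test] by simp
          qed
        qed
      qed
      finally show ?thesis .
    qed
    then have "0 \<le> (\<Sum>k=1..d. A k * (LINT p|lborel. excess \<omega> (V k p) * \<phi>t p + excess_flux \<omega> (V k p) * \<phi>x p))"
      using A by (intro sum_nonneg mult_nonneg_nonneg) (auto simp: less_imp_le)
    also have "\<dots> = (LINT p|lborel. (\<Sum>k=1..d. A k * (excess \<omega> (V k p) * \<phi>t p + excess_flux \<omega> (V k p) * \<phi>x p)))"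
      using int by simp
    also have "\<dots> = (LINT p|lborel. Q p * \<phi>t p + G p * \<phi>x p)"
      by (simp add: Q_def G_def sum_distrib_right sum.distrib distrib_left mult.assoc)
    finally show "0 \<le> (LINT p|lborel. Q p * \<phi>t p + G p * \<phi>x p)" .
  next
    fix R e :: real
    assume e: "0 < e"
    \<comment> \<open>The summand 1 keeps the denominator positive even if the sum of areas is 0, as
      for d = 0.\<close>
    define e' where "e' = e / (SA + 1)"
    have e': "0 < e'" "SA * e' \<le> e"
      using e SA by (auto simp: e'_def field_simps)
    obtain \<delta> where \<delta>: "0 < \<delta>" "AE t in lborel. 0 < t \<and> t < \<delta> \<longrightarrow>
        (\<forall>k\<in>{1..d}. (LINT x:{0<..<R}|lborel. excess \<omega> (U k t x)) \<le> e')"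
      using AE_right_interval_finite_allI[of "{1..d}"
          "\<lambda>k t. (LINT x:{0<..<R}|lborel. excess \<omega> (U k t x)) \<le> e'"] init[OF _ e'(1), of _ R] by auto
    show "\<exists>\<delta>>0. AE t in lborel. 0 < t \<and> t < \<delta> \<longrightarrow> (LINT x:{0<..<R}|lborel. Q (t, x)) \<le> e"
    proof (intro exI[of _ "min \<delta> \<tau>"] conjI)
      show "0 < min \<delta> \<tau>"
        using \<delta> \<tau> by simp
      show "AE t in lborel. 0 < t \<and> t < min \<delta> \<tau> \<longrightarrow> (LINT x:{0<..<R}|lborel. Q (t, x)) \<le> e"
        using \<delta>(2) V_eq_all
      proof eventually_elim
        case (elim t)
        show ?case
        proof
          assume t: "0 < t \<and> t < min \<delta> \<tau>"
          have excess_sec: "(\<lambda>x. excess \<omega> (V k (t, x))) \<in> borel_measurable borel" if k: "k \<in> {1..d}" for k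
          proof -
            have "(\<lambda>p. excess \<omega> (V k p)) \<in> borel_measurable (borel \<Otimes>\<^sub>M borel)"
              using HV_meas(1)[OF k] by (simp add: borel_prod)
            from measurable_compose[OF measurable_Pair1' this, of t] show ?thesis
              by simp
          qed
          have Y_sec: "(\<lambda>x. excess \<omega> (Y k (t, x))) \<in> borel_measurable borel" if k: "k \<in> {1..d}" for k
          proof -
            have "(\<lambda>p. excess \<omega> (Y k p)) \<in> borel_measurable (borel \<Otimes>\<^sub>M borel)"
              using measurable_compose[OF Y_meas[OF k] excess_measurable] by (simp add: borel_prod)
            from measurable_compose[OF measurable_Pair1' this, of t] show ?thesis
              by simp
          qed
          have int: "set_integrable lborel {0<..<R} (\<lambda>x. excess \<omega> (V k (t, x)))" if k: "k \<in> {1..d}" for k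
            unfolding set_integrable_def
            by (rule integrableI_bounded_set_indicator[where B = C])
               (use excess_sec[OF k] HC emeasure_bounded_finite[of "{0<..<R}"] in auto)
          have eq: "(LINT x:{0<..<R}|lborel. excess \<omega> (V k (t, x))) = (LINT x:{0<..<R}|lborel. excess \<omega> (U k t x))"
            if k: "k \<in> {1..d}" for k
          proof -
            have in_cyl: "(t, x) \<in> ?cyl" if "0 < x" for x
              using t that by (auto simp: cylinder_def)
            have "(LINT x:{0<..<R}|lborel. excess \<omega> (V k (t, x))) = (LINT x:{0<..<R}|lborel. excess \<omega> (Y k (t, x)))"
              unfolding set_lebesgue_integral_def
            proof (rule integral_cong_AE)
              show "AE x in lborel. indicator {0<..<R} x *\<^sub>R excess \<omega> (V k (t, x)) = indicator {0<..<R} x *\<^sub>R excess \<omega> (Y k (t, x))"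
                using elim(2)[rule_format, OF k]
              proof eventually_elim
                case (elim x)
                then show ?case
                  using in_cyl[of x] sub by (auto simp: indicator_def Y_def)
              qed
            qed (use excess_sec[OF k] Y_sec[OF k] in auto)
            also have "\<dots> = (LINT x:{0<..<R}|lborel. excess \<omega> (U k t x))"
              unfolding set_lebesgue_integral_def
              using in_cyl sub by (intro Bochner_Integration.integral_cong refl) (auto simp: indicator_def Y_def)
            finally show ?thesis .
          qed
          have "(LINT x:{0<..<R}|lborel. Q (t, x)) = (\<Sum>k=1..d. A k * (LINT x:{0<..<R}|lborel. excess \<omega> (V k (t, x))))"
            using int unfolding Q_def set_lebesgue_integral_def set_integrable_def
            by (simp add: sum_distrib_left mult.left_commute)
          also have "\<dots> \<le> (\<Sum>k=1..d. A k * e')"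
            using elim(1) t A eq by (intro sum_mono mult_left_mono) (auto simp: less_imp_le)
          also have "\<dots> \<le> e"
            using e'(2) by (simp add: SA_def sum_distrib_right)
          finally show "(LINT x:{0<..<R}|lborel. Q (t, x)) \<le> e" .
        qed
      qed
    qed
  next
    show "AE t in lborel. 0 < t \<and> t < \<tau> \<longrightarrow>
        (\<forall>e>0. \<exists>\<delta>>0. AE x in lborel. 0 < x \<and> x < \<delta> \<longrightarrow> G (t, x) \<le> e)"
      using trace V_eq_all
    proof eventually_elim
      case (elim t)
      show ?case
      proof (intro impI allI)
        fix e :: real
        assume t: "0 < t \<and> t < \<tau>" and e: "0 < e"
        then have "ereal t < T"
          using less_trans[OF _ \<tau>(2), of "ereal t"] by simp
        then obtain \<rho>s Ubar where \<rho>s: "0 \<le> \<rho>s"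
          and Ubar: "\<And>k. k \<in> {1..d} \<Longrightarrow> has_right_trace (U k t) (Ubar k) \<and> Ubar k \<in> V_set \<kappa> \<gamma> (\<rho>s, 0)"
          and sum: "(\<Sum>k=1..d. A k * fst (Ubar k) * snd (Ubar k)) = 0"
          using elim(1) t by blast
        obtain c where c: "\<And>V. 0 \<le> fst V \<Longrightarrow> excess \<omega> (\<rho>s, 0) + c * (fst V - \<rho>s) \<le> excess \<omega> V"
          using excess_subgradient[OF \<rho>s] by blast
        define e' where "e' = e / (SA + 1)"
        have e': "0 < e'" "SA * e' \<le> e"
          using e SA by (auto simp: e'_def field_simps)
        have "\<exists>\<delta>>0. AE x in lborel. 0 < x \<and> x < \<delta> \<longrightarrow> excess_flux \<omega> (V k (t, x)) \<le> excess_flux \<omega> (Ubar k) + e'" if k: "k \<in> {1..d}" for k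
        proof -
          have "Ubar k \<in> D"
            using Ubar[OF k] by (simp add: V_set_def)
          then obtain \<eta> where \<eta>: "0 < \<eta>" "\<And>V. V \<in> D \<Longrightarrow> dist V (Ubar k) < \<eta> \<Longrightarrow> dist (excess_flux \<omega> V) (excess_flux \<omega> (Ubar k)) < e'"
            using excess_flux_continuous[of \<omega>] e'(1) unfolding continuous_on_iff by blast
          obtain \<delta> where \<delta>: "0 < \<delta>" "AE x in lborel. 0 < x \<and> x < \<delta> \<longrightarrow> dist (U k t x) (Ubar k) < \<eta>"
            using Ubar[OF k] \<eta>(1) by (auto simp: has_right_trace_def)
          have "AE x in lborel. 0 < x \<and> x < \<delta> \<longrightarrow> excess_flux \<omega> (V k (t, x)) \<le> excess_flux \<omega> (Ubar k) + e'"
            using \<delta>(2) elim(2)[rule_format, OF k]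
          proof eventually_elim
            case (elim x)
            show ?case
            proof
              assume x: "0 < x \<and> x < \<delta>"
              then have "V k (t, x) = U k t x"
                using elim t by (auto simp: cylinder_def)
              then have "dist (excess_flux \<omega> (V k (t, x))) (excess_flux \<omega> (Ubar k)) < e'"
                using elim x VD[of k "(t, x)"] by (intro \<eta>(2)) auto
              then show "excess_flux \<omega> (V k (t, x)) \<le> excess_flux \<omega> (Ubar k) + e'"
                by (simp add: dist_real_def abs_less_iff)
            qed
          qed
          then show ?thesis
            using \<delta>(1) by blast
        qed
        then obtain \<delta> where \<delta>: "0 < \<delta>" "AE x in lborel. 0 < x \<and> x < \<delta> \<longrightarrow> (\<forall>k\<in>{1..d}. excess_flux \<omega> (V k (t, x)) \<le> excess_flux \<omega> (Ubar k) + e')"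
          using AE_right_interval_finite_allI[of "{1..d}" "\<lambda>k x. excess_flux \<omega> (V k (t, x)) \<le> excess_flux \<omega> (Ubar k) + e'"] by auto
        \<comment> \<open>All pipelines share \<rho>s and hence c, so the terms c \<rho> u sum to c
          times the vanishing total mass flux. Only the approximation error remains.\<close>
        have total: "(\<Sum>k=1..d. A k * (excess_flux \<omega> (Ubar k) + e')) \<le> e"
        proof -
          have "(\<Sum>k=1..d. A k * (excess_flux \<omega> (Ubar k) + e')) \<le> (\<Sum>k=1..d. A k * (c * (fst (Ubar k) * snd (Ubar k)) + e'))"
            using A Ubar trace_entropy_flux_le[OF _ \<rho>s c] by (intro sum_mono mult_left_mono) (auto simp: less_imp_le)
          also have "\<dots> = c * (\<Sum>k=1..d. A k * fst (Ubar k) * snd (Ubar k)) + SA * e'"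
            by (simp add: SA_def sum_distrib_left sum_distrib_right sum.distrib algebra_simps)
          finally show ?thesis
            using e'(2) sum by simp
        qed
        have "AE x in lborel. 0 < x \<and> x < \<delta> \<longrightarrow> G (t, x) \<le> e"
          using \<delta>(2)
        proof eventually_elim
          case (elim x)
          show ?case
          proof
            assume "0 < x \<and> x < \<delta>"
            then have "G (t, x) \<le> (\<Sum>k=1..d. A k * (excess_flux \<omega> (Ubar k) + e'))"
              unfolding G_def using elim A by (intro sum_mono mult_left_mono) (auto simp: less_imp_le)
            then show "G (t, x) \<le> e"
              using total by linarith
          qed
        qed
        then show "\<exists>\<delta>>0. AE x in lborel. 0 < x \<and> x < \<delta> \<longrightarrow> G (t, x) \<le> e"
          using \<delta>(1) by blast
      qed
    qed
  qed
  moreover have "AE p in lborel. \<forall>k\<in>{1..d}. p \<in> ?cyl \<longrightarrow> V k p = U k (fst p) (snd p) \<and> V k p \<in> D"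
    using V_eq by (intro AE_finite_allI) auto
  ultimately show ?thesis
  proof eventually_elim
    case (elim p)
    show ?case
    proof (intro impI ballI)
      fix k assume p: "p \<in> ?cyl" and k: "k \<in> {1..d}"
      then have "Q p = 0"
        using elim(1) by (auto simp: cylinder_def case_prod_beta)
      then have "A k * excess \<omega> (V k p) = 0"
        unfolding Q_def using A HC(1) k by (subst (asm) sum_nonneg_eq_0_iff) (auto simp: less_imp_le)
      then show "excess \<omega> (U k (fst p) (snd p)) = 0 \<and> U k (fst p) (snd p) \<in> D"
        using elim(2)[rule_format, OF k p] A[OF k] by auto
    qed
  qed
qed

text \<open>Rational end times below T form a countable exhaustion, which also covers an infinite T.
  Zero excess is then translated back into the bounds on the invariants.\<close>

lemma invariant_region:
  fixes A :: "nat \<Rightarrow> real" and U :: "nat \<Rightarrow> real \<Rightarrow> real \<Rightarrow> state"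
  assumes A: "\<And>k. k \<in> {1..d} \<Longrightarrow> 0 < A k" and \<omega>: "0 \<le> \<omega>"
    and sol: "\<And>k. k \<in> {1..d} \<Longrightarrow> weak_entropy_solution \<kappa> \<gamma> T {0<..} (U k)"
    and init: "\<And>k R e. k \<in> {1..d} \<Longrightarrow> 0 < e \<Longrightarrow> \<exists>\<delta>>0. AE t in lborel. 0 < t \<and> t < \<delta> \<longrightarrow>
        (LINT x:{0<..<R}|lborel. excess \<omega> (U k t x)) \<le> e"
    and trace: "AE t in lborel. 0 < t \<and> ereal t < T \<longrightarrow>
        (\<exists>\<rho>s\<ge>0. \<exists>Ubar.
           (\<forall>k\<in>{1..d}. has_right_trace (U k t) (Ubar k) \<and> Ubar k \<in> V_set \<kappa> \<gamma> (\<rho>s, 0)) \<and>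
           (\<Sum>k=1..d. A k * fst (Ubar k) * snd (Ubar k)) = 0)"
    and k: "k \<in> {1..d}"
  shows "AE (t, x) in lborel. 0 < t \<and> ereal t < T \<and> 0 < x \<longrightarrow>
           - \<omega> \<le> omega1 \<kappa> \<gamma> (U k t x) \<and>
           (U k t x \<noteq> (0, 0) \<longrightarrow> omega1 \<kappa> \<gamma> (U k t x) < omega2 \<kappa> \<gamma> (U k t x)) \<and>
           omega2 \<kappa> \<gamma> (U k t x) \<le> \<omega>"
proof -
  have "AE p in lborel. \<forall>r :: rat. 0 < real_of_rat r \<and> ereal (real_of_rat r) < T \<longrightarrow>
      p \<in> cylinder (ereal (real_of_rat r)) {0<..} \<longrightarrow>
      (\<forall>k\<in>{1..d}. excess \<omega> (U k (fst p) (snd p)) = 0 \<and> U k (fst p) (snd p) \<in> D)"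
    unfolding AE_all_countable
  proof
    fix r :: rat
    show "AE p in lborel. 0 < real_of_rat r \<and> ereal (real_of_rat r) < T \<longrightarrow>
        p \<in> cylinder (ereal (real_of_rat r)) {0<..} \<longrightarrow>
        (\<forall>k\<in>{1..d}. excess \<omega> (U k (fst p) (snd p)) = 0 \<and> U k (fst p) (snd p) \<in> D)"
    proof (cases "0 < real_of_rat r \<and> ereal (real_of_rat r) < T")
      case True
      then have "AE p in lborel. p \<in> cylinder (ereal (real_of_rat r)) {0<..} \<longrightarrow>
          (\<forall>k\<in>{1..d}. excess \<omega> (U k (fst p) (snd p)) = 0 \<and> U k (fst p) (snd p) \<in> D)"
        by (intro invariant_region_until[OF A sol init trace]) auto
      then show ?thesis
        by (auto elim!: eventually_mono)
    qed auto
  qed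
  then show ?thesis
  proof eventually_elim
    case (elim p)
    obtain t x where p: "p = (t, x)"
      by (cases p)
    have "- \<omega> \<le> omega1 \<kappa> \<gamma> (U k t x) \<and>
           (U k t x \<noteq> (0, 0) \<longrightarrow> omega1 \<kappa> \<gamma> (U k t x) < omega2 \<kappa> \<gamma> (U k t x)) \<and>
           omega2 \<kappa> \<gamma> (U k t x) \<le> \<omega>" if tx: "0 < t" "ereal t < T" "0 < x"
    proof -
      obtain s :: ereal where "ereal t < s" "s < T"
        using dense[OF tx(2)] by blast
      then obtain s' :: real where s': "t < s'" "ereal s' < T"
        by (cases s) auto
      then obtain r where r: "t < real_of_rat r" "real_of_rat r < s'"
        using of_rat_dense by blast
      have "ereal (real_of_rat r) < T"
        using less_trans[of "ereal (real_of_rat r)" "ereal s'" T] r s' by simp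
      then have HD: "excess \<omega> (U k t x) = 0" "U k t x \<in> D"
        using elim[rule_format, of r k] r tx k order.strict_trans[OF tx(1) r(1)] by (auto simp: p cylinder_def)
      show ?thesis
      proof (cases "U k t x = (0, 0)")
        \<comment> \<open>In the vacuum both invariants are 0, and the bounds reduce to 0 \<le>
          \<omega>.\<close>
        case True
        then show ?thesis
          using \<omega> by simp
      next
        case False
        then have "0 < fst (U k t x)"
          using HD D_cases by blast
        then show ?thesis
          using excess_eq_0_imp[OF _ HD(1)] rad_pos by (auto simp: omega_eq)
      qed
    qed
    then show ?case
      by (simp add: p)
  qed
qed

end

section \<open>Initial entropy and the two junction problems\<close>

text \<open>A test function on the smaller cylinder is one on the larger, and its derivatives vanish
  on the difference. This passes from Riemann solutions on the whole line to a pipeline.\<close>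

lemma weak_entropy_solution_restrict:
  assumes U': "weak_entropy_solution \<kappa> \<gamma> T X' U'"
    and X: "X \<subseteq> X'" "X \<in> sets borel"
    and eq: "\<And>t x. (t, x) \<in> cylinder T X \<Longrightarrow> U t x = U' t x"
  shows "weak_entropy_solution \<kappa> \<gamma> T X U"
proof -
  have sub: "cylinder \<tau> X \<subseteq> cylinder \<tau> X'" for \<tau>
    using X by (auto simp: cylinder_def)
  have in_cyl: "(t, x) \<in> cylinder T X" if "(t, x) \<in> cylinder (ereal \<tau>) X" "ereal \<tau> < T" for t x \<tau>
    using that by (auto simp: cylinder_def intro: less_trans[of "ereal t" "ereal \<tau>" T])
  have set_integral_eq: "(LINT p:cylinder T X|lborel. f p) = (LINT p:cylinder T X'|lborel. f' p)"
    if test: "test_function (cylinder T X) \<phi> \<phi>t \<phi>x"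
      and "\<And>p. p \<in> cylinder T X \<Longrightarrow> f p = f' p" "\<And>p. \<phi>t p = 0 \<Longrightarrow> \<phi>x p = 0 \<Longrightarrow> f' p = 0"
    for f f' :: "real \<times> real \<Rightarrow> 'b::{banach, second_countable_topology}" and \<phi> \<phi>t \<phi>x
    unfolding set_lebesgue_integral_def
    using that(2,3) test_function_derivative_eq_0[OF test] sub[of T]
    by (intro Bochner_Integration.integral_cong refl) (auto simp: indicator_def)
  have weak': "weak_solution \<kappa> \<gamma> T X' U'"
    using U' by (simp add: weak_entropy_solution_def)
  have "weak_solution \<kappa> \<gamma> T X U"
    unfolding weak_solution_def
  proof (intro conjI allI impI)
    have "(\<lambda>p. indicator (cylinder T X') p *\<^sub>R U' (fst p) (snd p)) \<in> borel_measurable borel"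
      using weak' by (simp add: weak_solution_def set_borel_measurable_def case_prod_beta)
    moreover have "cylinder T X \<in> sets borel"
      using X by (intro cylinder_borel)
    ultimately have "(\<lambda>p. indicator (cylinder T X) p *\<^sub>R (indicator (cylinder T X') p *\<^sub>R U' (fst p) (snd p))) \<in> borel_measurable borel"
      by measurable
    also have "(\<lambda>p. indicator (cylinder T X) p *\<^sub>R (indicator (cylinder T X') p *\<^sub>R U' (fst p) (snd p))) =
        (\<lambda>p. indicator (cylinder T X) p *\<^sub>R U (fst p) (snd p))"
      using eq sub by (auto simp: indicator_def fun_eq_iff)
    finally show "set_borel_measurable lborel (cylinder T X) (\<lambda>(t, x). U t x)"
      by (simp add: set_borel_measurable_def case_prod_beta)
  next
    have "AE (t, x) in lborel. (t, x) \<in> cylinder T X' \<longrightarrow> U' t x \<in> D"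
      using weak' by (simp add: weak_solution_def)
    then show "AE (t, x) in lborel. (t, x) \<in> cylinder T X \<longrightarrow> U t x \<in> D"
      by eventually_elim (use sub eq in auto)
  next
    fix \<tau> :: real
    assume \<tau>: "ereal \<tau> < T"
    have "\<forall>\<tau>. ereal \<tau> < T \<longrightarrow> (\<exists>M. AE (t, x) in lborel. (t, x) \<in> cylinder (ereal \<tau>) X' \<longrightarrow> norm (U' t x) \<le> M)"
      using weak' unfolding weak_solution_def by blast
    then obtain M where "AE (t, x) in lborel. (t, x) \<in> cylinder (ereal \<tau>) X' \<longrightarrow> norm (U' t x) \<le> M"
      using \<tau> by blast
    then have "AE (t, x) in lborel. (t, x) \<in> cylinder (ereal \<tau>) X \<longrightarrow> norm (U t x) \<le> M"
      by eventually_elim (use sub eq in_cyl[OF _ \<tau>] in fastforce)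
    then show "\<exists>M. AE (t, x) in lborel. (t, x) \<in> cylinder (ereal \<tau>) X \<longrightarrow> norm (U t x) \<le> M"
      by blast
  next
    fix \<phi> \<phi>t \<phi>x
    assume test: "test_function (cylinder T X) \<phi> \<phi>t \<phi>x"
    have "(LINT (t, x):cylinder T X|lborel. \<phi>t (t, x) *\<^sub>R conserved (U t x) + \<phi>x (t, x) *\<^sub>R flux \<kappa> \<gamma> (U t x)) =
        (LINT (t, x):cylinder T X'|lborel. \<phi>t (t, x) *\<^sub>R conserved (U' t x) + \<phi>x (t, x) *\<^sub>R flux \<kappa> \<gamma> (U' t x))"
      by (rule set_integral_eq[OF test]) (auto simp: eq)
    also have "\<dots> = 0"
      using weak' test_function_mono[OF test sub] unfolding weak_solution_def by blast
    finally show "(LINT (t, x):cylinder T X|lborel. \<phi>t (t, x) *\<^sub>R conserved (U t x) + \<phi>x (t, x) *\<^sub>R flux \<kappa> \<gamma> (U t x)) = 0" .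
  qed
  moreover have "0 \<le> (LINT (t, x):cylinder T X|lborel.
      eta \<kappa> \<gamma> S (U t x) * \<phi>t (t, x) + entropy_flux \<kappa> \<gamma> S (U t x) * \<phi>x (t, x))"
    if S: "convex_on UNIV S" and test: "test_function (cylinder T X) \<phi> \<phi>t \<phi>x" and \<phi>: "\<forall>p. 0 \<le> \<phi> p" for S \<phi> \<phi>t \<phi>x
  proof -
    have "0 \<le> (LINT (t, x):cylinder T X'|lborel.
        eta \<kappa> \<gamma> S (U' t x) * \<phi>t (t, x) + entropy_flux \<kappa> \<gamma> S (U' t x) * \<phi>x (t, x))"
      using U' S \<phi> test_function_mono[OF test sub] unfolding weak_entropy_solution_def by blast
    also have "\<dots> = (LINT (t, x):cylinder T X|lborel.
        eta \<kappa> \<gamma> S (U t x) * \<phi>t (t, x) + entropy_flux \<kappa> \<gamma> S (U t x) * \<phi>x (t, x))"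
      by (rule set_integral_eq[OF test, symmetric]) (auto simp: eq)
    finally show ?thesis .
  qed
  ultimately show ?thesis
    unfolding weak_entropy_solution_def by blast
qed

context isentropic_gas
begin

text \<open>The characteristic speed equals \<xi>, which tends to 0; at zero density it is the
  velocity. The parameter \<open>s\<close> covers both families with the values -1 and 1.\<close>

lemma char_limit_vacuum:
  assumes lim: "(W \<longlongrightarrow> V) (at_right 0)" and D: "\<And>\<xi>. W \<xi> \<in> D" and V: "fst V = 0"
    and char: "\<forall>\<^sub>F \<xi> in at_right 0. snd (W \<xi>) + s * sqrt (\<gamma> * \<kappa>) * fst (W \<xi>) powr \<theta> = \<xi>"
  shows "V = (0, 0)"
proof -
  have powr: "((\<lambda>\<xi>. fst (W \<xi>) powr \<theta>) \<longlongrightarrow> fst V powr \<theta>) (at_right 0)"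
    using lim theta by (intro tendsto_powr' tendsto_intros) (auto simp: D_nonneg[OF D])
  have "((\<lambda>\<xi>. snd (W \<xi>) + s * sqrt (\<gamma> * \<kappa>) * fst (W \<xi>) powr \<theta>) \<longlongrightarrow> snd V + s * sqrt (\<gamma> * \<kappa>) * fst V powr \<theta>) (at_right 0)"
    by (intro tendsto_add tendsto_mult tendsto_const tendsto_snd lim powr)
  then have "((\<lambda>\<xi>. \<xi>) \<longlongrightarrow> snd V + s * sqrt (\<gamma> * \<kappa>) * fst V powr \<theta>) (at_right 0)"
    using char by (rule Lim_transform_eventually)
  from tendsto_unique[OF _ this tendsto_ident_at] have "snd V = 0"
    using V by simp
  then show ?thesis
    using V by (simp add: prod_eq_iff)
qed

text \<open>\<open>D\<close> is not closed, but a Lax fan approaches the vacuum only along a rarefaction wave, where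
  the velocity tends to the characteristic speed \<open>\<xi>\<close>.\<close>

lemma lax_fan_limit_in_D:
  assumes fan: "lax_fan \<kappa> \<gamma> Ul Ur W" and lim: "(W \<longlongrightarrow> V) (at_right 0)"
  shows "V \<in> D"
proof -
  have WD: "W \<xi> \<in> D" for \<xi>
    using fan by (simp add: lax_fan_def)
  have const: "V \<in> D" if ev: "\<forall>\<^sub>F \<xi> in at_right 0. W \<xi> = U" for U
  proof -
    have "((\<lambda>_. U) \<longlongrightarrow> V) (at_right (0 :: real))"
      using lim ev by (rule Lim_transform_eventually)
    then have "V = U"
      by (simp add: tendsto_const_iff)
    moreover obtain \<xi> where "W \<xi> = U"
      using eventually_happens'[OF _ ev] by auto
    ultimately show ?thesis
      using WD by blast
  qed
  have rare: "V \<in> D" if "\<forall>\<^sub>F \<xi> in at_right 0. snd (W \<xi>) + s * sqrt (\<gamma> * \<kappa>) * fst (W \<xi>) powr \<theta> = \<xi>" for s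
  proof -
    have "0 \<le> fst V"
      by (rule tendsto_lowerbound[OF tendsto_fst[OF lim]]) (use D_nonneg[OF WD] in auto)
    then show ?thesis
      using char_limit_vacuum[OF lim WD _ that] by (cases "fst V = 0") (auto simp: D_def)
  qed
  obtain Um a1 b1 a2 b2 where f: "a1 \<le> b1" "b1 \<le> a2" "a2 \<le> b2"
    "\<forall>\<xi><a1. W \<xi> = Ul"
    "Ul = Um \<and> a1 = b1 \<or> lax_shock1 \<kappa> \<gamma> Ul Um a1 \<and> a1 = b1 \<or> rarefaction1 \<kappa> \<gamma> Ul Um a1 b1 W"
    "\<forall>\<xi>\<in>{b1<..<a2}. W \<xi> = Um"
    "Um = Ur \<and> a2 = b2 \<or> lax_shock2 \<kappa> \<gamma> Um Ur a2 \<and> a2 = b2 \<or> rarefaction2 \<kappa> \<gamma> Um Ur a2 b2 W"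
    "\<forall>\<xi>>b2. W \<xi> = Ur"
    using fan unfolding lax_fan_def by blast
  have near: "\<forall>\<^sub>F \<xi> in at_right 0. P \<xi>" if "0 < r" "\<And>\<xi>. 0 < \<xi> \<Longrightarrow> \<xi> < r \<Longrightarrow> P \<xi>" for P and r :: real
    using that by (auto simp: eventually_at_right_field)
  \<comment> \<open>Strict and weak inequalities are placed so that a right neighbourhood of 0 lies
    within a single piece of the fan, avoiding the unspecified edge values.\<close>
  consider "0 < a1" | "a1 \<le> 0" "0 < b1" | "b1 \<le> 0" "0 < a2" | "a2 \<le> 0" "0 < b2" | "b2 \<le> 0"
    by linarith
  then show ?thesis
  proof cases
    case 1
    then show ?thesis
      using f(4) by (intro const[OF near]) auto
  next
    case 2
    then have "\<forall>\<xi>\<in>{a1<..<b1}. char1 \<kappa> \<gamma> (W \<xi>) = \<xi>"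
      using f(5) by (auto simp: rarefaction1_def)
    then have "char1 \<kappa> \<gamma> (W \<xi>) = \<xi>" if "0 < \<xi>" "\<xi> < b1" for \<xi>
      using that 2 by simp
    then have "snd (W \<xi>) + (- 1) * sqrt (\<gamma> * \<kappa>) * fst (W \<xi>) powr \<theta> = \<xi>" if "0 < \<xi>" "\<xi> < b1" for \<xi>
      using that by (cases "W \<xi>") fastforce
    then show ?thesis
      by (intro rare[OF near[OF 2(2)]])
  next
    case 3
    then show ?thesis
      using f(6) by (intro const[OF near[OF 3(2)]]) auto
  next
    case 4
    then have "\<forall>\<xi>\<in>{a2<..<b2}. char2 \<kappa> \<gamma> (W \<xi>) = \<xi>"
      using f(7) by (auto simp: rarefaction2_def)
    then have "char2 \<kappa> \<gamma> (W \<xi>) = \<xi>" if "0 < \<xi>" "\<xi> < b2" for \<xi>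
      using that 4 by simp
    then have "snd (W \<xi>) + 1 * sqrt (\<gamma> * \<kappa>) * fst (W \<xi>) powr \<theta> = \<xi>" if "0 < \<xi>" "\<xi> < b2" for \<xi>
      using that by (cases "W \<xi>") fastforce
    then show ?thesis
      by (intro rare[OF near[OF 4(2)]])
  next
    case 5
    then show ?thesis
      using f(8) by (intro const[OF near[of 1]]) auto
  qed
qed

section \<open>Smallness of the excess near the initial time\<close>

definition region :: "real \<Rightarrow> state \<Rightarrow> bool" where
  "region \<omega> V \<longleftrightarrow> - \<omega> \<le> omega1 \<kappa> \<gamma> V \<and> omega1 \<kappa> \<gamma> V < omega2 \<kappa> \<gamma> V \<and> omega2 \<kappa> \<gamma> V \<le> \<omega>"

lemma region_iff: "region \<omega> V \<longleftrightarrow> \<bar>snd V\<bar> + rad V \<le> \<omega> \<and> 0 < rad V"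
  by (auto simp: region_def omega_eq)

lemma region_H_eq_0: "V \<in> D \<Longrightarrow> region \<omega> V \<Longrightarrow> excess \<omega> V = 0"
  using excess_le[OF D_nonneg, of V \<omega>] excess_nonneg[OF D_nonneg, of V \<omega>] by (simp add: region_iff)

text \<open>In conserved variables with m = \<rho> u, the bound for the excess is the positive part
  of \<bar>m\<bar> + a \<rho>^p - \<omega> \<rho>, p = 1 + \<theta>. This expression is nonpositive
  at \<open>W\<close>, and its three terms grow at rates at most 1, a p M^\<theta> and
  \<omega>.\<close>

lemma excess_le_conserved_dist:
  assumes V: "V \<in> D" "norm V \<le> M" and W: "W \<in> D" "region \<omega> W"
  shows "excess \<omega> V \<le> (1 + a * (1 + \<theta>) * M powr \<theta> + \<omega>) * norm (conserved V - conserved W)"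
proof (cases "fst V = 0")
  case True
  have "0 \<le> \<omega>"
    using W rad_nonneg[of W] unfolding region_iff by linarith
  then show ?thesis
    using True a_pos theta by (simp add: excess_def)
next
  case False
  define p where "p = 1 + \<theta>"
  define N where "N = norm (conserved V - conserved W)"
  obtain \<rho> u \<rho>' u' where eq: "V = (\<rho>, u)" "W = (\<rho>', u')"
    by (metis surj_pair)
  have \<rho>: "0 < \<rho>" "\<rho> \<le> M" "0 \<le> \<rho>'" and \<omega>: "0 \<le> \<omega>"
    using V W D_nonneg[OF V(1)] D_nonneg[OF W(1)] False norm_fst_le[of \<rho> u] rad_nonneg[of W]
    unfolding region_iff by (auto simp: eq)
  have N: "\<bar>\<rho> - \<rho>'\<bar> \<le> N" "\<bar>\<rho> * u - \<rho>' * u'\<bar> \<le> N"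
    using norm_fst_le[of "\<rho> - \<rho>'" "\<rho> * u - \<rho>' * u'"] norm_snd_le[of "\<rho> * u - \<rho>' * u'" "\<rho> - \<rho>'"]
    by (auto simp: N_def eq)
  have pw: "r * (a * r powr \<theta>) = a * r powr p" if "0 \<le> r" for r
    using that by (cases "r = 0") (auto simp: p_def powr_add)
  have rad: "\<rho> * rad V = a * \<rho> powr p" "\<rho>' * rad W = a * \<rho>' powr p"
    unfolding rad_def eq fst_conv by (rule pw, use \<rho> in linarith)+
  \<comment> \<open>The tangent is taken at \<rho>, the density of \<open>V\<close>, so only the
    bound on \<open>V\<close> enters the constant.\<close>
  have "\<rho> powr p - \<rho>' powr p \<le> p * \<rho> powr \<theta> * (\<rho> - \<rho>')"
    using powr_tangent_le[of p \<rho>' \<rho>] \<rho> theta by (simp add: p_def algebra_simps)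
  also have "\<dots> \<le> p * \<rho> powr \<theta> * N"
    using theta N by (intro mult_left_mono) (auto simp: p_def)
  also have "\<dots> \<le> p * M powr \<theta> * N"
    using \<rho> theta N by (intro mult_right_mono mult_left_mono powr_mono2) (auto simp: p_def)
  finally have powr: "a * \<rho> powr p - a * \<rho>' powr p \<le> a * (p * M powr \<theta> * N)"
    using a_pos by (simp flip: right_diff_distrib)
  have "\<rho>' * (\<bar>u'\<bar> + rad W) \<le> \<rho>' * \<omega>"
    using W \<rho> by (intro mult_left_mono) (auto simp: region_iff eq)
  then have W0: "\<bar>\<rho>' * u'\<bar> + a * \<rho>' powr p - \<omega> * \<rho>' \<le> 0"
    using \<rho> rad(2) by (simp add: eq algebra_simps abs_mult)
  have "excess \<omega> V \<le> \<rho> * max 0 (\<bar>u\<bar> + rad V - \<omega>)"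
    using excess_le[OF D_nonneg[OF V(1)]] by (simp add: eq)
  also have "\<dots> = max 0 (\<bar>\<rho> * u\<bar> + a * \<rho> powr p - \<omega> * \<rho>)"
    using \<rho> unfolding rad(1)[symmetric] by (simp add: max_mult_distrib_left abs_mult algebra_simps)
  also have "\<dots> \<le> N + a * (p * M powr \<theta> * N) + \<omega> * N"
  proof (rule max.boundedI)
    have "0 \<le> N"
      by (simp add: N_def)
    then show "0 \<le> N + a * (p * M powr \<theta> * N) + \<omega> * N"
      using a_pos theta \<omega> by (intro add_nonneg_nonneg mult_nonneg_nonneg) (auto simp: p_def)
    have "\<omega> * (\<rho>' - \<rho>) \<le> \<omega> * N"
      using \<omega> N(1) by (intro mult_left_mono) auto
    moreover have "\<omega> * (\<rho>' - \<rho>) = \<omega> * \<rho>' - \<omega> * \<rho>"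
      by (simp add: right_diff_distrib)
    ultimately show "\<bar>\<rho> * u\<bar> + a * \<rho> powr p - \<omega> * \<rho> \<le> N + a * (p * M powr \<theta> * N) + \<omega> * N"
      using powr W0 N(2) by linarith
  qed
  also have "\<dots> = (1 + a * (1 + \<theta>) * M powr \<theta> + \<omega>) * N"
    by (simp add: p_def algebra_simps)
  finally show ?thesis
    by (simp add: N_def)
qed

text \<open>Convergence of the conserved variables in L^1 as t tends to 0 carries over to the excess
  by the preceding estimate, because the initial data lie in the region almost everywhere.\<close>

lemma cauchy_initial_entropy:
  assumes sol: "weak_solution \<kappa> \<gamma> T {0<..} U" and T: "0 < T"
    and reg: "AE x in lborel. 0 < x \<longrightarrow> region \<omega> (Uhat x)"
    and UhatD: "AE x in lborel. 0 < x \<longrightarrow> Uhat x \<in> D"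
    and UD: "\<And>t. 0 \<le> t \<Longrightarrow> ereal t \<le> T \<Longrightarrow> AE x in lborel. 0 < x \<longrightarrow> U t x \<in> D"
    and int: "\<And>t. 0 \<le> t \<Longrightarrow> ereal t \<le> T \<Longrightarrow> set_integrable lborel {0<..} (\<lambda>x. conserved (U t x) - Uc)"
    and int0: "set_integrable lborel {0<..} (\<lambda>x. conserved (Uhat x) - Uc)"
    and lim: "((\<lambda>t. LINT x:{0<..}|lborel. norm (conserved (U t x) - conserved (Uhat x))) \<longlongrightarrow> 0) (at_right 0)"
    and e: "0 < e"
  shows "\<exists>\<delta>>0. AE t in lborel. 0 < t \<and> t < \<delta> \<longrightarrow> (LINT x:{0<..<R}|lborel. excess \<omega> (U t x)) \<le> e"
proof -
  obtain \<tau> :: real where \<tau>: "0 < \<tau>" "ereal \<tau> < T"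
    using ereal_dense2[OF T] by auto
  have "\<forall>\<tau>. ereal \<tau> < T \<longrightarrow> (\<exists>M. AE (t, x) in lborel. (t, x) \<in> cylinder (ereal \<tau>) {0<..} \<longrightarrow> norm (U t x) \<le> M)"
    using sol unfolding weak_solution_def by blast
  then obtain M where M: "AE (t, x) in lborel. (t, x) \<in> cylinder (ereal \<tau>) {0<..} \<longrightarrow> norm (U t x) \<le> M"
    using \<tau> by blast
  have M': "AE t in lborel. AE x in lborel. (t, x) \<in> cylinder (ereal \<tau>) {0<..} \<longrightarrow> norm (U t x) \<le> M"
    using lborel_pair.AE_pair[unfolded lborel_prod, OF M] by simp
  define L where "L = \<bar>1 + a * (1 + \<theta>) * M powr \<theta> + \<omega>\<bar> + 1"
  have L: "0 < L"
    by (simp add: L_def)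
  have "\<forall>\<^sub>F t in at_right 0. (LINT x:{0<..}|lborel. norm (conserved (U t x) - conserved (Uhat x))) < e / L"
    using lim L e by (intro order_tendstoD(2)[OF lim]) simp
  then obtain \<delta> where \<delta>: "0 < \<delta>"
    "\<And>t. 0 < t \<Longrightarrow> t < \<delta> \<Longrightarrow> (LINT x:{0<..}|lborel. norm (conserved (U t x) - conserved (Uhat x))) < e / L"
    by (auto simp: eventually_at_right_field)
  show ?thesis
  proof (intro exI[of _ "min \<delta> \<tau>"] conjI)
    show "0 < min \<delta> \<tau>"
      using \<delta> \<tau> by simp
    show "AE t in lborel. 0 < t \<and> t < min \<delta> \<tau> \<longrightarrow> (LINT x:{0<..<R}|lborel. excess \<omega> (U t x)) \<le> e"
      using M'
    proof eventually_elim
      case (elim t)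
      show ?case
      proof
        assume t: "0 < t \<and> t < min \<delta> \<tau>"
        then have tT: "0 \<le> t" "ereal t \<le> T"
          using less_trans[OF _ \<tau>(2), of "ereal t"] by (auto intro: less_imp_le)
        have dist_int: "integrable lborel (\<lambda>x. L * (indicator {0<..} x *\<^sub>R norm (conserved (U t x) - conserved (Uhat x))))"
        proof -
          have "set_integrable lborel {0<..} (\<lambda>x. (conserved (U t x) - Uc) - (conserved (Uhat x) - Uc))"
            by (rule set_integral_diff(1)[OF int[OF tT] int0])
          then have "set_integrable lborel {0<..} (\<lambda>x. norm (conserved (U t x) - conserved (Uhat x)))"
            by (simp add: set_integrable_norm)
          then show ?thesis
            by (simp add: set_integrable_def)
        qed
        have "(LINT x:{0<..<R}|lborel. excess \<omega> (U t x)) \<le>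
            L * (LINT x:{0<..}|lborel. norm (conserved (U t x) - conserved (Uhat x)))"
        proof (cases "integrable lborel (\<lambda>x. indicator {0<..<R} x *\<^sub>R excess \<omega> (U t x))")
          case True
          have "(LINT x:{0<..<R}|lborel. excess \<omega> (U t x)) \<le>
              (LINT x|lborel. L * (indicator {0<..} x *\<^sub>R norm (conserved (U t x) - conserved (Uhat x))))"
            unfolding set_lebesgue_integral_def
          proof (rule integral_mono_AE[OF True dist_int])
            show "AE x in lborel. indicator {0<..<R} x *\<^sub>R excess \<omega> (U t x) \<le>
                L * (indicator {0<..} x *\<^sub>R norm (conserved (U t x) - conserved (Uhat x)))"
              using elim reg UhatD UD[OF tT]
            proof eventually_elim
              case (elim x)
              show ?case
              proof (cases "0 < x")
                case True
                then have "excess \<omega> (U t x) \<le> (1 + a * (1 + \<theta>) * M powr \<theta> + \<omega>) * norm (conserved (U t x) - conserved (Uhat x))"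
                  using elim t by (intro excess_le_conserved_dist) (auto simp: cylinder_def)
                also have "\<dots> \<le> L * norm (conserved (U t x) - conserved (Uhat x))"
                  by (intro mult_right_mono) (auto simp: L_def)
                finally show ?thesis
                  using True L by (auto simp: indicator_def)
              qed simp
            qed
          qed
          then show ?thesis
            by (simp add: set_lebesgue_integral_def)
        next
          case False
          then show ?thesis
            using L by (simp add: set_lebesgue_integral_def not_integrable_integral_eq)
        qed
        also have "\<dots> \<le> L * (e / L)"
          using \<delta>(2)[of t] t L by (intro mult_left_mono) auto
        finally show "(LINT x:{0<..<R}|lborel. excess \<omega> (U t x)) \<le> e"
          using L by simp
      qed
    qed
  qed
qed

text \<open>Beyond x = B t the solution already equals the initial state, whose excess is 0; the
  remaining interval shrinks with t while the excess stays bounded.\<close>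

lemma riemann_initial_entropy:
  assumes fan: "lax_fan \<kappa> \<gamma> Ul Ur W" and sol: "weak_solution \<kappa> \<gamma> \<infinity> UNIV (\<lambda>t x. W (x / t))"
    and UW: "\<And>t x. 0 < t \<Longrightarrow> 0 < x \<Longrightarrow> U t x = W (x / t)"
    and Ur: "Ur \<in> D" "region \<omega> Ur" and e: "0 < e"
  shows "\<exists>\<delta>>0. AE t in lborel. 0 < t \<and> t < \<delta> \<longrightarrow> (LINT x:{0<..<R}|lborel. excess \<omega> (U t x)) \<le> e"
proof -
  have WD: "W \<xi> \<in> D" for \<xi>
    using fan by (simp add: lax_fan_def)
  obtain b where b: "\<And>\<xi>. b < \<xi> \<Longrightarrow> W \<xi> = Ur"
    using fan by (auto simp: lax_fan_def)
  have "\<forall>\<tau>. ereal \<tau> < \<infinity> \<longrightarrow> (\<exists>M. AE (t, x) in lborel. (t, x) \<in> cylinder (ereal \<tau>) UNIV \<longrightarrow> norm (W (x / t)) \<le> M)"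
    using sol unfolding weak_solution_def by blast
  moreover have "ereal 1 < \<infinity>"
    by simp
  ultimately obtain M where M: "AE (t, x) in lborel. (t, x) \<in> cylinder (ereal 1) UNIV \<longrightarrow> norm (W (x / t)) \<le> M"
    by blast
  have M': "AE t in lborel. AE x in lborel. (t, x) \<in> cylinder (ereal 1) UNIV \<longrightarrow> norm (W (x / t)) \<le> M"
    using lborel_pair.AE_pair[unfolded lborel_prod, OF M] by simp
  obtain C where C: "\<And>V. V \<in> D \<Longrightarrow> norm V \<le> M \<Longrightarrow> \<bar>excess \<omega> V - 0 * fst V\<bar> \<le> C"
    using bounded_on_states by blast
  define B where "B = \<bar>b\<bar> + 1"
  \<comment> \<open>The cap 1 is the end time of the cylinder on which M bounds the solution; the
    quotient makes B t (\<bar>C\<bar> + 1) at most e.\<close>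
  define \<delta> where "\<delta> = min 1 (e / (B * (\<bar>C\<bar> + 1)))"
  have B: "0 < B" "b < B"
    by (auto simp: B_def)
  have \<delta>: "0 < \<delta>"
    using B e by (simp add: \<delta>_def)
  show ?thesis
  proof (intro exI[of _ \<delta>] conjI \<delta>)
    show "AE t in lborel. 0 < t \<and> t < \<delta> \<longrightarrow> (LINT x:{0<..<R}|lborel. excess \<omega> (U t x)) \<le> e"
      using M'
    proof eventually_elim
      case (elim t)
      show ?case
      proof
        assume t: "0 < t \<and> t < \<delta>"
        show "(LINT x:{0<..<R}|lborel. excess \<omega> (U t x)) \<le> e"
        proof (cases "integrable lborel (\<lambda>x. indicator {0<..<R} x *\<^sub>R excess \<omega> (U t x))")
          case True
          have "(LINT x:{0<..<R}|lborel. excess \<omega> (U t x)) \<le> (LINT x|lborel. indicator {0..B * t} x * (\<bar>C\<bar> + 1))"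
            unfolding set_lebesgue_integral_def
          proof (rule integral_mono_AE[OF True])
            show "integrable lborel (\<lambda>x. indicator {0..B * t} x * (\<bar>C\<bar> + 1))"
              using B t by (intro integrable_mult_left integrable_real_indicator) (auto simp: emeasure_lborel_Icc_eq)
            show "AE x in lborel. indicator {0<..<R} x *\<^sub>R excess \<omega> (U t x) \<le> indicator {0..B * t} x * (\<bar>C\<bar> + 1)"
              using elim
            proof eventually_elim
              case (elim x)
              show ?case
              proof (cases "0 < x \<and> x < R")
                case x: True
                show ?thesis
                proof (cases "x \<le> B * t")
                  case True
                  have "norm (W (x / t)) \<le> M"
                    using elim t by (auto simp: cylinder_def \<delta>_def)
                  then have "excess \<omega> (U t x) \<le> C"
                    using C[OF WD, of "x / t"] UW t x by auto
                  then show ?thesis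
                    using True x by (auto simp: indicator_def)
                next
                  case False
                  then have "B < x / t"
                    using t by (simp add: field_simps)
                  then have "U t x = Ur"
                    using b[of "x / t"] UW t x B by simp
                  then show ?thesis
                    using region_H_eq_0[OF Ur] by simp
                qed
              qed (auto simp: indicator_def)
            qed
          qed
          also have "\<dots> = B * t * (\<bar>C\<bar> + 1)"
            using B t by simp
          also have "\<dots> \<le> B * (e / (B * (\<bar>C\<bar> + 1))) * (\<bar>C\<bar> + 1)"
            using t B by (intro mult_right_mono mult_left_mono) (auto simp: \<delta>_def)
          also have "\<dots> = e"
            using B by (simp add: field_simps add_nonneg_eq_0_iff)
          finally show ?thesis .
        next
          case False
          then show ?thesis
            using e by (simp add: set_lebesgue_integral_def not_integrable_integral_eq)
        qed
      qed
    qed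
  qed
qed

text \<open>The common state at rest from the definition serves as \<rho>s at every time. What needs
  an argument is that the spatial traces are admissible elements of \<open>V_set\<close>.\<close>

lemma generalized_riemann_region:
  assumes A: "\<And>k. k \<in> {1..d} \<Longrightarrow> 0 < A k" and \<omega>: "0 \<le> \<omega>"
    and sol: "generalized_riemann_solution \<kappa> \<gamma> d A c U"
    and reg: "\<And>k. k \<in> {1..d} \<Longrightarrow> region \<omega> (c k)"
    and k: "k \<in> {1..d}"
  shows "AE (t, x) in lborel. 0 < t \<and> ereal t < \<infinity> \<and> 0 < x \<longrightarrow>
           - \<omega> \<le> omega1 \<kappa> \<gamma> (U k t x) \<and>
           (U k t x \<noteq> (0, 0) \<longrightarrow> omega1 \<kappa> \<gamma> (U k t x) < omega2 \<kappa> \<gamma> (U k t x)) \<and>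
           omega2 \<kappa> \<gamma> (U k t x) \<le> \<omega>"
proof -
  have cD: "\<And>k. k \<in> {1..d} \<Longrightarrow> c k \<in> D"
    using sol by (simp add: generalized_riemann_solution_def)
  obtain \<rho>s where \<rho>s: "0 \<le> \<rho>s"
    and "\<forall>k\<in>{1..d}. \<exists>W. riemann_solution \<kappa> \<gamma> (\<rho>s, 0) (c k) W \<and> (\<forall>t>0. \<forall>x>0. U k t x = W (x / t))"
    using sol unfolding generalized_riemann_solution_def by blast
  from bchoice[OF this(2)] obtain W where W: "\<And>k. k \<in> {1..d} \<Longrightarrow> riemann_solution \<kappa> \<gamma> (\<rho>s, 0) (c k) (W k)"
    and UW: "\<And>k t x. k \<in> {1..d} \<Longrightarrow> 0 < t \<Longrightarrow> 0 < x \<Longrightarrow> U k t x = W k (x / t)"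
    by blast
  have fan: "lax_fan \<kappa> \<gamma> (\<rho>s, 0) (c k) (W k)"
    and wes: "weak_entropy_solution \<kappa> \<gamma> \<infinity> UNIV (\<lambda>t x. W k (x / t))" if "k \<in> {1..d}" for k
    using W[OF that] by (simp_all add: riemann_solution_def)
  show ?thesis
  proof (rule invariant_region[OF A \<omega> _ _ _ k])
    show "weak_entropy_solution \<kappa> \<gamma> \<infinity> {0<..} (U k)" if "k \<in> {1..d}" for k
      by (rule weak_entropy_solution_restrict[OF wes[OF that]]) (auto simp: cylinder_def UW[OF that])
    show "\<exists>\<delta>>0. AE t in lborel. 0 < t \<and> t < \<delta> \<longrightarrow> (LINT x:{0<..<R}|lborel. excess \<omega> (U k t x)) \<le> e"
      if "k \<in> {1..d}" "0 < e" for k R e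
      using wes[OF that(1)]
      by (intro riemann_initial_entropy[OF fan[OF that(1)] _ UW[OF that(1)] cD[OF that(1)] reg[OF that(1)] that(2)])
         (simp_all add: weak_entropy_solution_def)
    have "AE t in lborel. 0 < t \<longrightarrow>
        (\<exists>Ubar. (\<forall>k\<in>{1..d}. (U k t \<longlongrightarrow> Ubar k) (at_right 0)) \<and> (\<Sum>k=1..d. A k * fst (Ubar k) * snd (Ubar k)) = 0)"
      using sol by (simp add: generalized_riemann_solution_def)
    then show "AE t in lborel. 0 < t \<and> ereal t < \<infinity> \<longrightarrow>
        (\<exists>\<rho>s\<ge>0. \<exists>Ubar.
           (\<forall>k\<in>{1..d}. has_right_trace (U k t) (Ubar k) \<and> Ubar k \<in> V_set \<kappa> \<gamma> (\<rho>s, 0)) \<and>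
           (\<Sum>k=1..d. A k * fst (Ubar k) * snd (Ubar k)) = 0)"
    proof eventually_elim
      case (elim t)
      show ?case
      proof
        assume t: "0 < t \<and> ereal t < \<infinity>"
        then obtain Ubar where lim: "\<And>k. k \<in> {1..d} \<Longrightarrow> (U k t \<longlongrightarrow> Ubar k) (at_right 0)"
          and sum: "(\<Sum>k=1..d. A k * fst (Ubar k) * snd (Ubar k)) = 0"
          using elim by blast
        have "has_right_trace (U k t) (Ubar k) \<and> Ubar k \<in> V_set \<kappa> \<gamma> (\<rho>s, 0)" if k: "k \<in> {1..d}" for k
        proof
          show "has_right_trace (U k t) (Ubar k)"
            unfolding has_right_trace_def
          proof (intro allI impI)
            fix e :: real assume "0 < e"
            then have "\<forall>\<^sub>F x in at_right 0. dist (U k t x) (Ubar k) < e"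
              using lim[OF k] by (simp add: tendsto_iff)
            then show "\<exists>\<delta>>0. AE x in lborel. 0 < x \<and> x < \<delta> \<longrightarrow> dist (U k t x) (Ubar k) < e"
              by (auto simp: eventually_at_right_field)
          qed
          \<comment> \<open>At a fixed time t, the substitution x = t \<xi> turns the trace of the
            solution into the limit of the profile at 0+.\<close>
          have "filterlim (\<lambda>\<xi>. t * \<xi>) (at_right 0) (at_right 0)"
            using t by (intro filterlim_times_pos[of _ 0 _ t 0] filterlim_ident) auto
          from filterlim_compose[OF lim[OF k] this]
          have "((\<lambda>\<xi>. U k t (t * \<xi>)) \<longlongrightarrow> Ubar k) (at_right 0)" .
          moreover have "\<forall>\<^sub>F \<xi> in at_right 0. U k t (t * \<xi>) = W k \<xi>"
            using t UW[OF k] by (auto simp: eventually_at_right_field intro!: exI[of _ 1])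
          ultimately have W_lim: "(W k \<longlongrightarrow> Ubar k) (at_right 0)"
            by (rule Lim_transform_eventually)
          then show "Ubar k \<in> V_set \<kappa> \<gamma> (\<rho>s, 0)"
            using lax_fan_limit_in_D[OF fan[OF k] W_lim] W[OF k] cD[OF k] by (auto simp: V_set_def)
        qed
        then show "\<exists>\<rho>s\<ge>0. \<exists>Ubar.
           (\<forall>k\<in>{1..d}. has_right_trace (U k t) (Ubar k) \<and> Ubar k \<in> V_set \<kappa> \<gamma> (\<rho>s, 0)) \<and>
           (\<Sum>k=1..d. A k * fst (Ubar k) * snd (Ubar k)) = 0"
          using \<rho>s sum by blast
      qed
    qed
  qed
qed

lemma generalized_cauchy_region:
  assumes A: "\<And>k. k \<in> {1..d} \<Longrightarrow> 0 < A k" and \<omega>: "0 \<le> \<omega>"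
    and sol: "generalized_cauchy_solution \<kappa> \<gamma> d A T U0 Uhat U"
    and reg: "\<And>k. k \<in> {1..d} \<Longrightarrow> AE x in lborel. 0 < x \<longrightarrow> region \<omega> (Uhat k x)"
    and k: "k \<in> {1..d}"
  shows "AE (t, x) in lborel. 0 < t \<and> ereal t < T \<and> 0 < x \<longrightarrow>
           - \<omega> \<le> omega1 \<kappa> \<gamma> (U k t x) \<and>
           (U k t x \<noteq> (0, 0) \<longrightarrow> omega1 \<kappa> \<gamma> (U k t x) < omega2 \<kappa> \<gamma> (U k t x)) \<and>
           omega2 \<kappa> \<gamma> (U k t x) \<le> \<omega>"
proof (rule invariant_region[OF A \<omega> _ _ _ k])
  note sol' = sol[unfolded generalized_cauchy_solution_def]
  show "AE t in lborel. 0 < t \<and> ereal t < T \<longrightarrow>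
        (\<exists>\<rho>s\<ge>0. \<exists>Ubar.
           (\<forall>k\<in>{1..d}. has_right_trace (U k t) (Ubar k) \<and> Ubar k \<in> V_set \<kappa> \<gamma> (\<rho>s, 0)) \<and>
           (\<Sum>k=1..d. A k * fst (Ubar k) * snd (Ubar k)) = 0)"
    by (rule conjunct2[OF conjunct2[OF sol']])
  fix k assume k: "k \<in> {1..d}"
  from bspec[OF conjunct1[OF conjunct2[OF sol']] k]
  have UhatD: "AE x in lborel. 0 < x \<longrightarrow> Uhat k x \<in> D"
    and int0: "set_integrable lborel {0<..} (\<lambda>x. conserved (Uhat k x) - U0 k)"
    and U: "\<forall>t. 0 \<le> t \<and> ereal t \<le> T \<longrightarrow>
           (AE x in lborel. 0 < x \<longrightarrow> U k t x \<in> D) \<and>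
           set_integrable lborel {0<..} (\<lambda>x. conserved (U k t x) - U0 k) \<and>
           ((\<lambda>s. LINT x:{0<..}|lborel. norm (conserved (U k s x) - conserved (U k t x))) \<longlongrightarrow> 0)
             (at t within {s. 0 \<le> s \<and> ereal s \<le> T})"
    and wes: "weak_entropy_solution \<kappa> \<gamma> T {0<..} (U k)"
    and lim: "((\<lambda>t. LINT x:{0<..}|lborel. norm (conserved (U k t x) - conserved (Uhat k x))) \<longlongrightarrow> 0) (at_right 0)"
    by - (elim conjE, assumption)+
  show "weak_entropy_solution \<kappa> \<gamma> T {0<..} (U k)"
    by (rule wes)
  fix R e :: real
  assume e: "0 < e"
  show "\<exists>\<delta>>0. AE t in lborel. 0 < t \<and> t < \<delta> \<longrightarrow> (LINT x:{0<..<R}|lborel. excess \<omega> (U k t x)) \<le> e"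
  proof (rule cauchy_initial_entropy[OF _ conjunct1[OF sol'] reg[OF k] UhatD _ _ int0 lim e])
    show "weak_solution \<kappa> \<gamma> T {0<..} (U k)"
      using wes unfolding weak_entropy_solution_def by (rule conjunct1)
    show "AE x in lborel. 0 < x \<longrightarrow> U k t x \<in> D"
      "set_integrable lborel {0<..} (\<lambda>x. conserved (U k t x) - U0 k)" if "0 \<le> t" "ereal t \<le> T" for t
      using mp[OF spec[OF U, of t] conjI[OF that]] by - (elim conjE, assumption)+
  qed
qed

end

text \<open>The strict inequality is conditional because the vacuum state (0, 0) makes both
  invariants equal to 0.\<close>

theorem corollary2:
  fixes \<kappa> \<gamma> \<omega>M :: real and d :: nat and A :: "nat \<Rightarrow> real" and T :: ereal
    and U0 :: "nat \<Rightarrow> real \<times> real"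
    and Uhat :: "nat \<Rightarrow> real \<Rightarrow> state"
    and U :: "nat \<Rightarrow> real \<Rightarrow> real \<Rightarrow> state"
  assumes "0 < \<kappa>" and "1 < \<gamma>" and "\<gamma> < 3"
    and "\<And>k. k \<in> {1..d} \<Longrightarrow> 0 < A k"
    and "(T = \<infinity> \<and> (\<exists>c. (\<forall>k\<in>{1..d}. \<forall>x>0. Uhat k x = c k) \<and> generalized_riemann_solution \<kappa> \<gamma> d A c U)) \<or>
         generalized_cauchy_solution \<kappa> \<gamma> d A T U0 Uhat U"
    and "\<And>k. k \<in> {1..d} \<Longrightarrow> AE x in lborel. 0 < x \<longrightarrow>
           - \<omega>M \<le> omega1 \<kappa> \<gamma> (Uhat k x) \<and>
           omega1 \<kappa> \<gamma> (Uhat k x) < omega2 \<kappa> \<gamma> (Uhat k x) \<and>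
           omega2 \<kappa> \<gamma> (Uhat k x) \<le> \<omega>M"
  shows "\<forall>k\<in>{1..d}. AE (t, x) in lborel. 0 < t \<and> ereal t < T \<and> 0 < x \<longrightarrow>
           - \<omega>M \<le> omega1 \<kappa> \<gamma> (U k t x) \<and>
           (U k t x \<noteq> (0, 0) \<longrightarrow> omega1 \<kappa> \<gamma> (U k t x) < omega2 \<kappa> \<gamma> (U k t x)) \<and>
           omega2 \<kappa> \<gamma> (U k t x) \<le> \<omega>M"
proof
  fix k assume k: "k \<in> {1..d}"
  interpret isentropic_gas \<kappa> \<gamma>
    by standard fact+
  have reg: "AE x in lborel. 0 < x \<longrightarrow> region \<omega>M (Uhat k x)" if "k \<in> {1..d}" for k
    using assms(6)[OF that] by (simp add: region_def)
  have witness: "\<exists>x>0. region \<omega>M (Uhat k x)" if "k \<in> {1..d}" for k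
  proof -
    have "AE x in lborel. 0 < x \<and> x < 1 \<longrightarrow> region \<omega>M (Uhat k x)"
      using reg[OF that] by eventually_elim simp
    from AE_lborel_interval_witness[OF _ this] show ?thesis
      by auto
  qed
  \<comment> \<open>The initial bounds at a single point already force -\<omega>M <
    \<omega>M.\<close>
  have \<omega>: "0 \<le> \<omega>M"
    using witness[OF k] unfolding region_def by linarith
  from assms(5) show "AE (t, x) in lborel. 0 < t \<and> ereal t < T \<and> 0 < x \<longrightarrow>
           - \<omega>M \<le> omega1 \<kappa> \<gamma> (U k t x) \<and>
           (U k t x \<noteq> (0, 0) \<longrightarrow> omega1 \<kappa> \<gamma> (U k t x) < omega2 \<kappa> \<gamma> (U k t x)) \<and>
           omega2 \<kappa> \<gamma> (U k t x) \<le> \<omega>M"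
  proof
    assume "T = \<infinity> \<and> (\<exists>c. (\<forall>k\<in>{1..d}. \<forall>x>0. Uhat k x = c k) \<and> generalized_riemann_solution \<kappa> \<gamma> d A c U)"
    then obtain c where T: "T = \<infinity>" and c: "\<And>k x. k \<in> {1..d} \<Longrightarrow> 0 < x \<Longrightarrow> Uhat k x = c k"
      and sol: "generalized_riemann_solution \<kappa> \<gamma> d A c U"
      by blast
    \<comment> \<open>The data are constant for x > 0, so one point at which the almost-everywhere
      bound holds is enough.\<close>
    have "region \<omega>M (c k)" if "k \<in> {1..d}" for k
      using witness[OF that] c[OF that] by auto
    from generalized_riemann_region[OF assms(4) \<omega> sol this k] show ?thesis
      by (simp only: T)
  next
    assume "generalized_cauchy_solution \<kappa> \<gamma> d A T U0 Uhat U"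
    from generalized_cauchy_region[OF assms(4) \<omega> this reg k] show ?thesis .
  qed
qed

end
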